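(* (a) $(\mathcal{H}(\mathbb{C}^{\mathbb{N}}),\tau_0)=(\mathcal{H}(\mathbb{C}^{\mathbb{N}}),\tau_\omega)\neq(\mathcal{H}(\mathbb{C}^{\mathbb{N}}),\tau_\delta)=\mathcal{H}_{ub}(\mathbb{C}^{\mathbb{N}})$; that is, on $\mathcal{H}(\mathbb{C}^{\mathbb{N}})$ the topologies $\tau_0$ and $\tau_\omega$ coincide, they differ from $\tau_\delta$, and $(\mathcal{H}(\mathbb{C}^{\mathbb{N}}),\tau_\delta)$ and $\mathcal{H}_{ub}(\mathbb{C}^{\mathbb{N}})$ coincide as vector spaces and as topological spaces. (b) For each $a\in\mathbb{C}^{\mathbb{N}}$, the translation operator $\tau_a$, given by $(\tau_a f)(x)=f(x-a)$, is a convolution operator on $(\mathcal{H}(\mathbb{C}^{\mathbb{N}}),\tau)$ which is not hypercyclic, for each of $\tau=\tau_0$, $\tau=\tau_\omega$ and $\tau=\tau_\delta$.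
   Context: $\mathbb{C}^{\mathbb{N}}$ carries the product topology. For a locally convex space $E$, $\mathcal{H}(E)$ is the vector space of all holomorphic functions $f\colon E\to\mathbb{C}$. Topologies on $\mathcal{H}(E)$: - $\tau_0$ is the compact-open topology. - $\tau_\omega$ (Nachbin's compact-ported topology) is generated by all seminorms $q$ on $\mathcal{H}(E)$ for which there is a compact set $K\subset E$ such that for every open $V\supset K$ there is $c(V)>0$ with $q(f)\le c(V)\sup_{V}|f|$ for all $f\in\mathcal{H}(E)$. - $\tau_\delta$ (the bornological topology of Coeuré and Nachbin) is generated by all seminorms $q$ on $\mathcal{H}(E)$ such that for every increasing countable open cover $(V_n)_{n}$ of $E$ there are $n_0$ and $C>0$ with $q(f)\le C\sup_{V_{n_0}}|f|$ for all $f\in\mathcal{H}(E)$. The space $\mathcal{H}_{ub}(E)$: let $cs(E)$ be the set of continuous seminorms on $E$. For $p\in cs(E)$ let $E_p=(E,p)/p^{-1}(0)$ be the associated normed space and $\pi_p\colon E\to E_p$ the canonical surjection. For a normed space $X$, $\mathcal{H}_b(X)$ is the space of all $f\in\mathcal{H}(X)$ with $\lim_{m\to\infty}\bigl(\frac{1}{m!}\|\hat d^m f(0)\|\bigr)^{1/m}=0$, where $\frac{1}{m!}\hat d^m f(0)$ is the $m$-homogeneous Taylor polynomial of $f$ at $0$ and $\|\cdot\|$ is the sup norm on the unit ball. It is a Fréchet space with the seminorms $\|f\|_\rho=\sum_{m=0}^\infty\frac{\rho^m}{m!}\|\hat d^m f(0)\|$, $\rho>0$. Then $\mathcal{H}_{ub}(E)=\bigcup_{p\in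 cs(E)}\{f_p\circ\pi_p: f_p\in\mathcal{H}_b(E_p)\}$, endowed with the locally convex inductive topology with respect to the mappings $\pi_p^*\colon f_p\in\mathcal{H}_b(E_p)\mapsto f_p\circ\pi_p$, i.e. the finest locally convex topology making all $\pi_p^*$, $p\in cs(E)$, continuous. A convolution operator on $(\mathcal{H}(E),\tau)$ is a continuous linear mapping $L\colon\mathcal{H}(E)\to\mathcal{H}(E)$ with $L(\tau_b f)=\tau_b(Lf)$ for all $f\in\mathcal{H}(E)$ and $b\in E$. A continuous linear operator $T\colon X\to X$ on a topological vector space is hypercyclic if there is $x\in X$ whose orbit $\{x,T(x),T^2(x),\ldots\}$ is dense in $X$. *)

theory Defs
  imports "HOL-Analysis.Analysis"
begin

text \<open>
  Complex vector spaces are given by an explicit carrier, because the quotients \<open>E\<^sub>p\<close> depend on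
  a seminorm \<open>p\<close> and are therefore not types. A topological vector space is passed as a pair \<open>V T\<close>
  of a vector space and a topology with \<open>topspace T = vcarrier V\<close>. Functions on a carrier are
  \<open>extensional\<close>, so that equality of functions on a space is equality in HOL; if the carrier is
  \<open>UNIV\<close>, this is no restriction.
\<close>

record 'v cvec =
  vcarrier :: "'v set"
  vzero :: 'v
  vadd :: "'v \<Rightarrow> 'v \<Rightarrow> 'v"
  vscale :: "complex \<Rightarrow> 'v \<Rightarrow> 'v"

definition vminus :: "'v cvec \<Rightarrow> 'v \<Rightarrow> 'v \<Rightarrow> 'v" where
  "vminus V x y = vadd V x (vscale V (- 1) y)"

text \<open>Vector space operations (pointwise) on a set \<open>F\<close> of complex functions on \<open>C\<close>.\<close>

definition fun_space :: "'v set \<Rightarrow> ('v \<Rightarrow> complex) set \<Rightarrow> ('v \<Rightarrow> complex) cvec" where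
  "fun_space C F =
     \<lparr>vcarrier = F,
      vzero = (\<lambda>x\<in>C. 0),
      vadd = (\<lambda>f g. \<lambda>x\<in>C. f x + g x),
      vscale = (\<lambda>c f. \<lambda>x\<in>C. c * f x)\<rparr>"

subsection \<open>Seminorms and locally convex topologies\<close>

definition seminorm_on :: "'v cvec \<Rightarrow> ('v \<Rightarrow> real) \<Rightarrow> bool" where
  "seminorm_on V q \<longleftrightarrow>
     (\<forall>x\<in>vcarrier V. 0 \<le> q x) \<and>
     (\<forall>x\<in>vcarrier V. \<forall>y\<in>vcarrier V. q (vadd V x y) \<le> q x + q y) \<and>
     (\<forall>c. \<forall>x\<in>vcarrier V. q (vscale V c x) = cmod c * q x)"

definition seminorm_topology :: "'v cvec \<Rightarrow> ('v \<Rightarrow> real) set \<Rightarrow> 'v topology" where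
  "seminorm_topology V Q = topology_generated_by
     (insert (vcarrier V)
       {{y \<in> vcarrier V. q (vminus V y x) < r} | q x r. q \<in> Q \<and> x \<in> vcarrier V \<and> 0 < r})"

definition cs :: "'v cvec \<Rightarrow> 'v topology \<Rightarrow> ('v \<Rightarrow> real) set" where
  "cs V T = {p. seminorm_on V p \<and> continuous_map T euclideanreal p}"

definition vconvex :: "'v cvec \<Rightarrow> 'v set \<Rightarrow> bool" where
  "vconvex V A \<longleftrightarrow>
     (\<forall>x\<in>A. \<forall>y\<in>A. \<forall>t\<in>{0..1::real}.
        vadd V (vscale V (complex_of_real (1 - t)) x) (vscale V (complex_of_real t) y) \<in> A)"

definition locally_convex_topology :: "'v cvec \<Rightarrow> 'v topology \<Rightarrow> bool" where
  "locally_convex_topology V T \<longleftrightarrow>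
     topspace T = vcarrier V \<and>
     continuous_map (prod_topology T T) T (\<lambda>(x, y). vadd V x y) \<and>
     continuous_map (prod_topology euclidean T) T (\<lambda>(c, x). vscale V c x) \<and>
     (\<forall>U. openin T U \<and> vzero V \<in> U \<longrightarrow>
        (\<exists>W. openin T W \<and> vzero V \<in> W \<and> W \<subseteq> U \<and> vconvex V W))"

subsection \<open>Entire functions and the topologies on the space of entire functions\<close>

text \<open>Holomorphic means continuous and holomorphic along every complex line.\<close>

definition holo :: "'v cvec \<Rightarrow> 'v topology \<Rightarrow> ('v \<Rightarrow> complex) set" where
  "holo V T = {f \<in> extensional (vcarrier V).
     continuous_map T euclidean f \<and>
     (\<forall>x\<in>vcarrier V. \<forall>y\<in>vcarrier V.
        (\<lambda>z. f (vadd V x (vscale V z y))) holomorphic_on UNIV)}"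

definition holo_space :: "'v cvec \<Rightarrow> 'v topology \<Rightarrow> ('v \<Rightarrow> complex) cvec" where
  "holo_space V T = fun_space (vcarrier V) (holo V T)"

text \<open>The supremum of \<open>|f|\<close> may be infinite, and is 0 on the empty set.\<close>

definition sup_abs :: "'v set \<Rightarrow> ('v \<Rightarrow> complex) \<Rightarrow> ennreal" where
  "sup_abs A f = (SUP x\<in>A. ennreal (cmod (f x)))"

definition tau_zero :: "'v cvec \<Rightarrow> 'v topology \<Rightarrow> ('v \<Rightarrow> complex) topology" where
  "tau_zero V T = topology_generated_by
     {{f \<in> holo V T. f ` K \<subseteq> U} | K U. compactin T K \<and> open U}"

definition ported_seminorm :: "'v cvec \<Rightarrow> 'v topology \<Rightarrow> (('v \<Rightarrow> complex) \<Rightarrow> real) \<Rightarrow> bool" where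
  "ported_seminorm V T q \<longleftrightarrow>
     seminorm_on (holo_space V T) q \<and>
     (\<exists>K. compactin T K \<and>
        (\<forall>W. openin T W \<and> K \<subseteq> W \<longrightarrow>
           (\<exists>c>0. \<forall>f\<in>holo V T. ennreal (q f) \<le> ennreal c * sup_abs W f)))"

definition tau_omega :: "'v cvec \<Rightarrow> 'v topology \<Rightarrow> ('v \<Rightarrow> complex) topology" where
  "tau_omega V T = seminorm_topology (holo_space V T) {q. ported_seminorm V T q}"

definition delta_seminorm :: "'v cvec \<Rightarrow> 'v topology \<Rightarrow> (('v \<Rightarrow> complex) \<Rightarrow> real) \<Rightarrow> bool" where
  "delta_seminorm V T q \<longleftrightarrow>
     seminorm_on (holo_space V T) q \<and>
     (\<forall>W :: nat \<Rightarrow> 'v set.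
        (\<forall>n. openin T (W n)) \<and> incseq W \<and> (\<Union>n. W n) = vcarrier V \<longrightarrow>
        (\<exists>n. \<exists>c>0. \<forall>f\<in>holo V T. ennreal (q f) \<le> ennreal c * sup_abs (W n) f))"

definition tau_delta :: "'v cvec \<Rightarrow> 'v topology \<Rightarrow> ('v \<Rightarrow> complex) topology" where
  "tau_delta V T = seminorm_topology (holo_space V T) {q. delta_seminorm V T q}"

subsection \<open>Entire functions of bounded type on a normed space\<close>

text \<open>
  The \<open>m\<close>-homogeneous Taylor polynomial at the origin: its value at \<open>x\<close> is the \<open>m\<close>-th Taylor
  coefficient at 0 of \<open>z \<mapsto> f (z x)\<close>.
\<close>

definition taylor_poly :: "'v cvec \<Rightarrow> ('v \<Rightarrow> complex) \<Rightarrow> nat \<Rightarrow> 'v \<Rightarrow> complex" where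
  "taylor_poly X f m x = (deriv ^^ m) (\<lambda>z. f (vscale X z x)) 0 / fact m"

text \<open>
  The supremum is over a nonempty set that is bounded when \<open>f\<close> is holomorphic, by the Cauchy
  estimates on a ball on which \<open>f\<close> is bounded.
\<close>

definition taylor_norm :: "'v cvec \<Rightarrow> ('v \<Rightarrow> real) \<Rightarrow> ('v \<Rightarrow> complex) \<Rightarrow> nat \<Rightarrow> real" where
  "taylor_norm X N f m = (SUP x\<in>{x \<in> vcarrier X. N x \<le> 1}. cmod (taylor_poly X f m x))"

definition Hb :: "'v cvec \<Rightarrow> ('v \<Rightarrow> real) \<Rightarrow> ('v \<Rightarrow> complex) set" where
  "Hb X N = {f \<in> holo X (seminorm_topology X {N}).
     (\<lambda>m. root m (taylor_norm X N f m)) \<longlonglongrightarrow> 0}"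

definition Hb_seminorm ::
    "'v cvec \<Rightarrow> ('v \<Rightarrow> real) \<Rightarrow> real \<Rightarrow> ('v \<Rightarrow> complex) \<Rightarrow> real" where
  "Hb_seminorm X N \<rho> f = (\<Sum>m. \<rho> ^ m * taylor_norm X N f m)"

definition Hb_topology :: "'v cvec \<Rightarrow> ('v \<Rightarrow> real) \<Rightarrow> ('v \<Rightarrow> complex) topology" where
  "Hb_topology X N =
     seminorm_topology (fun_space (vcarrier X) (Hb X N)) {Hb_seminorm X N \<rho> | \<rho>. 0 < \<rho>}"

subsection \<open>The normed space associated with a seminorm\<close>

definition ker :: "'v cvec \<Rightarrow> ('v \<Rightarrow> real) \<Rightarrow> 'v set" where
  "ker V p = {x \<in> vcarrier V. p x = 0}"

definition proj :: "'v cvec \<Rightarrow> ('v \<Rightarrow> real) \<Rightarrow> 'v \<Rightarrow> 'v set" where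
  "proj V p x = vadd V x ` ker V p"

text \<open>Adding the kernel in the scalar multiplication matters only for the scalar 0.\<close>

definition quot :: "'v cvec \<Rightarrow> ('v \<Rightarrow> real) \<Rightarrow> 'v set cvec" where
  "quot V p =
     \<lparr>vcarrier = proj V p ` vcarrier V,
      vzero = ker V p,
      vadd = (\<lambda>A B. {vadd V a b | a b. a \<in> A \<and> b \<in> B}),
      vscale = (\<lambda>c A. {vadd V (vscale V c a) n | a n. a \<in> A \<and> n \<in> ker V p})\<rparr>"

text \<open>The seminorm is constant on each coset.\<close>

definition quot_norm :: "('v \<Rightarrow> real) \<Rightarrow> 'v set \<Rightarrow> real" where
  "quot_norm p A = the_elem (p ` A)"

subsection \<open>The space of entire functions of uniformly bounded type\<close>

definition pullback ::
    "'v cvec \<Rightarrow> ('v \<Rightarrow> real) \<Rightarrow> ('v set \<Rightarrow> complex) \<Rightarrow> 'v \<Rightarrow> complex" where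
  "pullback V p f = compose (vcarrier V) f (proj V p)"

definition Hub :: "'v cvec \<Rightarrow> 'v topology \<Rightarrow> ('v \<Rightarrow> complex) set" where
  "Hub V T = (\<Union>p\<in>cs V T. pullback V p ` Hb (quot V p) (quot_norm p))"

definition Hub_space :: "'v cvec \<Rightarrow> 'v topology \<Rightarrow> ('v \<Rightarrow> complex) cvec" where
  "Hub_space V T = fun_space (vcarrier V) (Hub V T)"

definition Hub_admissible :: "'v cvec \<Rightarrow> 'v topology \<Rightarrow> ('v \<Rightarrow> complex) topology \<Rightarrow> bool" where
  "Hub_admissible V T S \<longleftrightarrow>
     locally_convex_topology (Hub_space V T) S \<and>
     (\<forall>p\<in>cs V T. continuous_map (Hb_topology (quot V p) (quot_norm p)) S (pullback V p))"

text \<open>The finest admissible topology; it exists, as the supremum of all admissible ones.\<close>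

definition Hub_topology :: "'v cvec \<Rightarrow> 'v topology \<Rightarrow> ('v \<Rightarrow> complex) topology" where
  "Hub_topology V T =
     (THE S. Hub_admissible V T S \<and>
        (\<forall>S'. Hub_admissible V T S' \<longrightarrow> (\<forall>U. openin S' U \<longrightarrow> openin S U)))"

subsection \<open>Convolution operators and hypercyclicity\<close>

definition translation ::
    "'v cvec \<Rightarrow> 'v \<Rightarrow> ('v \<Rightarrow> complex) \<Rightarrow> 'v \<Rightarrow> complex" where
  "translation V a f = (\<lambda>x\<in>vcarrier V. f (vminus V x a))"

definition continuous_linear_op :: "'v cvec \<Rightarrow> 'v topology \<Rightarrow> ('v \<Rightarrow> 'v) \<Rightarrow> bool" where
  "continuous_linear_op V T L \<longleftrightarrow>
     L \<in> vcarrier V \<rightarrow> vcarrier V \<and>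
     (\<forall>x\<in>vcarrier V. \<forall>y\<in>vcarrier V. L (vadd V x y) = vadd V (L x) (L y)) \<and>
     (\<forall>c. \<forall>x\<in>vcarrier V. L (vscale V c x) = vscale V c (L x)) \<and>
     continuous_map T T L"

definition convolution_operator ::
    "'v cvec \<Rightarrow> 'v topology \<Rightarrow> ('v \<Rightarrow> complex) topology
      \<Rightarrow> (('v \<Rightarrow> complex) \<Rightarrow> 'v \<Rightarrow> complex) \<Rightarrow> bool" where
  "convolution_operator V T \<tau> L \<longleftrightarrow>
     continuous_linear_op (holo_space V T) \<tau> L \<and>
     (\<forall>f\<in>holo V T. \<forall>b\<in>vcarrier V. L (translation V b f) = translation V b (L f))"

text \<open>Existence of a dense orbit. That the operator is continuous and linear is not part of this predicate
  and is asserted by \<open>continuous_linear_op\<close>.\<close>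

definition hypercyclic :: "'v topology \<Rightarrow> ('v \<Rightarrow> 'v) \<Rightarrow> bool" where
  "hypercyclic T L \<longleftrightarrow>
     (\<exists>x\<in>topspace T. T closure_of (range (\<lambda>n. (L ^^ n) x)) = topspace T)"

subsection \<open>The space of complex sequences\<close>

definition CN :: "(nat \<Rightarrow> complex) cvec" where
  "CN = \<lparr>vcarrier = UNIV,
         vzero = (\<lambda>n. 0),
         vadd = (\<lambda>x y n. x n + y n),
         vscale = (\<lambda>c x n. c * x n)\<rparr>"

definition CN_top :: "(nat \<Rightarrow> complex) topology" where
  "CN_top = product_topology (\<lambda>_. euclidean) UNIV"

end

theory Submission
  imports Defs "HOL-Complex_Analysis.Complex_Analysis"
begin

text \<open>
  An entire function \<open>f\<close> on the space of complex sequences depends on finitely many coordinates only.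
  Indeed, continuity at \<open>0\<close> bounds \<open>f\<close> on a cylinder \<open>{x. |x i| < e for i < n}\<close>, on which the
  coordinates from \<open>n\<close> on are unrestricted; Liouville's theorem shows that \<open>f\<close> ignores them at small
  points, and the identity theorem along rays extends this to all points (\<open>entire_cyl\<close>). So the space
  of entire functions is the increasing union of the stages \<open>H(\<complex>\<^sup>n)\<close>, written \<open>cyl n f\<close> below, and
  every assertion becomes a comparison of estimates on the stages.

  The seminorms that generate \<open>\<tau>\<^sub>\<delta>\<close> are those which on every stage are dominated by the supremum over
  some polydisc, whose radius may depend on the stage (\<open>delta_seminorm_iff\<close>): a function that is
  bounded on a member of an open cover lies in a stage fixed beforehand, and the polydiscs of that
  stage are compact, so they are swallowed by the cover. The seminorms that generate \<open>\<tau>\<^sub>\<omega>\<close> are those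
  dominated by the supremum over one compact polydisc of all variables (\<open>ported_seminorm_iff\<close>), which
  gives \<open>\<tau>\<^sub>0 = \<tau>\<^sub>\<omega>\<close>. For this, \<open>f\<close> is written as the telescoping sum of the differences
  \<open>g n x = f (trunc (n + 1) x) - f (trunc n x)\<close>. The summand \<open>g n\<close> vanishes where \<open>x n = 0\<close>, so by the
  Schwarz lemma enlarging the \<open>n\<close>-th radius by a factor \<open>l n\<close> gains the factor \<open>1 / l n\<close> on the smaller
  polydisc, and a suitable choice of \<open>l\<close> absorbs the constants \<open>c n\<close> that portedness provides on the
  stages. The seminorm \<open>\<Sum>n. |f (n e\<^sub>0 + e\<^sub>n\<^sub>+\<^sub>1) - f (n e\<^sub>0)|\<close> is a finite sum on each stage but looks at
  points that leave every compact set; it separates \<open>\<tau>\<^sub>\<delta>\<close> from \<open>\<tau>\<^sub>\<omega>\<close>.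

  A function of the stage \<open>n\<close> factors through the normed space of \<open>\<Sum>i<n. |x i|\<close>, and the Cauchy
  estimates show that the factor is of bounded type (\<open>stage_factorisation\<close>); conversely a continuous
  seminorm is dominated by finitely many coordinates, so every function of uniformly bounded type lies
  in a stage. Evaluating Taylor series makes each generating seminorm of \<open>\<tau>\<^sub>\<delta>\<close> continuous on every
  space \<open>\<H>\<^sub>b(E\<^sub>p)\<close>, so \<open>\<tau>\<^sub>\<delta>\<close> is admissible (\<open>Hub_admissible_tau_delta\<close>). It is the finest
  admissible topology (\<open>tau_delta_finest\<close>) because a convex neighbourhood of \<open>0\<close> in any other one
  contains a balanced convex set whose gauge is dominated on each stage, hence is a seminorm of \<open>\<tau>\<^sub>\<delta>\<close>.

  A translation preserves each stage. The orbit of \<open>f\<close> therefore stays in one stage \<open>N\<close>, each of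
  whose members takes the same value at \<open>0\<close> and at the unit vector \<open>e\<^sub>N\<close>. The coordinate function
  \<open>x \<mapsto> x N\<close> does not, and hence is not in the closure of the orbit.
\<close>

section \<open>Topologies given by directed families of seminorms\<close>

text \<open>
  Only the values of the gauges on differences enter. In this form the description of the open sets
  applies to the quotient spaces and to the spaces of functions alike.
\<close>

locale directed_gauges =
  fixes V :: "'v cvec" and Q :: "('v \<Rightarrow> real) set"
  assumes zero: "\<And>q x. q \<in> Q \<Longrightarrow> x \<in> vcarrier V \<Longrightarrow> q (vminus V x x) = 0"
    and triangle: "\<And>q x y z. q \<in> Q \<Longrightarrow> x \<in> vcarrier V \<Longrightarrow> y \<in> vcarrier V \<Longrightarrow> z \<in> vcarrier V \<Longrightarrow>
      q (vminus V z x) \<le> q (vminus V z y) + q (vminus V y x)"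
    and directed: "\<And>q q'. q \<in> Q \<Longrightarrow> q' \<in> Q \<Longrightarrow>
      \<exists>s\<in>Q. \<forall>x\<in>vcarrier V. \<forall>y\<in>vcarrier V.
        q (vminus V y x) \<le> s (vminus V y x) \<and> q' (vminus V y x) \<le> s (vminus V y x)"
    and nonempty: "Q \<noteq> {}"
begin

lemma topspace_seminorm_topology: "topspace (seminorm_topology V Q) = vcarrier V"
  unfolding seminorm_topology_def by auto

lemma openin_ball:
  "q \<in> Q \<Longrightarrow> x \<in> vcarrier V \<Longrightarrow> 0 < r \<Longrightarrow>
    openin (seminorm_topology V Q) {y \<in> vcarrier V. q (vminus V y x) < r}"
  unfolding seminorm_topology_def by (intro topology_generated_by_Basis) blast

text \<open>
  Directedness is used for intersections, and the triangle inequality to recentre a ball at one of its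
  points.
\<close>

lemma generated_contains_ball:
  assumes "generate_topology_on (insert (vcarrier V)
       {{y \<in> vcarrier V. q (vminus V y x) < r} | q x r. q \<in> Q \<and> x \<in> vcarrier V \<and> 0 < r}) U"
  shows "\<forall>x\<in>U. \<exists>q\<in>Q. \<exists>r>0. {y \<in> vcarrier V. q (vminus V y x) < r} \<subseteq> U"
  using assms
proof (induction rule: generate_topology_on.induct)
  case Empty
  then show ?case by simp
next
  case (Int a b)
  show ?case
  proof
    fix x assume x: "x \<in> a \<inter> b"
    obtain q r where q: "q \<in> Q" "r > 0" "{y \<in> vcarrier V. q (vminus V y x) < r} \<subseteq> a"
      using Int x by blast
    obtain q' r' where q': "q' \<in> Q" "r' > 0" "{y \<in> vcarrier V. q' (vminus V y x) < r'} \<subseteq> b"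
      using Int x by blast
    obtain s where s: "s \<in> Q" "\<forall>x\<in>vcarrier V. \<forall>y\<in>vcarrier V.
        q (vminus V y x) \<le> s (vminus V y x) \<and> q' (vminus V y x) \<le> s (vminus V y x)"
      using directed q(1) q'(1) by blast
    have "a \<subseteq> vcarrier V"
      using generate_topology_on.induct[OF Int(1), of "\<lambda>a. a \<subseteq> vcarrier V"] by blast
    then have "x \<in> vcarrier V" using x by blast
    then have "{y \<in> vcarrier V. s (vminus V y x) < min r r'} \<subseteq> a \<inter> b"
      using q(3) q'(3) s(2) by (fastforce simp: subset_iff)
    then show "\<exists>q\<in>Q. \<exists>r>0. {y \<in> vcarrier V. q (vminus V y x) < r} \<subseteq> a \<inter> b"
      using s(1) q(2) q'(2) by (metis min_less_iff_conj)
  qed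
next
  case (UN K)
  then show ?case by (meson UnionE Union_upper dual_order.trans)
next
  case (Basis s)
  then consider "s = vcarrier V"
    | q x r where "s = {y \<in> vcarrier V. q (vminus V y x) < r}" "q \<in> Q" "x \<in> vcarrier V" "0 < r"
    by blast
  then show ?case
  proof cases
    case 1
    then show ?thesis using nonempty by (auto intro: exI[of _ 1])
  next
    case 2
    show ?thesis
    proof
      fix z assume z: "z \<in> s"
      then have "{y \<in> vcarrier V. q (vminus V y z) < r - q (vminus V z x)} \<subseteq> s"
        using 2 triangle[OF 2(2,3), of z] by fastforce
      moreover have "r - q (vminus V z x) > 0" using z 2 by simp
      ultimately show "\<exists>q\<in>Q. \<exists>r>0. {y \<in> vcarrier V. q (vminus V y z) < r} \<subseteq> s"
        using 2(2) by blast
    qed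
  qed
qed

lemma openin_seminorm_topology:
  "openin (seminorm_topology V Q) U \<longleftrightarrow>
    U \<subseteq> vcarrier V \<and> (\<forall>x\<in>U. \<exists>q\<in>Q. \<exists>r>0. {y \<in> vcarrier V. q (vminus V y x) < r} \<subseteq> U)"
proof
  assume U: "openin (seminorm_topology V Q) U"
  then show "U \<subseteq> vcarrier V \<and>
      (\<forall>x\<in>U. \<exists>q\<in>Q. \<exists>r>0. {y \<in> vcarrier V. q (vminus V y x) < r} \<subseteq> U)"
    using openin_subset[OF U] generated_contains_ball[of U] topspace_seminorm_topology
    unfolding seminorm_topology_def openin_topology_generated_by_iff by blast
next
  assume R: "U \<subseteq> vcarrier V \<and>
      (\<forall>x\<in>U. \<exists>q\<in>Q. \<exists>r>0. {y \<in> vcarrier V. q (vminus V y x) < r} \<subseteq> U)"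
  show "openin (seminorm_topology V Q) U"
  proof (subst openin_subopen, intro ballI)
    fix x assume x: "x \<in> U"
    then obtain q r where q: "q \<in> Q" "r > 0" "{y \<in> vcarrier V. q (vminus V y x) < r} \<subseteq> U"
      using R by blast
    then show "\<exists>T. openin (seminorm_topology V Q) T \<and> x \<in> T \<and> T \<subseteq> U"
      using openin_ball[of q x r] zero[of q x] x R
      by (intro exI[of _ "{y \<in> vcarrier V. q (vminus V y x) < r}"]) auto
  qed
qed

end

section \<open>Function spaces\<close>

lemma fun_space_simps [simp]:
  "vcarrier (fun_space C F) = F"
  "vzero (fun_space C F) = (\<lambda>x\<in>C. 0)"
  "vadd (fun_space C F) f g = (\<lambda>x\<in>C. f x + g x)"
  "vscale (fun_space C F) c f = (\<lambda>x\<in>C. c * f x)"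
  "vminus (fun_space C F) f g = (\<lambda>x\<in>C. f x - g x)"
  by (auto simp: fun_space_def vminus_def)

lemma restrict_UNIV_eq [simp]: "restrict f UNIV = f"
  by auto

text \<open>
  Closure of the family under sums makes it directed, since a sum of seminorms dominates its summands.
\<close>

locale seminormed_functions =
  fixes F :: "('a \<Rightarrow> complex) set" and Q :: "(('a \<Rightarrow> complex) \<Rightarrow> real) set"
  assumes zero_mem: "(\<lambda>x. 0) \<in> F"
    and add_mem: "\<And>f g. f \<in> F \<Longrightarrow> g \<in> F \<Longrightarrow> (\<lambda>x. f x + g x) \<in> F"
    and scale_mem: "\<And>c f. f \<in> F \<Longrightarrow> (\<lambda>x. c * f x) \<in> F"
    and seminorm: "\<And>q. q \<in> Q \<Longrightarrow> seminorm_on (fun_space UNIV F) q"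
    and sum_mem: "\<And>q q'. q \<in> Q \<Longrightarrow> q' \<in> Q \<Longrightarrow> (\<lambda>f. q f + q' f) \<in> Q"
    and ex_mem: "Q \<noteq> {}"
begin

lemma diff_mem: "f \<in> F \<Longrightarrow> g \<in> F \<Longrightarrow> (\<lambda>x. f x - g x) \<in> F"
  using add_mem[of f "\<lambda>x. - 1 * g x"] scale_mem[of g "- 1"] by simp

lemma nonneg: "q \<in> Q \<Longrightarrow> f \<in> F \<Longrightarrow> 0 \<le> q f"
  and subadditive: "q \<in> Q \<Longrightarrow> f \<in> F \<Longrightarrow> g \<in> F \<Longrightarrow> q (\<lambda>x. f x + g x) \<le> q f + q g"
  and homogeneous: "q \<in> Q \<Longrightarrow> f \<in> F \<Longrightarrow> q (\<lambda>x. c * f x) = cmod c * q f"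
  using seminorm unfolding seminorm_on_def by auto

sublocale directed_gauges "fun_space UNIV F" Q
proof
  show "q (vminus (fun_space UNIV F) f f) = 0" if "q \<in> Q" "f \<in> vcarrier (fun_space UNIV F)" for q f
    using homogeneous[of q f 0] that by simp
  show "q (vminus (fun_space UNIV F) h f)
      \<le> q (vminus (fun_space UNIV F) h g) + q (vminus (fun_space UNIV F) g f)"
    if "q \<in> Q" "f \<in> vcarrier (fun_space UNIV F)" "g \<in> vcarrier (fun_space UNIV F)"
      "h \<in> vcarrier (fun_space UNIV F)" for q f g h
    using subadditive[of q "\<lambda>x. h x - g x" "\<lambda>x. g x - f x"] that diff_mem by simp
  show "\<exists>s\<in>Q. \<forall>f\<in>vcarrier (fun_space UNIV F). \<forall>g\<in>vcarrier (fun_space UNIV F).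
        q (vminus (fun_space UNIV F) g f) \<le> s (vminus (fun_space UNIV F) g f) \<and>
        q' (vminus (fun_space UNIV F) g f) \<le> s (vminus (fun_space UNIV F) g f)"
    if "q \<in> Q" "q' \<in> Q" for q q'
    using that nonneg diff_mem by (intro bexI[of _ "\<lambda>f. q f + q' f"] sum_mem) auto
qed (rule ex_mem)

abbreviation T where "T \<equiv> seminorm_topology (fun_space UNIV F) Q"

lemma continuous_add: "continuous_map (prod_topology T T) T (\<lambda>(f, g). vadd (fun_space UNIV F) f g)"
proof (unfold continuous_map_def, intro conjI allI impI)
  show "(\<lambda>(f, g). vadd (fun_space UNIV F) f g) \<in> topspace (prod_topology T T) \<rightarrow> topspace T"
    using add_mem by (auto simp: topspace_seminorm_topology)
next
  fix U assume U: "openin T U"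
  show "openin (prod_topology T T)
      {p \<in> topspace (prod_topology T T). (case p of (f, g) \<Rightarrow> vadd (fun_space UNIV F) f g) \<in> U}"
    unfolding openin_prod_topology_alt
  proof (intro allI impI)
    fix f g assume "(f, g) \<in> {p \<in> topspace (prod_topology T T).
      (case p of (f, g) \<Rightarrow> vadd (fun_space UNIV F) f g) \<in> U}"
    then have fg: "f \<in> F" "g \<in> F" "(\<lambda>x. f x + g x) \<in> U"
      by (auto simp: topspace_seminorm_topology)
    obtain q r where q: "q \<in> Q" "r > 0" "\<And>h. h \<in> F \<Longrightarrow> q (\<lambda>x. h x - (f x + g x)) < r \<Longrightarrow> h \<in> U"
      using U fg(3) unfolding openin_seminorm_topology by fastforce
    let ?A = "\<lambda>f. {y \<in> vcarrier (fun_space UNIV F). q (vminus (fun_space UNIV F) y f) < r / 2}"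
    have "openin T (?A f)" "openin T (?A g)" using q fg by (intro openin_ball; simp)+
    moreover have "f \<in> ?A f" "g \<in> ?A g" using fg q zero by fastforce+
    moreover have "(\<lambda>x. f' x + g' x) \<in> U" if "f' \<in> ?A f" "g' \<in> ?A g" for f' g'
      using that q(2) subadditive[OF q(1), of "\<lambda>x. f' x - f x" "\<lambda>x. g' x - g x"] fg
      by (intro q(3) add_mem) (auto simp: diff_mem algebra_simps)
    ultimately show "\<exists>A B. openin T A \<and> openin T B \<and> f \<in> A \<and> g \<in> B \<and>
      A \<times> B \<subseteq> {p \<in> topspace (prod_topology T T). (case p of (f, g) \<Rightarrow> vadd (fun_space UNIV F) f g) \<in> U}"
      by (intro exI[of _ "?A f"] exI[of _ "?A g"]) (auto simp: topspace_seminorm_topology)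
  qed
qed

text \<open>
  The estimate behind joint continuity is
  \<open>q (c' f' - c f) \<le> |c'| q (f' - f) + |c' - c| q f\<close>.
\<close>

lemma continuous_scale:
  "continuous_map (prod_topology euclidean T) T (\<lambda>(c, f). vscale (fun_space UNIV F) c f)"
proof (unfold continuous_map_def, intro conjI allI impI)
  show "(\<lambda>(c, f). vscale (fun_space UNIV F) c f) \<in> topspace (prod_topology euclidean T) \<rightarrow> topspace T"
    using scale_mem by (auto simp: topspace_seminorm_topology)
next
  fix U assume U: "openin T U"
  show "openin (prod_topology euclidean T) {p \<in> topspace (prod_topology euclidean T).
      (case p of (c, f) \<Rightarrow> vscale (fun_space UNIV F) c f) \<in> U}"
    unfolding openin_prod_topology_alt
  proof (intro allI impI)
    fix c f assume "(c, f) \<in> {p \<in> topspace (prod_topology euclidean T).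
      (case p of (c, f) \<Rightarrow> vscale (fun_space UNIV F) c f) \<in> U}"
    then have f: "f \<in> F" "(\<lambda>x. c * f x) \<in> U"
      by (auto simp: topspace_seminorm_topology)
    obtain q r where q: "q \<in> Q" "r > 0" "\<And>h. h \<in> F \<Longrightarrow> q (\<lambda>x. h x - c * f x) < r \<Longrightarrow> h \<in> U"
      using U f(2) unfolding openin_seminorm_topology by fastforce
    \<comment> \<open>bounding the change of scalar by \<open>1\<close> keeps \<open>|c'| \<le> |c| + 1\<close>; each of
      the two terms gets \<open>r / 2\<close>\<close>
    define d where "d = min 1 (r / (2 * (q f + 1)))"
    have qf: "q f \<ge> 0" using nonneg q f by auto
    have d: "d > 0" "d \<le> 1"
      using q(2) qf by (auto simp: d_def)
    have "d * (q f + 1) \<le> r / (2 * (q f + 1)) * (q f + 1)"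
      using qf by (intro mult_right_mono) (auto simp: d_def)
    also have "\<dots> = r / 2" using qf by (simp add: divide_simps)
    finally have dq: "d * (q f + 1) \<le> r / 2" .
    define s where "s = r / 2 / (cmod c + 1)"
    have c1: "cmod c + 1 > 0" using norm_ge_zero[of c] by linarith
    have s: "s > 0" using c1 q(2) by (simp add: s_def)
    have sc: "(cmod c + 1) * s = r / 2"
      unfolding s_def using c1 by (intro nonzero_mult_div_cancel_left[of _ "r / 2", folded times_divide_eq_right]) simp
    let ?A = "{y \<in> vcarrier (fun_space UNIV F). q (vminus (fun_space UNIV F) y f) < s}"
    have "openin T ?A" using q f s by (intro openin_ball) simp_all
    moreover have "f \<in> ?A" using f q zero s by fastforce
    moreover have "(\<lambda>x. c' * f' x) \<in> U" if "f' \<in> ?A" "c' \<in> ball c d" for f' c'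
    proof (rule q(3))
      show "(\<lambda>x. c' * f' x) \<in> F" using that scale_mem by simp
      have m: "(\<lambda>x. c' * (f' x - f x)) \<in> F" "(\<lambda>x. (c' - c) * f x) \<in> F" "(\<lambda>x. f' x - f x) \<in> F"
        using that f by (auto intro!: scale_mem diff_mem)
      have cc: "cmod (c' - c) \<le> d" "cmod c' \<le> cmod c + 1"
        using that(2) d(2) norm_triangle_ineq[of c "c' - c"] by (auto simp: dist_norm norm_minus_commute)
      have "q (\<lambda>x. c' * f' x - c * f x) = q (\<lambda>x. c' * (f' x - f x) + (c' - c) * f x)"
        by (simp add: algebra_simps)
      also have "\<dots> \<le> q (\<lambda>x. c' * (f' x - f x)) + q (\<lambda>x. (c' - c) * f x)"
        by (rule subadditive[OF q(1) m(1,2)])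
      also have "\<dots> = cmod c' * q (\<lambda>x. f' x - f x) + cmod (c' - c) * q f"
        using homogeneous[OF q(1)] m(3) f(1) by simp
      also have "\<dots> \<le> (cmod c + 1) * q (\<lambda>x. f' x - f x) + d * q f"
        using cc qf nonneg[OF q(1) m(3)] by (intro add_mono mult_right_mono) auto
      also have "\<dots> < (cmod c + 1) * s + d * (q f + 1)"
        using that(1) d(1) c1 by (intro add_strict_mono mult_strict_left_mono) auto
      also have "\<dots> \<le> r" using sc dq by simp
      finally show "q (\<lambda>x. c' * f' x - c * f x) < r" .
    qed
    ultimately show "\<exists>A B. openin euclidean A \<and> openin T B \<and> c \<in> A \<and> f \<in> B \<and>
      A \<times> B \<subseteq> {p \<in> topspace (prod_topology euclidean T). (case p of (c, f) \<Rightarrow> vscale (fun_space UNIV F) c f) \<in> U}"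
      using d by (intro exI[of _ "ball c d"] exI[of _ ?A]) (auto simp: topspace_seminorm_topology)
  qed
qed

lemma locally_convex: "locally_convex_topology (fun_space UNIV F) T"
  unfolding locally_convex_topology_def
proof (intro conjI allI impI)
  show "topspace T = vcarrier (fun_space UNIV F)" by (rule topspace_seminorm_topology)
  show "continuous_map (prod_topology T T) T (\<lambda>(x, y). vadd (fun_space UNIV F) x y)"
    by (rule continuous_add)
  show "continuous_map (prod_topology euclidean T) T (\<lambda>(c, x). vscale (fun_space UNIV F) c x)"
    by (rule continuous_scale)
  fix U assume U: "openin T U \<and> vzero (fun_space UNIV F) \<in> U"
  then obtain q r where q: "q \<in> Q" "r > 0" "\<And>h. h \<in> F \<Longrightarrow> q (\<lambda>x. h x - 0) < r \<Longrightarrow> h \<in> U"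
    unfolding openin_seminorm_topology by fastforce
  let ?W = "{y \<in> vcarrier (fun_space UNIV F). q (vminus (fun_space UNIV F) y (\<lambda>x. 0)) < r}"
  have "openin T ?W" using q zero_mem by (intro openin_ball) simp_all
  moreover have "vzero (fun_space UNIV F) \<in> ?W" using zero_mem q zero by fastforce
  moreover have "?W \<subseteq> U" using q(3) by auto
  moreover have "vconvex (fun_space UNIV F) ?W"
    unfolding vconvex_def
  proof (intro ballI)
    fix f g and t :: real assume fg: "f \<in> ?W" "g \<in> ?W" and t: "t \<in> {0..1}"
    have "q (\<lambda>x. complex_of_real (1 - t) * f x + complex_of_real t * g x)
        \<le> cmod (complex_of_real (1 - t)) * q f + cmod (complex_of_real t) * q g"
      using subadditive[OF q(1), of "\<lambda>x. complex_of_real (1 - t) * f x" "\<lambda>x. complex_of_real t * g x"]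
        homogeneous[OF q(1), of f] homogeneous[OF q(1), of g] fg by (simp add: scale_mem)
    also have "\<dots> = (1 - t) * q f + t * q g"
      unfolding norm_of_real using t by simp
    also have "\<dots> < r"
      using fg t by (intro convex_bound_lt) auto
    finally show "vadd (fun_space UNIV F) (vscale (fun_space UNIV F) (complex_of_real (1 - t)) f)
        (vscale (fun_space UNIV F) (complex_of_real t) g) \<in> ?W"
      using fg by (auto intro!: add_mem scale_mem simp del: of_real_diff)
  qed
  ultimately show "\<exists>W. openin T W \<and> vzero (fun_space UNIV F) \<in> W \<and> W \<subseteq> U \<and> vconvex (fun_space UNIV F) W"
    by blast
qed

end

section \<open>Entire functions of infinitely many variables\<close>

lemma CN_simps [simp]:
  "vcarrier CN = UNIV" "vzero CN = (\<lambda>n. 0)"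
  "vadd CN x y = (\<lambda>n. x n + y n)" "vscale CN c x = (\<lambda>n. c * x n)"
  "vminus CN x y = (\<lambda>n. x n - y n)"
  by (auto simp: CN_def vminus_def)

lemma CN_top_eq: "CN_top = euclidean"
  unfolding CN_top_def by (rule euclidean_product_topology)

abbreviation entire :: "((nat \<Rightarrow> complex) \<Rightarrow> complex) set" where
  "entire \<equiv> holo CN CN_top"

lemma entire_iff:
  "f \<in> entire \<longleftrightarrow>
    continuous_on UNIV f \<and> (\<forall>x y. (\<lambda>z. f (\<lambda>n. x n + z * y n)) holomorphic_on UNIV)"
  by (simp add: holo_def CN_top_eq)

lemma entire_line: "f \<in> entire \<Longrightarrow> (\<lambda>z. f (\<lambda>n. x n + z * y n)) holomorphic_on UNIV"
  by (simp add: entire_iff)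

lemma entire_const: "(\<lambda>x. c) \<in> entire"
  by (simp add: entire_iff)

lemma entire_add: "f \<in> entire \<Longrightarrow> g \<in> entire \<Longrightarrow> (\<lambda>x. f x + g x) \<in> entire"
  by (auto simp: entire_iff intro!: continuous_intros holomorphic_intros)

lemma entire_scale: "f \<in> entire \<Longrightarrow> (\<lambda>x. c * f x) \<in> entire"
  by (auto simp: entire_iff intro!: continuous_intros holomorphic_intros)

lemma entire_mult: "f \<in> entire \<Longrightarrow> g \<in> entire \<Longrightarrow> (\<lambda>x. f x * g x) \<in> entire"
  by (auto simp: entire_iff intro!: continuous_intros holomorphic_intros)

lemma entire_power: "f \<in> entire \<Longrightarrow> (\<lambda>x. f x ^ k) \<in> entire"
  by (auto simp: entire_iff intro!: continuous_intros holomorphic_intros)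

lemma entire_diff: "f \<in> entire \<Longrightarrow> g \<in> entire \<Longrightarrow> (\<lambda>x. f x - g x) \<in> entire"
  by (auto simp: entire_iff intro!: continuous_intros holomorphic_intros)

lemma entire_coordinate: "(\<lambda>x. x i) \<in> entire"
  by (auto simp: entire_iff intro!: holomorphic_intros continuous_on_product_coordinates)

text \<open>
  A basic open set of the product topology restricts finitely many coordinates; taking all coordinates
  below a bound and the smallest of the radii loses nothing.
\<close>

lemma open_contains_cylinder:
  fixes W :: "(nat \<Rightarrow> complex) set"
  assumes "open W" "x \<in> W"
  obtains n e where "e > 0" "\<And>y. (\<And>i. i < n \<Longrightarrow> cmod (y i - x i) < e) \<Longrightarrow> y \<in> W"
proof -
  have "openin (product_topology (\<lambda>_. euclidean) UNIV) W"
    using assms(1) by (simp add: euclidean_product_topology)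
  then obtain X where X: "x \<in> (\<Pi>\<^sub>E i\<in>UNIV. X i)" "\<And>i. open (X i)"
    "finite {i. X i \<noteq> UNIV}" "(\<Pi>\<^sub>E i\<in>UNIV. X i) \<subseteq> W"
    using product_topology_open_contains_basis[of "\<lambda>_. euclidean" UNIV W x] assms(2) by auto
  obtain n where n: "\<And>i. X i \<noteq> UNIV \<Longrightarrow> i < n"
    using X(3) unfolding finite_nat_set_iff_bounded by auto
  have "\<exists>e>0. ball (x i) e \<subseteq> X i" for i
    using X(1,2) by (meson PiE_mem UNIV_I open_contains_ball_eq)
  then obtain d where d: "\<And>i. d i > 0" "\<And>i. ball (x i) (d i) \<subseteq> X i" by metis
  define e where "e = Min (insert 1 (d ` {..<n}))"
  have "e > 0" using d(1) by (auto simp: e_def)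
  moreover have "y \<in> W" if y: "\<And>i. i < n \<Longrightarrow> cmod (y i - x i) < e" for y
  proof -
    have "y i \<in> X i" for i
    proof (cases "i < n")
      case True
      then have "e \<le> d i" by (auto simp: e_def)
      then have "y i \<in> ball (x i) (d i)"
        using y[OF True] by (auto simp: dist_norm norm_minus_commute)
      then show ?thesis using d(2) by blast
    qed (use n in auto)
    then show ?thesis using X(4) by (auto simp: PiE_def Pi_def)
  qed
  ultimately show thesis by (rule that)
qed

lemma compact_polydisc: "compact {x :: nat \<Rightarrow> complex. \<forall>i. cmod (x i) \<le> R i}"
proof -
  have "compactin (product_topology (\<lambda>_. euclidean) UNIV) (\<Pi>\<^sub>E i\<in>UNIV. cball (0::complex) (R i))"
    by (simp add: compactin_PiE)
  moreover have "(\<Pi>\<^sub>E i\<in>UNIV. cball (0::complex) (R i)) = {x. \<forall>i. cmod (x i) \<le> R i}"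
    by (auto simp: PiE_def Pi_def)
  ultimately show ?thesis by (simp add: euclidean_product_topology)
qed

lemma compact_in_polydisc:
  assumes "compact (K :: (nat \<Rightarrow> complex) set)"
  obtains R where "\<And>i. R i \<ge> 0" "\<And>x i. x \<in> K \<Longrightarrow> cmod (x i) \<le> R i"
proof -
  have "\<exists>r. r \<ge> 0 \<and> (\<forall>x\<in>K. cmod (x i) \<le> r)" for i
  proof -
    have "compact ((\<lambda>x. x i) ` K)"
      by (intro compact_continuous_image assms continuous_on_product_coordinates
          continuous_on_subset[OF _ subset_UNIV])
    then obtain r where "\<forall>z\<in>(\<lambda>x. x i) ` K. cmod z \<le> r"
      using compact_imp_bounded bounded_iff by metis
    then show ?thesis by (intro exI[of _ "max r 0"]) auto
  qed
  then show thesis using that by metis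
qed

section \<open>Dependence on finitely many coordinates\<close>

definition cyl :: "nat \<Rightarrow> ((nat \<Rightarrow> complex) \<Rightarrow> complex) \<Rightarrow> bool" where
  "cyl n f \<longleftrightarrow> (\<forall>x y. (\<forall>i<n. x i = y i) \<longrightarrow> f x = f y)"

lemma cylD: "cyl n f \<Longrightarrow> (\<And>i. i < n \<Longrightarrow> x i = y i) \<Longrightarrow> f x = f y"
  by (auto simp: cyl_def)

text \<open>
  Boundedness on a cylinder over the first \<open>n\<close> coordinates forces independence of the remaining ones:
  for a direction \<open>d\<close> that vanishes on the first \<open>n\<close> coordinates and a point \<open>z x\<close> inside the cylinder,
  the whole line \<open>z x + w d\<close> stays inside, so Liouville's theorem applies to \<open>w\<close>. The identity theorem in
  \<open>z\<close> then removes the restriction to small \<open>z\<close>.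
\<close>

lemma bounded_on_cylinder_imp_cyl:
  assumes f: "f \<in> entire" and e: "e > 0"
    and B: "\<And>x. (\<And>i. i < n \<Longrightarrow> cmod (x i) < e) \<Longrightarrow> cmod (f x) \<le> B"
  shows "cyl n f"
  unfolding cyl_def
proof (intro allI impI)
  fix x y :: "nat \<Rightarrow> complex" assume xy: "\<forall>i<n. x i = y i"
  define d where "d = (\<lambda>i. y i - x i)"
  \<comment> \<open>small enough for \<open>z x\<close> to lie in the cylinder when \<open>|z| < r\<close>\<close>
  define r where "r = e / (1 + (\<Sum>i<n. cmod (x i)))"
  have s: "1 + (\<Sum>i<n. cmod (x i)) > 0" by (simp add: add_pos_nonneg sum_nonneg)
  then have r: "r > 0" using e by (simp add: r_def)
  have small: "f (\<lambda>i. d i + z * x i) = f (\<lambda>i. 0 + z * x i)" if z: "z \<in> ball 0 r" for z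
  proof -
    have zx: "cmod (z * x i) < e" if "i < n" for i
    proof -
      have "cmod (x i) \<le> (\<Sum>i<n. cmod (x i))"
        using that by (intro member_le_sum) auto
      then have "cmod (z * x i) \<le> cmod z * (1 + (\<Sum>i<n. cmod (x i)))"
        by (simp add: norm_mult mult_left_mono)
      also have "\<dots> < r * (1 + (\<Sum>i<n. cmod (x i)))"
        using z s by (intro mult_strict_right_mono) auto
      also have "\<dots> = e" using s by (simp add: r_def)
      finally show ?thesis .
    qed
    have "cmod (f (\<lambda>i. z * x i + w * d i)) \<le> B" for w
      using xy zx by (intro B) (simp add: d_def)
    then have "bounded (range (\<lambda>w. f (\<lambda>i. z * x i + w * d i)))"
      by (auto simp: bounded_iff)
    then obtain c where "\<And>w. f (\<lambda>i. z * x i + w * d i) = c"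
      using Liouville_theorem[OF entire_line[OF f, of "\<lambda>i. z * x i" d]]
      by (auto simp: constant_on_def)
    \<comment> \<open>compare the constant at \<open>w = 0\<close> and \<open>w = 1\<close>\<close>
    from this[of 0] this[of 1] show ?thesis by (simp add: add.commute)
  qed
  have "f (\<lambda>i. d i + 1 * x i) - f (\<lambda>i. 0 + 1 * x i) = 0"
  proof (rule analytic_continuation[where f = "\<lambda>z. f (\<lambda>i. d i + z * x i) - f (\<lambda>i. 0 + z * x i)"
        and S = UNIV and U = "ball 0 r" and \<xi> = 0])
    show "(\<lambda>z. f (\<lambda>i. d i + z * x i) - f (\<lambda>i. 0 + z * x i)) holomorphic_on UNIV"
      by (intro holomorphic_on_diff entire_line f)
    show "0 islimpt ball (0::complex) r" using r by (simp add: islimpt_ball)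
  qed (use small in auto)
  then show "f x = f y" by (simp add: d_def)
qed

text \<open>
  This is the structural fact about \<open>\<complex>\<^sup>\<nat>\<close> on which the proof depends: the stages exhaust the
  space of entire functions.
\<close>

lemma entire_cyl:
  assumes f: "f \<in> entire"
  obtains n where "cyl n f"
proof -
  have "open (f -` ball (f (\<lambda>i. 0)) 1)"
    using f by (intro open_vimage) (auto simp: entire_iff)
  then obtain n e where ne: "e > 0"
    "\<And>y. (\<And>i. i < n \<Longrightarrow> cmod (y i - 0) < e) \<Longrightarrow> y \<in> f -` ball (f (\<lambda>i. 0)) 1"
    by (rule open_contains_cylinder[where x = "\<lambda>i. 0"]) auto
  have "cmod (f y) \<le> cmod (f (\<lambda>i. 0)) + 1" if "\<And>i. i < n \<Longrightarrow> cmod (y i) < e" for y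
    using ne(2)[of y] that norm_triangle_ineq2[of "f y" "f (\<lambda>i. 0)"]
    by (auto simp: dist_norm norm_minus_commute)
  then show thesis using bounded_on_cylinder_imp_cyl[OF f ne(1)] that by blast
qed

definition trunc :: "nat \<Rightarrow> (nat \<Rightarrow> complex) \<Rightarrow> nat \<Rightarrow> complex" where
  "trunc n x = (\<lambda>i. if i < n then x i else 0)"

lemma cyl_trunc: "cyl n f \<Longrightarrow> f (trunc n x) = f x"
  by (rule cylD) (auto simp: trunc_def)

lemma trunc_linear: "trunc n (\<lambda>i. x i + z * y i) = (\<lambda>i. trunc n x i + z * trunc n y i)"
  by (auto simp: trunc_def)

lemma entire_trunc: "f \<in> entire \<Longrightarrow> (\<lambda>x. f (trunc n x)) \<in> entire"
proof -
  assume f: "f \<in> entire"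
  have "continuous_on UNIV (trunc n)"
  proof (rule continuous_on_coordinatewise_then_product)
    show "continuous_on UNIV (\<lambda>x. trunc n x i)" for i
      by (cases "i < n") (auto simp: trunc_def intro: continuous_on_product_coordinates)
  qed
  then have "continuous_on UNIV (\<lambda>x. f (trunc n x))"
    using f by (auto simp: entire_iff intro: continuous_on_compose2[of UNIV f])
  then show ?thesis using f by (auto simp: entire_iff trunc_linear)
qed

text \<open>
  A set restricted in only \<open>n\<close> coordinates is not compact, but after truncation it lies in a compact
  polydisc with the same values of \<open>f\<close>.
\<close>

lemma cyl_bounded:
  assumes f: "f \<in> entire" and n: "cyl n f"
  obtains B where "B \<ge> 0" "\<And>x. (\<And>i. i < n \<Longrightarrow> cmod (x i) \<le> r) \<Longrightarrow> cmod (f x) \<le> B"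
proof -
  have "compact (f ` {x. \<forall>i. cmod (x i) \<le> \<bar>r\<bar>})"
    using f by (intro compact_continuous_image compact_polydisc)
      (auto simp: entire_iff intro: continuous_on_subset)
  then obtain B where B: "\<forall>z\<in>f ` {x. \<forall>i. cmod (x i) \<le> \<bar>r\<bar>}. cmod z \<le> B"
    using compact_imp_bounded bounded_iff by metis
  have "cmod (f x) \<le> max B 0" if "\<And>i. i < n \<Longrightarrow> cmod (x i) \<le> r" for x
  proof -
    have "\<forall>i. cmod (trunc n x i) \<le> \<bar>r\<bar>" using that by (fastforce simp: trunc_def)
    then have "cmod (f (trunc n x)) \<le> B" using B by blast
    then show ?thesis using cyl_trunc[OF n, of x] by simp
  qed
  then show thesis using that[of "max B 0"] by auto
qed

section \<open>Seminorms on the space of entire functions\<close>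

lemma holo_space_eq: "holo_space CN CN_top = fun_space UNIV entire"
  by (simp add: holo_space_def)

text \<open>
  Extended suprema are exchanged for real upper bounds \<open>B\<close>. If the supremum is infinite, the left-hand
  side holds because \<open>c\<close> is positive, and the right-hand side is vacuous.
\<close>

lemma le_sup_abs_iff:
  assumes "c > 0"
  shows "ennreal a \<le> ennreal c * sup_abs W f \<longleftrightarrow>
    (\<forall>B\<ge>0. (\<forall>x\<in>W. cmod (f x) \<le> B) \<longrightarrow> a \<le> c * B)"
proof (intro iffI allI impI)
  fix B :: real assume a: "ennreal a \<le> ennreal c * sup_abs W f" and B: "B \<ge> 0" "\<forall>x\<in>W. cmod (f x) \<le> B"
  have "sup_abs W f \<le> ennreal B"
    unfolding sup_abs_def using B(2) by (intro SUP_least ennreal_leI) auto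
  then have "ennreal a \<le> ennreal c * ennreal B"
    using a by (meson mult_left_mono order_trans zero_le)
  then show "a \<le> c * B"
    using assms B(1) by (simp add: ennreal_mult[symmetric] ennreal_le_iff)
next
  assume R: "\<forall>B\<ge>0. (\<forall>x\<in>W. cmod (f x) \<le> B) \<longrightarrow> a \<le> c * B"
  show "ennreal a \<le> ennreal c * sup_abs W f"
  proof (cases "sup_abs W f")
    case (real B)
    have "cmod (f x) \<le> B" if "x \<in> W" for x
    proof -
      have "ennreal (cmod (f x)) \<le> sup_abs W f"
        unfolding sup_abs_def using that by (rule SUP_upper)
      then show ?thesis using real by simp
    qed
    then have "a \<le> c * B" using R real(1) by blast
    then show ?thesis using real assms by (simp add: ennreal_mult[symmetric] ennreal_leI)
  next
    case top
    then show ?thesis using assms by (simp add: ennreal_mult_top)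
  qed
qed

text \<open>
  On every stage, \<open>q\<close> is dominated by a multiple of the supremum over a polydisc of that stage. The
  supremum is expressed through its upper bounds \<open>B\<close>, so that estimates can be verified pointwise.
\<close>

definition stage_bounded :: "(((nat \<Rightarrow> complex) \<Rightarrow> complex) \<Rightarrow> real) \<Rightarrow> bool" where
  "stage_bounded q \<longleftrightarrow>
    (\<forall>n. \<exists>r>0. \<exists>c>0. \<forall>f\<in>entire. cyl n f \<longrightarrow>
      (\<forall>B\<ge>0. (\<forall>x. (\<forall>i<n. cmod (x i) \<le> r) \<longrightarrow> cmod (f x) \<le> B) \<longrightarrow> q f \<le> c * B))"

text \<open>
  The same domination, uniformly over all stages, by one compact polydisc in all coordinates.
\<close>

definition polydisc_bounded :: "(((nat \<Rightarrow> complex) \<Rightarrow> complex) \<Rightarrow> real) \<Rightarrow> bool" where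
  "polydisc_bounded q \<longleftrightarrow>
    (\<exists>R. (\<forall>i. R i \<ge> 0) \<and> (\<exists>c>0. \<forall>f\<in>entire.
      \<forall>B\<ge>0. (\<forall>x. (\<forall>i. cmod (x i) \<le> R i) \<longrightarrow> cmod (f x) \<le> B) \<longrightarrow> q f \<le> c * B))"

lemma open_coordinate_less: "open {x :: nat \<Rightarrow> complex. \<forall>i<n. cmod (x i) < R i}"
proof -
  have "{x :: nat \<Rightarrow> complex. \<forall>i<n. cmod (x i) < R i} = (\<Inter>i<n. (\<lambda>x. x i) -` ball 0 (R i))"
    by auto
  moreover have "open ((\<lambda>x. x i) -` ball (0 :: complex) (R i))" for i :: nat
    by (intro open_vimage open_ball continuous_on_product_coordinates)
  ultimately show ?thesis by (simp add: open_INT)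
qed

text \<open>
  For one direction, the cover of the sequence space by the cylinders \<open>{x. |x i| < k for i < n}\<close> yields
  the estimate on the stage \<open>n\<close>. For the other one, a member \<open>W m\<close> of the given cover that contains \<open>0\<close>
  contains a cylinder, over \<open>n\<close> coordinates say; a function that is bounded on \<open>W m\<close> then belongs to the
  stage \<open>n\<close>, so that a single one of the estimates suffices.
\<close>

lemma delta_seminorm_iff:
  "delta_seminorm CN CN_top q \<longleftrightarrow> seminorm_on (holo_space CN CN_top) q \<and> stage_bounded q"
proof (intro iffI conjI)
  assume q: "delta_seminorm CN CN_top q"
  then show "seminorm_on (holo_space CN CN_top) q" by (simp add: delta_seminorm_def)
  show "stage_bounded q"
    unfolding stage_bounded_def
  proof
    fix n
    define W where "W = (\<lambda>k :: nat. {x :: nat \<Rightarrow> complex. \<forall>i<n. cmod (x i) < real k})"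
    have "\<exists>k. x \<in> W k" for x
    proof -
      obtain k :: nat where "(\<Sum>i<n. cmod (x i)) < k" using reals_Archimedean2 by blast
      moreover have "cmod (x i) \<le> (\<Sum>i<n. cmod (x i))" if "i < n" for i
        using that by (intro member_le_sum) auto
      ultimately have "x \<in> W k" unfolding W_def by (auto intro: le_less_trans)
      then show ?thesis ..
    qed
    moreover have "incseq W"
      unfolding W_def by (intro monoI) (auto simp: le_fun_def intro: less_le_trans)
    moreover have "open (W k)" for k
      unfolding W_def by (rule open_coordinate_less)
    ultimately obtain k c where c: "c > 0" "\<forall>f\<in>entire. ennreal (q f) \<le> ennreal c * sup_abs (W k) f"
      using q unfolding delta_seminorm_def CN_top_eq open_openin[symmetric]
      by (auto dest!: spec[of _ W] simp: set_eq_iff)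
    \<comment> \<open>the radius \<open>Suc k\<close> is positive also for \<open>k = 0\<close>\<close>
    have "q f \<le> c * B" if "f \<in> entire" "B \<ge> 0" "\<forall>x. (\<forall>i<n. cmod (x i) \<le> real (Suc k)) \<longrightarrow> cmod (f x) \<le> B" for f B
      using c that unfolding le_sup_abs_iff[OF c(1)]
      by (force simp: W_def)
    then show "\<exists>r>0. \<exists>c>0. \<forall>f\<in>entire. cyl n f \<longrightarrow>
      (\<forall>B\<ge>0. (\<forall>x. (\<forall>i<n. cmod (x i) \<le> r) \<longrightarrow> cmod (f x) \<le> B) \<longrightarrow> q f \<le> c * B)"
      using c(1) by (intro exI[of _ "real (Suc k)"] conjI exI[of _ c]) auto
  qed
next
  assume q: "seminorm_on (holo_space CN CN_top) q \<and> stage_bounded q"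
  show "delta_seminorm CN CN_top q"
    unfolding delta_seminorm_def
  proof (intro conjI allI impI)
    show "seminorm_on (holo_space CN CN_top) q" using q by simp
    fix W :: "nat \<Rightarrow> (nat \<Rightarrow> complex) set"
    assume "(\<forall>n. openin CN_top (W n)) \<and> incseq W \<and> (\<Union>n. W n) = vcarrier CN"
    then have W: "\<And>n. open (W n)" "incseq W" "(\<Union>n. W n) = UNIV"
      by (auto simp: CN_top_eq)
    obtain m where m: "(\<lambda>i. 0) \<in> W m" using W(3) by blast
    obtain n e where e: "e > 0" "\<And>x. (\<And>i. i < n \<Longrightarrow> cmod (x i - 0) < e) \<Longrightarrow> x \<in> W m"
      by (rule open_contains_cylinder[OF W(1) m]) blast
    obtain r c where rc: "r > 0" "c > 0" "\<And>f B. f \<in> entire \<Longrightarrow> cyl n f \<Longrightarrow> B \<ge> 0 \<Longrightarrow>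
        (\<And>x. (\<And>i. i < n \<Longrightarrow> cmod (x i) \<le> r) \<Longrightarrow> cmod (f x) \<le> B) \<Longrightarrow> q f \<le> c * B"
      using q unfolding stage_bounded_def by metis
    \<comment> \<open>the polydisc of the stage \<open>n\<close>, compact because its other coordinates are
      \<open>0\<close>\<close>
    define K where "K = {x :: nat \<Rightarrow> complex. \<forall>i. cmod (x i) \<le> (if i < n then r else 0)}"
    have "compact K" unfolding K_def by (rule compact_polydisc)
    then obtain C where C: "finite C" "K \<subseteq> (\<Union>k\<in>C. W k)"
    proof (rule compactE_image[of K UNIV W])
      show "K \<subseteq> (\<Union>k. W k)" using W(3) by simp
    qed (use W(1) in auto)
    define k where "k = Max (insert m C)"
    have k: "j \<le> k" if "j \<in> insert m C" for j
      unfolding k_def using that C(1) by (intro Max_ge) auto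
    have Wk: "W j \<subseteq> W k" if "j \<in> insert m C" for j
      using incseqD[OF W(2) k[OF that]] .
    have "q f \<le> c * B" if f: "f \<in> entire" and B: "B \<ge> 0" "\<forall>x\<in>W k. cmod (f x) \<le> B" for f B
    proof (rule rc(3)[OF f _ B(1)])
      have fB: "cmod (f x) \<le> B" if "\<And>i. i < n \<Longrightarrow> cmod (x i) < e" for x
        using e(2)[of x] that Wk[of m] B(2) by auto
      show n: "cyl n f"
        using bounded_on_cylinder_imp_cyl[OF f e(1) fB] by blast
      fix x assume x: "\<And>i. i < n \<Longrightarrow> cmod (x i) \<le> r"
      have "trunc n x \<in> K" using x by (auto simp: K_def trunc_def)
      then have "trunc n x \<in> W k" using C(2) Wk by blast
      then show "cmod (f x) \<le> B" using B(2) cyl_trunc[OF n, of x] by auto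
    qed
    then show "\<exists>k. \<exists>c>0. \<forall>f\<in>entire. ennreal (q f) \<le> ennreal c * sup_abs (W k) f"
      using rc(2) by (intro exI[of _ k] exI[of _ c]) (simp add: le_sup_abs_iff)
  qed
qed

text \<open>
  The Schwarz lemma, rescaled. It concerns functions of modulus less than \<open>1\<close> on the unit disc, so the
  bound \<open>M\<close> is first enlarged by a margin that tends to \<open>0\<close>.
\<close>

lemma schwarz_estimate:
  assumes h: "h holomorphic_on UNIV" and h0: "h 0 = 0" and r: "r > 0"
    and M: "\<And>z. cmod z \<le> r \<Longrightarrow> cmod (h z) \<le> M" and z: "cmod z < r"
  shows "cmod (h z) \<le> M * cmod z / r"
proof (rule field_le_epsilon)
  fix e :: real assume e: "e > 0"
  have M0: "M \<ge> 0" using M[of 0] h0 r by simp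
  \<comment> \<open>the margin which contributes at most \<open>e\<close> after multiplication by
    \<open>|z| / r\<close>\<close>
  define e' where "e' = e * r / (cmod z + 1)"
  have z1: "cmod z + 1 > 0" using norm_ge_zero[of z] by linarith
  then have e': "e' > 0" using e r by (simp add: e'_def)
  define g where "g = (\<lambda>w. h (complex_of_real r * w) / complex_of_real (M + e'))"
  have "cmod (g (z / complex_of_real r)) \<le> cmod (z / complex_of_real r)"
  proof (rule Schwarz_Lemma(1))
    show "g holomorphic_on ball 0 1"
      unfolding g_def using M0 e'
      by (intro holomorphic_intros holomorphic_on_compose_gen[OF _ h, unfolded o_def]) (auto simp del: of_real_add)
    show "g 0 = 0" by (simp add: g_def h0)
    show "cmod (g w) < 1" if "cmod w < 1" for w
    proof -
      have "cmod (complex_of_real r * w) \<le> r" using that r by (simp add: norm_mult)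
      then have "cmod (h (complex_of_real r * w)) < M + e'" using M e' by (meson less_add_same_cancel1 le_less_trans)
      then show ?thesis using M0 e' by (simp add: g_def norm_divide del: of_real_add)
    qed
    show "cmod (z / complex_of_real r) < 1" using z r by (simp add: norm_divide)
  qed
  then have "cmod (h z) / (M + e') \<le> cmod z / r"
    using r M0 e' by (simp add: g_def norm_divide del: of_real_add)
  then have "cmod (h z) \<le> (M + e') * (cmod z / r)"
    using M0 e' by (simp add: divide_simps mult.commute split: if_splits)
  also have "\<dots> = M * cmod z / r + e * (cmod z / (cmod z + 1))"
    using r by (simp add: e'_def field_simps)
  also have "\<dots> \<le> M * cmod z / r + e"
    using e z1 by (intro add_left_mono mult_left_le) (auto simp: divide_simps)
  finally show "cmod (h z) \<le> M * cmod z / r + e" .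
qed

lemma seminorm_entire:
  assumes "seminorm_on (fun_space UNIV entire) q"
  shows "f \<in> entire \<Longrightarrow> 0 \<le> q f"
    and "f \<in> entire \<Longrightarrow> g \<in> entire \<Longrightarrow> q (\<lambda>x. f x + g x) \<le> q f + q g"
    and "f \<in> entire \<Longrightarrow> q (\<lambda>x. c * f x) = cmod c * q f"
  using assms by (auto simp: seminorm_on_def)

text \<open>
  The constant \<open>c\<close> of portedness depends on the neighbourhood of \<open>K\<close>, and a bound in finitely many
  coordinates is available only on neighbourhoods that are unbounded in the others; this gives constants
  \<open>c n\<close> on the stages without control of their growth. They are absorbed by the radii: the \<open>n\<close>-th
  telescoping difference of \<open>f\<close> vanishes with the \<open>n\<close>-th coordinate, so enlarging that radius by \<open>l n\<close>
  improves its bound by \<open>1 / l n\<close>.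
\<close>

lemma ported_seminorm_iff:
  "ported_seminorm CN CN_top q \<longleftrightarrow> seminorm_on (holo_space CN CN_top) q \<and> polydisc_bounded q"
proof (intro iffI conjI)
  assume q: "ported_seminorm CN CN_top q"
  then show sq: "seminorm_on (holo_space CN CN_top) q" by (simp add: ported_seminorm_def)
  note qs = seminorm_entire[OF sq[unfolded holo_space_eq]]
  obtain K where K: "compact K" "\<And>W. open W \<Longrightarrow> K \<subseteq> W \<Longrightarrow>
      \<exists>c>0. \<forall>f\<in>entire. ennreal (q f) \<le> ennreal c * sup_abs W f"
    using q by (auto simp: ported_seminorm_def CN_top_eq)
  obtain R where R: "\<And>i. R i \<ge> 0" "\<And>x i. x \<in> K \<Longrightarrow> cmod (x i) \<le> R i"
    using compact_in_polydisc[OF K(1)] by blast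
  define W where "W = (\<lambda>n. {x :: nat \<Rightarrow> complex. \<forall>i<n. cmod (x i) < R i + 1})"
  have "\<exists>c>0. \<forall>f\<in>entire. ennreal (q f) \<le> ennreal c * sup_abs (W n) f" for n
  proof (rule K(2))
    show "open (W n)" unfolding W_def by (rule open_coordinate_less)
    show "K \<subseteq> W n" unfolding W_def using le_less_trans[OF R(2) less_add_one] by blast
  qed
  then obtain c where c: "\<And>n. c n > 0" "\<And>n f. f \<in> entire \<Longrightarrow> ennreal (q f) \<le> ennreal (c n) * sup_abs (W n) f"
    by metis
  have cB: "q f \<le> c n * B" if "f \<in> entire" "B \<ge> 0" "\<And>x. x \<in> W n \<Longrightarrow> cmod (f x) \<le> B" for f n B
    using c(2)[OF that(1), of n] that unfolding le_sup_abs_iff[OF c(1)] by auto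
  \<comment> \<open>chosen so that \<open>c (Suc n) / l n \<le> 1 / 2 ^ n\<close>, which is summable;
    \<open>c (Suc n)\<close> because the \<open>n\<close>-th difference uses \<open>n + 1\<close> coordinates\<close>
  define l where "l = (\<lambda>n. max 1 (c (Suc n) * 2 ^ n))"
  have l: "l n \<ge> 1" "c (Suc n) \<le> l n * (1/2) ^ n" for n
  proof -
    have "c (Suc n) * 2 ^ n \<le> l n" by (simp add: l_def)
    then show "c (Suc n) \<le> l n * (1/2) ^ n" by (simp add: field_simps)
  qed (simp add: l_def)
  define R' where "R' = (\<lambda>i. l i * (R i + 1))"
  have RR': "R i + 1 \<le> R' i" for i
    using mult_right_mono[OF l(1)[of i], of "R i + 1"] R(1)[of i] by (simp add: R'_def)
  have "q f \<le> (c 0 + 4) * B" if f: "f \<in> entire" and B: "B \<ge> 0"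
    and fB: "\<forall>x. (\<forall>i. cmod (x i) \<le> R' i) \<longrightarrow> cmod (f x) \<le> B" for f B
  proof -
    obtain N where N: "cyl N f" using entire_cyl[OF f] .
    have R'0: "R' i \<ge> 0" for i using RR'[of i] R(1)[of i] by linarith
    have ftB: "cmod (f (trunc n x)) \<le> B" if "\<And>i. i < n \<Longrightarrow> cmod (x i) \<le> R' i" for n x
      using that R'0 by (intro fB[rule_format]) (auto simp: trunc_def)
    define g where "g = (\<lambda>n x. f (trunc (Suc n) x) - f (trunc n x))"
    have g: "g n \<in> entire" for n
      unfolding g_def by (intro entire_diff entire_trunc f)
    have gq: "q (g n) \<le> (1/2) ^ n * (2 * B)" for n
    proof -
      have "q (g n) \<le> c (Suc n) * (2 * B / l n)"
      proof (rule cB[OF g])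
        show "2 * B / l n \<ge> 0" using B l(1)[of n] by simp
        fix x assume x: "x \<in> W (Suc n)"
        \<comment> \<open>the \<open>n\<close>-th difference as a function of its last coordinate\<close>
        define h where "h = (\<lambda>z. g n (x(n := z)))"
        have hline: "h = (\<lambda>z. g n (\<lambda>i. (x(n := 0)) i + z * (if i = n then 1 else 0)))"
          unfolding h_def by (intro ext arg_cong[of _ _ "g n"]) auto
        have "cmod (h (x n)) \<le> 2 * B * cmod (x n) / R' n"
        proof (rule schwarz_estimate)
          show "h holomorphic_on UNIV" unfolding hline by (intro entire_line g)
          have "trunc (Suc n) (x(n := 0)) = trunc n (x(n := 0))" by (auto simp: trunc_def fun_eq_iff less_Suc_eq)
          then show "h 0 = 0" by (simp add: h_def g_def)
          have xi: "cmod (x i) < R i + 1" if "i < Suc n" for i using x that by (auto simp: W_def)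
          show "cmod (x n) < R' n" using xi[of n] RR'[of n] by simp
          show "R' n > 0" using R(1)[of n] RR'[of n] by linarith
          show "cmod (h z) \<le> 2 * B" if "cmod z \<le> R' n" for z
          proof -
            have "cmod ((x(n := z)) i) \<le> R' i" if "i < Suc n" for i
              using xi[OF that] RR'[of i] \<open>cmod z \<le> R' n\<close> by auto
            then have "cmod (f (trunc (Suc n) (x(n := z)))) \<le> B" "cmod (f (trunc n (x(n := z)))) \<le> B"
              by (intro ftB; metis less_SucI)+
            then show ?thesis
              unfolding h_def g_def using norm_triangle_ineq4 by (smt (verit))
          qed
        qed
        also have "\<dots> \<le> 2 * B / l n"
        proof -
          have "cmod (x n) \<le> R n + 1" using x by (auto simp: W_def less_eq_real_def)
          then have "2 * B * cmod (x n) / R' n \<le> 2 * B * (R n + 1) / R' n"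
            using B R'0 by (intro divide_right_mono mult_left_mono) auto
          also have "\<dots> = 2 * B / l n"
            using R(1)[of n] l(1)[of n] by (simp add: R'_def)
          finally show ?thesis .
        qed
        finally show "cmod (g n x) \<le> 2 * B / l n" by (simp add: h_def)
      qed
      also have "\<dots> \<le> l n * (1/2) ^ n * (2 * B / l n)"
        using l(1)[of n] B by (intro mult_right_mono l(2)) auto
      also have "\<dots> = (1/2) ^ n * (2 * B)" using l(1)[of n] by simp
      finally show ?thesis .
    qed
    have "q (\<lambda>x. f (trunc n x)) \<le> c 0 * B + (\<Sum>k<n. (1/2) ^ k * (2 * B))" for n
    proof (induction n)
      case 0
      have "q (\<lambda>x. f (trunc 0 x)) \<le> c 0 * B"
        using ftB[of 0] by (intro cB entire_trunc f B) auto
      then show ?case by simp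
    next
      case (Suc n)
      have "q (\<lambda>x. f (trunc (Suc n) x)) = q (\<lambda>x. f (trunc n x) + g n x)" by (simp add: g_def)
      also have "\<dots> \<le> q (\<lambda>x. f (trunc n x)) + q (g n)" by (intro qs(2) entire_trunc f g)
      finally show ?case using Suc gq[of n] by simp
    qed
    from this[of N] have "q f \<le> c 0 * B + (\<Sum>k<N. (1/2) ^ k * (2 * B))"
      using cyl_trunc[OF N] by simp
    also have "(\<Sum>k<N. (1/2) ^ k * (2 * B)) = (\<Sum>k<N. (1/2) ^ k) * (2 * B)"
      by (simp add: sum_distrib_right)
    also have "\<dots> \<le> 2 * (2 * B)"
      using B by (intro mult_right_mono) (simp_all add: sum_gp_strict)
    finally show ?thesis by (simp add: algebra_simps)
  qed
  moreover have "R' i \<ge> 0" for i using RR'[of i] R(1)[of i] by linarith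
  moreover have "c 0 + 4 > 0" using c(1)[of 0] by simp
  ultimately show "polydisc_bounded q"
    unfolding polydisc_bounded_def by blast
next
  assume q: "seminorm_on (holo_space CN CN_top) q \<and> polydisc_bounded q"
  then obtain R c where R: "c > 0" "\<And>f B. f \<in> entire \<Longrightarrow> B \<ge> 0 \<Longrightarrow>
      (\<And>x. (\<And>i. cmod (x i) \<le> R i) \<Longrightarrow> cmod (f x) \<le> B) \<Longrightarrow> q f \<le> c * B"
    unfolding polydisc_bounded_def by metis
  show "ported_seminorm CN CN_top q"
    unfolding ported_seminorm_def
  proof (intro conjI exI[of _ "{x. \<forall>i. cmod (x i) \<le> R i}"] allI impI exI[of _ c] ballI)
    show "seminorm_on (holo_space CN CN_top) q" using q by simp
    show "compactin CN_top {x. \<forall>i. cmod (x i) \<le> R i}"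
      by (simp add: CN_top_eq compact_polydisc)
    show "ennreal (q f) \<le> ennreal c * sup_abs W f"
      if "openin CN_top W \<and> {x. \<forall>i. cmod (x i) \<le> R i} \<subseteq> W" "f \<in> entire" for W f
      using that R(2)[of f] by (auto simp: le_sup_abs_iff[OF R(1)])
  qed (rule R(1))
qed

text \<open>
  Functions of the stage \<open>n\<close> see the first \<open>n\<close> radii only, and any common bound of these can serve as the
  radius of the stage.
\<close>

lemma polydisc_bounded_imp_stage_bounded:
  assumes "polydisc_bounded q"
  shows "stage_bounded q"
  unfolding stage_bounded_def
proof
  fix n
  obtain R c where R: "\<And>i. R i \<ge> 0" "c > 0" "\<And>f B. f \<in> entire \<Longrightarrow> B \<ge> 0 \<Longrightarrow>
      (\<And>x. (\<And>i. cmod (x i) \<le> R i) \<Longrightarrow> cmod (f x) \<le> B) \<Longrightarrow> q f \<le> c * B"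
    using assms unfolding polydisc_bounded_def by metis
  define r where "r = 1 + (\<Sum>i<n. R i)"
  have r: "r > 0" unfolding r_def using R(1) by (simp add: add_pos_nonneg sum_nonneg)
  have Rr: "R i \<le> r" if "i < n" for i
    using member_le_sum[of i "{..<n}" R] that R(1) by (simp add: r_def)
  have "q f \<le> c * B" if "f \<in> entire" "B \<ge> 0"
    "\<forall>x. (\<forall>i<n. cmod (x i) \<le> r) \<longrightarrow> cmod (f x) \<le> B" for f B
  proof (rule R(3)[OF that(1,2)])
    show "cmod (f x) \<le> B" if "\<And>i. cmod (x i) \<le> R i" for x
      using order_trans[OF that Rr] \<open>\<forall>x. (\<forall>i<n. cmod (x i) \<le> r) \<longrightarrow> cmod (f x) \<le> B\<close> by blast
  qed
  then show "\<exists>r>0. \<exists>c>0. \<forall>f\<in>entire. cyl n f \<longrightarrow>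
      (\<forall>B\<ge>0. (\<forall>x. (\<forall>i<n. cmod (x i) \<le> r) \<longrightarrow> cmod (f x) \<le> B) \<longrightarrow> q f \<le> c * B)"
    using r R(2) by (intro exI[of _ r] conjI exI[of _ c]) auto
qed

section \<open>The three topologies on entire functions\<close>

lemma stage_bounded_add:
  assumes "stage_bounded q" "stage_bounded q'"
  shows "stage_bounded (\<lambda>f. q f + q' f)"
  unfolding stage_bounded_def
proof
  fix n
  obtain r c where r: "r > 0" "c > 0" "\<And>f B. f \<in> entire \<Longrightarrow> cyl n f \<Longrightarrow> B \<ge> 0 \<Longrightarrow>
      (\<forall>x. (\<forall>i<n. cmod (x i) \<le> r) \<longrightarrow> cmod (f x) \<le> B) \<Longrightarrow> q f \<le> c * B"
    using assms(1) unfolding stage_bounded_def by metis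
  obtain r' c' where r': "r' > 0" "c' > 0" "\<And>f B. f \<in> entire \<Longrightarrow> cyl n f \<Longrightarrow> B \<ge> 0 \<Longrightarrow>
      (\<forall>x. (\<forall>i<n. cmod (x i) \<le> r') \<longrightarrow> cmod (f x) \<le> B) \<Longrightarrow> q' f \<le> c' * B"
    using assms(2) unfolding stage_bounded_def by metis
  have "q f + q' f \<le> (c + c') * B" if "f \<in> entire" "cyl n f" "B \<ge> 0"
    and fB: "\<forall>x. (\<forall>i<n. cmod (x i) \<le> max r r') \<longrightarrow> cmod (f x) \<le> B" for f B
    using r(3)[OF that(1-3)] r'(3)[OF that(1-3)] fB by (simp add: algebra_simps le_max_iff_disj)
  then show "\<exists>r>0. \<exists>c>0. \<forall>f\<in>entire. cyl n f \<longrightarrow>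
      (\<forall>B\<ge>0. (\<forall>x. (\<forall>i<n. cmod (x i) \<le> r) \<longrightarrow> cmod (f x) \<le> B) \<longrightarrow> q f + q' f \<le> c * B)"
    using r(1,2) r'(1,2) by (intro exI[of _ "max r r'"] conjI exI[of _ "c + c'"]) auto
qed

lemma polydisc_bounded_add:
  assumes "polydisc_bounded q" "polydisc_bounded q'"
  shows "polydisc_bounded (\<lambda>f. q f + q' f)"
proof -
  obtain R c where R: "\<And>i. R i \<ge> 0" "c > 0" "\<And>f B. f \<in> entire \<Longrightarrow> B \<ge> 0 \<Longrightarrow>
      (\<forall>x. (\<forall>i. cmod (x i) \<le> R i) \<longrightarrow> cmod (f x) \<le> B) \<Longrightarrow> q f \<le> c * B"
    using assms(1) unfolding polydisc_bounded_def by metis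
  obtain R' c' where R': "\<And>i. R' i \<ge> 0" "c' > 0" "\<And>f B. f \<in> entire \<Longrightarrow> B \<ge> 0 \<Longrightarrow>
      (\<forall>x. (\<forall>i. cmod (x i) \<le> R' i) \<longrightarrow> cmod (f x) \<le> B) \<Longrightarrow> q' f \<le> c' * B"
    using assms(2) unfolding polydisc_bounded_def by metis
  have "q f + q' f \<le> (c + c') * B" if "f \<in> entire" "B \<ge> 0"
    and fB: "\<forall>x. (\<forall>i. cmod (x i) \<le> max (R i) (R' i)) \<longrightarrow> cmod (f x) \<le> B" for f B
    using R(3)[OF that(1,2)] R'(3)[OF that(1,2)] fB by (simp add: algebra_simps le_max_iff_disj)
  then show ?thesis
    unfolding polydisc_bounded_def using R(1,2) R'(1,2)
    by (intro exI[of _ "\<lambda>i. max (R i) (R' i)"] conjI exI[of _ "c + c'"]) (auto simp: le_max_iff_disj)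
qed

lemma seminorm_on_add:
  assumes "seminorm_on V q" "seminorm_on V q'"
  shows "seminorm_on V (\<lambda>f. q f + q' f)"
  unfolding seminorm_on_def
proof (intro conjI ballI allI)
  fix f assume f: "f \<in> vcarrier V"
  show "0 \<le> q f + q' f" "q (vscale V c f) + q' (vscale V c f) = cmod c * (q f + q' f)" for c
    using assms f by (simp_all add: seminorm_on_def distrib_left)
  fix g assume g: "g \<in> vcarrier V"
  have "q (vadd V f g) \<le> q f + q g" "q' (vadd V f g) \<le> q' f + q' g"
    using assms f g by (simp_all add: seminorm_on_def)
  then show "q (vadd V f g) + q' (vadd V f g) \<le> q f + q' f + (q g + q' g)" by linarith
qed

lemma seminorm_on_zero: "seminorm_on V (\<lambda>_. 0)"
  by (simp add: seminorm_on_def)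

lemma stage_bounded_zero: "stage_bounded (\<lambda>_. 0)"
  unfolding stage_bounded_def by (auto intro!: exI[of _ "1 :: real"])

lemma polydisc_bounded_zero: "polydisc_bounded (\<lambda>_. 0)"
  unfolding polydisc_bounded_def by (auto intro!: exI[of _ "1 :: real"] exI[of _ "\<lambda>_. 0"])

interpretation delta: seminormed_functions entire "{q. delta_seminorm CN CN_top q}"
  by unfold_locales
    (auto simp: delta_seminorm_iff holo_space_eq seminorm_on_add stage_bounded_add
      entire_const entire_add entire_scale intro!: exI[of _ "\<lambda>_. 0"] seminorm_on_zero stage_bounded_zero)

interpretation omega: seminormed_functions entire "{q. ported_seminorm CN CN_top q}"
  by unfold_locales
    (auto simp: ported_seminorm_iff holo_space_eq seminorm_on_add polydisc_bounded_add
      entire_const entire_add entire_scale intro!: exI[of _ "\<lambda>_. 0"] seminorm_on_zero polydisc_bounded_zero)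

lemma openin_tau_delta:
  "openin (tau_delta CN CN_top) U \<longleftrightarrow> U \<subseteq> entire \<and>
    (\<forall>f\<in>U. \<exists>q. delta_seminorm CN CN_top q \<and> (\<exists>r>0. {g \<in> entire. q (\<lambda>x. g x - f x) < r} \<subseteq> U))"
  using delta.openin_seminorm_topology by (simp add: tau_delta_def holo_space_eq)

lemma openin_tau_omega:
  "openin (tau_omega CN CN_top) U \<longleftrightarrow> U \<subseteq> entire \<and>
    (\<forall>f\<in>U. \<exists>q. ported_seminorm CN CN_top q \<and> (\<exists>r>0. {g \<in> entire. q (\<lambda>x. g x - f x) < r} \<subseteq> U))"
  using omega.openin_seminorm_topology by (simp add: tau_omega_def holo_space_eq)

lemma tau_delta_contains_ball:
  assumes "openin (tau_delta CN CN_top) U" "f \<in> U"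
  obtains q r where "delta_seminorm CN CN_top q" "r > 0"
    "\<And>g. g \<in> entire \<Longrightarrow> q (\<lambda>x. g x - f x) < r \<Longrightarrow> g \<in> U"
  using assms unfolding openin_tau_delta by blast

lemma tau_omega_contains_ball:
  assumes "openin (tau_omega CN CN_top) U" "f \<in> U"
  obtains q r where "ported_seminorm CN CN_top q" "r > 0"
    "\<And>g. g \<in> entire \<Longrightarrow> q (\<lambda>x. g x - f x) < r \<Longrightarrow> g \<in> U"
  using assms unfolding openin_tau_omega by blast

lemma ported_imp_delta: "ported_seminorm CN CN_top q \<Longrightarrow> delta_seminorm CN CN_top q"
  by (simp add: ported_seminorm_iff delta_seminorm_iff polydisc_bounded_imp_stage_bounded)

lemma tau_omega_le_tau_delta: "openin (tau_omega CN CN_top) U \<Longrightarrow> openin (tau_delta CN CN_top) U"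
  unfolding openin_tau_omega openin_tau_delta by (meson ported_imp_delta)

text \<open>
  The suprema over polydiscs generate the compact-open topology, because every compact set lies in a
  polydisc.
\<close>

definition sup_seminorm :: "(nat \<Rightarrow> real) \<Rightarrow> ((nat \<Rightarrow> complex) \<Rightarrow> complex) \<Rightarrow> real" where
  "sup_seminorm R f = (SUP x\<in>{x. \<forall>i. cmod (x i) \<le> R i}. cmod (f x))"

lemma bdd_above_polydisc:
  assumes "f \<in> entire"
  shows "bdd_above ((\<lambda>x. cmod (f x)) ` {x. \<forall>i. cmod (x i) \<le> R i})"
proof -
  have "compact ((\<lambda>x. cmod (f x)) ` {x. \<forall>i. cmod (x i) \<le> R i})"
    using assms by (intro compact_continuous_image compact_polydisc continuous_on_norm)
      (auto simp: entire_iff intro: continuous_on_subset)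
  then show ?thesis by (intro bounded_imp_bdd_above compact_imp_bounded)
qed

lemma sup_seminorm_upper:
  "f \<in> entire \<Longrightarrow> (\<And>i. cmod (x i) \<le> R i) \<Longrightarrow> cmod (f x) \<le> sup_seminorm R f"
  unfolding sup_seminorm_def by (intro cSUP_upper bdd_above_polydisc) auto

lemma sup_seminorm_least:
  assumes "\<And>i. R i \<ge> 0" "\<And>x. (\<And>i. cmod (x i) \<le> R i) \<Longrightarrow> cmod (f x) \<le> B"
  shows "sup_seminorm R f \<le> B"
  unfolding sup_seminorm_def using assms by (intro cSUP_least) (auto intro!: exI[of _ "\<lambda>i. 0"])

lemma ported_sup_seminorm:
  assumes R: "\<And>i. R i \<ge> 0"
  shows "ported_seminorm CN CN_top (sup_seminorm R)"
  unfolding ported_seminorm_iff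
proof
  have le: "sup_seminorm R (\<lambda>x. c * f x) \<le> cmod c * sup_seminorm R f" if "f \<in> entire" for c f
    using R that by (intro sup_seminorm_least) (auto simp: norm_mult intro!: mult_left_mono sup_seminorm_upper)
  show "seminorm_on (holo_space CN CN_top) (sup_seminorm R)"
    unfolding seminorm_on_def holo_space_eq fun_space_simps restrict_UNIV_eq
  proof (intro conjI ballI allI)
    fix f assume f: "f \<in> entire"
    show "0 \<le> sup_seminorm R f"
      using order_trans[OF norm_ge_zero sup_seminorm_upper[OF f, of "\<lambda>i. 0"]] R by simp
    show "sup_seminorm R (\<lambda>x. f x + g x) \<le> sup_seminorm R f + sup_seminorm R g" if g: "g \<in> entire" for g
      using R f g by (intro sup_seminorm_least norm_triangle_le add_mono sup_seminorm_upper) auto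
    show "sup_seminorm R (\<lambda>x. c * f x) = cmod c * sup_seminorm R f" for c
    proof (cases "c = 0")
      case True
      then show ?thesis using sup_seminorm_least[of R "\<lambda>x. 0" 0, OF R]
          sup_seminorm_upper[OF entire_const[of 0], where x = "\<lambda>i. 0" and R = R] R
        by simp
    next
      case False
      have "cmod c * sup_seminorm R f \<le> cmod c * (cmod (inverse c) * sup_seminorm R (\<lambda>x. c * f x))"
        using le[OF entire_scale[OF f, of c], of "inverse c"] False by (intro mult_left_mono) (auto simp: mult.assoc[symmetric])
      also have "\<dots> = sup_seminorm R (\<lambda>x. c * f x)" using False by (simp add: norm_inverse)
      finally show ?thesis using le[OF f, of c] by linarith
    qed
  qed
  show "polydisc_bounded (sup_seminorm R)"
    unfolding polydisc_bounded_def using R sup_seminorm_least[OF R]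
    by (intro exI[of _ R] conjI exI[of _ 1]) auto
qed

lemma openin_tau_zero_subbasis:
  "compact K \<Longrightarrow> open U \<Longrightarrow> openin (tau_zero CN CN_top) {f \<in> entire. f ` K \<subseteq> U}"
  unfolding tau_zero_def by (intro topology_generated_by_Basis) (auto simp: CN_top_eq)

text \<open>
  Compactness of \<open>h ` K\<close> reduces uniform closeness to \<open>h\<close> on \<open>K\<close> to finitely many conditions of the form
  that define the compact-open topology.
\<close>

lemma tau_zero_neighbourhood:
  assumes h: "h \<in> entire" and K: "compact K" and e: "e > 0"
  obtains U where "openin (tau_zero CN CN_top) U" "h \<in> U" "\<And>g x. g \<in> U \<Longrightarrow> x \<in> K \<Longrightarrow> cmod (g x - h x) < e"
proof -
  have hc: "continuous_on A h" for A using h by (auto simp: entire_iff intro: continuous_on_subset)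
  have "compact (h ` K)" by (intro compact_continuous_image K hc)
  then obtain C where C: "C \<subseteq> h ` K" "finite C" "h ` K \<subseteq> (\<Union>c\<in>C. ball c (e / 3))"
    by (rule compactE_image[of "h ` K" "h ` K" "\<lambda>c. ball c (e / 3)"]) (use e in auto)
  \<comment> \<open>finitely many compact pieces of \<open>K\<close>, on each of which \<open>h\<close> is within
    \<open>e / 3\<close> of a value \<open>c\<close>; a function within \<open>e / 2\<close> of \<open>c\<close> there is
    within \<open>e\<close> of \<open>h\<close>\<close>
  define L where "L = (\<lambda>c. K \<inter> h -` cball c (e / 3))"
  have L: "compact (L c)" for c
    unfolding L_def using K closed_vimage[OF closed_cball hc] by (rule compact_Int_closed)
  \<comment> \<open>the second factor accounts for an empty \<open>K\<close>, for which the intersection is over the empty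
    family\<close>
  define U where "U = (\<Inter>c\<in>C. {f \<in> entire. f ` L c \<subseteq> ball c (e / 2)}) \<inter> {f \<in> entire. f ` {} \<subseteq> UNIV}"
  show thesis
  proof (rule that)
    show "openin (tau_zero CN CN_top) U"
    proof -
      have whole: "openin (tau_zero CN CN_top) {f \<in> entire. f ` {} \<subseteq> UNIV}"
        by (intro openin_tau_zero_subbasis) auto
      have "openin (tau_zero CN CN_top) (\<Inter>c\<in>C. {f \<in> entire. f ` L c \<subseteq> ball c (e / 2)})" if "C \<noteq> {}"
        using C(2) that by (intro openin_INT2 openin_tau_zero_subbasis L) auto
      then show ?thesis unfolding U_def
        by (cases "C = {}") (use whole in \<open>auto intro: openin_Int\<close>)
    qed
    show "h \<in> U" using h e by (auto simp: U_def L_def)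
    show "cmod (g x - h x) < e" if g: "g \<in> U" and x: "x \<in> K" for g x
    proof -
      obtain c where c: "c \<in> C" "dist c (h x) < e / 3" using C(3) x by auto
      then have "x \<in> L c" using x by (simp add: L_def)
      moreover have "g ` L c \<subseteq> ball c (e / 2)" using g c(1) by (simp add: U_def)
      ultimately have "dist c (g x) < e / 2" by (simp add: image_subset_iff)
      then show ?thesis using c(2) e dist_triangle[of "g x" "h x" c] by (simp add: dist_norm norm_minus_commute)
    qed
  qed
qed

lemma tau_omega_openin_subbasis:
  assumes K: "compact K" and U: "open U"
  shows "openin (tau_omega CN CN_top) {f \<in> entire. f ` K \<subseteq> U}"
  unfolding openin_tau_omega
proof (intro conjI ballI)
  fix f assume f: "f \<in> {f \<in> entire. f ` K \<subseteq> U}"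
  obtain R where R: "\<And>i. R i \<ge> 0" "\<And>x i. x \<in> K \<Longrightarrow> cmod (x i) \<le> R i"
    using compact_in_polydisc[OF K] by blast
  have "compact (f ` K)" using f by (intro compact_continuous_image K)
    (auto simp: entire_iff intro: continuous_on_subset)
  then obtain e where e: "e > 0" "\<And>z. z \<in> f ` K \<Longrightarrow> ball z e \<subseteq> U"
  proof -
    assume "compact (f ` K)"
    moreover have "f ` K \<subseteq> U" using f by blast
    ultimately obtain e where "e > 0" "(\<Union>z\<in>f ` K. cball z e) \<subseteq> U"
      using compact_subset_open_imp_cball_epsilon_subset[of "f ` K" U] U by blast
    then show ?thesis using that[of e] ball_subset_cball by blast
  qed
  have "g ` K \<subseteq> U" if g: "g \<in> entire" "sup_seminorm R (\<lambda>x. g x - f x) < e" for g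
  proof safe
    fix x assume x: "x \<in> K"
    have "cmod (g x - f x) \<le> sup_seminorm R (\<lambda>x. g x - f x)"
      using R(2)[OF x] f g by (intro sup_seminorm_upper[of "\<lambda>x. g x - f x"] entire_diff) auto
    then have "g x \<in> ball (f x) e" using g(2) by (simp add: dist_norm norm_minus_commute)
    then show "g x \<in> U" using e(2) x by blast
  qed
  then show "\<exists>q. ported_seminorm CN CN_top q \<and>
      (\<exists>r>0. {g \<in> entire. q (\<lambda>x. g x - f x) < r} \<subseteq> {f \<in> entire. f ` K \<subseteq> U})"
    using ported_sup_seminorm[OF R(1)] e(1)
    by (intro exI[of _ "sup_seminorm R"] exI[of _ e] conjI) auto
qed auto

lemma tau_zero_eq_tau_omega: "tau_zero CN CN_top = tau_omega CN CN_top"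
  unfolding topology_eq
proof (intro allI iffI)
  fix U assume U: "openin (tau_omega CN CN_top) U"
  show "openin (tau_zero CN CN_top) U"
  proof (subst openin_subopen, intro ballI)
    fix f assume f: "f \<in> U"
    obtain q r where q: "ported_seminorm CN CN_top q" "r > 0" "\<And>g. g \<in> entire \<Longrightarrow> q (\<lambda>x. g x - f x) < r \<Longrightarrow> g \<in> U"
      using tau_omega_contains_ball[OF U f] by blast
    have fe: "f \<in> entire" using U f unfolding openin_tau_omega by blast
    obtain R c where R: "c > 0" "\<And>f B. f \<in> entire \<Longrightarrow> B \<ge> 0 \<Longrightarrow>
      (\<And>x. (\<And>i. cmod (x i) \<le> R i) \<Longrightarrow> cmod (f x) \<le> B) \<Longrightarrow> q f \<le> c * B"
      using q(1) unfolding ported_seminorm_iff polydisc_bounded_def by metis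
    define e where "e = r / (2 * c)"
    have e: "e > 0" "c * e < r" using q(2) R(1) by (auto simp: e_def)
    obtain A where A: "openin (tau_zero CN CN_top) A" "f \<in> A"
      "\<And>g x. g \<in> A \<Longrightarrow> x \<in> {x. \<forall>i. cmod (x i) \<le> R i} \<Longrightarrow> cmod (g x - f x) < e"
      using tau_zero_neighbourhood[OF fe compact_polydisc e(1)] by blast
    have "A \<subseteq> entire"
      using openin_subset[OF A(1)] unfolding tau_zero_def by auto
    moreover have "q (\<lambda>x. g x - f x) \<le> c * e" if "g \<in> entire" "g \<in> A" for g
      using A(3)[OF that(2)] e fe that(1) by (intro R(2) entire_diff) (auto intro: less_imp_le)
    ultimately show "\<exists>T. openin (tau_zero CN CN_top) T \<and> f \<in> T \<and> T \<subseteq> U"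
      using A(1,2) e(2) by (intro exI[of _ A]) (auto intro!: q(3) intro: le_less_trans)
  qed
next
  fix U assume "openin (tau_zero CN CN_top) U"
  then have "generate_topology_on {{f \<in> entire. f ` K \<subseteq> U} | K U. compactin CN_top K \<and> open U} U"
    by (simp add: tau_zero_def openin_topology_generated_by_iff)
  then show "openin (tau_omega CN CN_top) U"
  proof (induction rule: generate_topology_on.induct)
    case (Basis s)
    then obtain K U where "s = {f \<in> entire. f ` K \<subseteq> U}" "compactin CN_top K" "open U"
      by blast
    then show ?case using tau_omega_openin_subbasis[of K U] compactin_euclidean_iff[of K]
      unfolding CN_top_eq by blast
  qed (simp_all add: openin_Int openin_Union)
qed

definition unit_vec :: "nat \<Rightarrow> nat \<Rightarrow> complex" where
  "unit_vec k = (\<lambda>i. if i = k then 1 else 0)"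

text \<open>
  The increment of \<open>f\<close> from \<open>n e\<^sub>0\<close> in the direction \<open>e\<^sub>n\<^sub>+\<^sub>1\<close>. It vanishes on every stage up to \<open>n + 1\<close>,
  while the base points \<open>n e\<^sub>0\<close> leave every compact set. The sum over \<open>n\<close> is a seminorm that is
  continuous for \<open>\<tau>\<^sub>\<delta>\<close> but not for \<open>\<tau>\<^sub>\<omega>\<close>.
\<close>

definition escaping :: "((nat \<Rightarrow> complex) \<Rightarrow> complex) \<Rightarrow> nat \<Rightarrow> real" where
  "escaping f n = cmod (f (\<lambda>i. of_nat n * unit_vec 0 i + unit_vec (Suc n) i) - f (\<lambda>i. of_nat n * unit_vec 0 i))"

lemma escaping_nonneg: "0 \<le> escaping f n"
  by (simp add: escaping_def)

lemma escaping_eq_0: "cyl m f \<Longrightarrow> m \<le> Suc n \<Longrightarrow> escaping f n = 0"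
  unfolding escaping_def using cylD[of m f "\<lambda>i. of_nat n * unit_vec 0 i + unit_vec (Suc n) i"
    "\<lambda>i. of_nat n * unit_vec 0 i"] by (auto simp: unit_vec_def)

lemma escaping_summable: "f \<in> entire \<Longrightarrow> summable (escaping f)"
proof -
  assume "f \<in> entire"
  then obtain m where "cyl m f" by (rule entire_cyl)
  then show ?thesis by (intro summable_finite[of "{..<m}"]) (auto intro: escaping_eq_0)
qed

lemma delta_seminorm_escaping: "delta_seminorm CN CN_top (\<lambda>f. \<Sum>n. escaping f n)"
  unfolding delta_seminorm_iff
proof
  show "seminorm_on (holo_space CN CN_top) (\<lambda>f. \<Sum>n. escaping f n)"
    unfolding seminorm_on_def holo_space_eq fun_space_simps restrict_UNIV_eq
  proof (intro conjI ballI allI)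
    fix f assume f: "f \<in> entire"
    show "0 \<le> (\<Sum>n. escaping f n)"
      using escaping_summable[OF f] by (rule suminf_nonneg) (rule escaping_nonneg)
    show "(\<Sum>n. escaping (\<lambda>x. c * f x) n) = cmod c * (\<Sum>n. escaping f n)" for c
    proof -
      have "escaping (\<lambda>x. c * f x) n = cmod c * escaping f n" for n
        by (simp add: escaping_def norm_mult[symmetric] right_diff_distrib)
      then show ?thesis using suminf_mult[OF escaping_summable[OF f], of "cmod c"] by simp
    qed
    show "(\<Sum>n. escaping (\<lambda>x. f x + g x) n) \<le> (\<Sum>n. escaping f n) + (\<Sum>n. escaping g n)"
      if g: "g \<in> entire" for g
      unfolding suminf_add[OF escaping_summable[OF f] escaping_summable[OF g]]
    proof (intro suminf_le summable_add escaping_summable entire_add f g)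
      show "escaping (\<lambda>x. f x + g x) n \<le> escaping f n + escaping g n" for n
        unfolding escaping_def by (rule norm_diff_triangle_ineq[THEN order_trans[rotated]]) simp
    qed
  qed
  show "stage_bounded (\<lambda>f. \<Sum>n. escaping f n)"
    unfolding stage_bounded_def
  proof
    fix m
    have "(\<Sum>n. escaping f n) \<le> real (2 * m + 1) * B" if f: "f \<in> entire" "cyl m f" and B: "B \<ge> 0"
      and fB: "\<forall>x. (\<forall>i<m. cmod (x i) \<le> real m + 1) \<longrightarrow> cmod (f x) \<le> B" for f B
    proof -
      have "(\<Sum>n. escaping f n) = (\<Sum>n<m. escaping f n)"
        by (rule suminf_finite) (auto intro: escaping_eq_0[OF f(2)])
      also have "\<dots> \<le> (\<Sum>n<m. 2 * B)"
      proof (rule sum_mono)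
        fix n assume "n \<in> {..<m}"
        then have "cmod (f (\<lambda>i. of_nat n * unit_vec 0 i + unit_vec (Suc n) i)) \<le> B"
          "cmod (f (\<lambda>i. of_nat n * unit_vec 0 i)) \<le> B"
          by (intro fB[rule_format]; auto simp: unit_vec_def)+
        then show "escaping f n \<le> 2 * B"
          unfolding escaping_def using norm_triangle_ineq4 by (smt (verit))
      qed
      also have "\<dots> \<le> real (2 * m + 1) * B" using B by (simp add: algebra_simps)
      finally show ?thesis .
    qed
    then show "\<exists>r>0. \<exists>c>0. \<forall>f\<in>entire. cyl m f \<longrightarrow>
        (\<forall>B\<ge>0. (\<forall>x. (\<forall>i<m. cmod (x i) \<le> r) \<longrightarrow> cmod (f x) \<le> B) \<longrightarrow> (\<Sum>n. escaping f n) \<le> c * B)"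
      by (intro exI[of _ "real m + 1"] conjI exI[of _ "real (2 * m + 1)"]) auto
  qed
qed

text \<open>
  If \<open>n\<close> exceeds the radius in the coordinate \<open>0\<close> of a polydisc, then the functions
  \<open>(x 0 / n) ^ k * x (n + 1)\<close> tend to \<open>0\<close> uniformly on the polydisc as \<open>k\<close> grows, but their increment at
  \<open>n e\<^sub>0\<close> in the direction \<open>e\<^sub>n\<^sub>+\<^sub>1\<close> is always \<open>1\<close>.
\<close>

lemma tau_omega_neq_tau_delta: "tau_omega CN CN_top \<noteq> tau_delta CN CN_top"
proof
  assume eq: "tau_omega CN CN_top = tau_delta CN CN_top"
  define U where "U = {g \<in> entire. (\<Sum>n. escaping (\<lambda>x. g x - 0) n) < 1}"
  have "openin (tau_delta CN CN_top) U"
    using delta.openin_ball[of "\<lambda>f. \<Sum>n. escaping f n" "\<lambda>x. 0" 1] delta_seminorm_escaping entire_const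
    by (simp add: tau_delta_def holo_space_eq U_def)
  then have "openin (tau_omega CN CN_top) U" by (simp add: eq)
  moreover have "(\<lambda>x. 0) \<in> U" by (simp add: U_def entire_const escaping_def)
  ultimately obtain q r where q: "ported_seminorm CN CN_top q" "r > 0" "\<And>g. g \<in> entire \<Longrightarrow> q (\<lambda>x. g x - 0) < r \<Longrightarrow> g \<in> U"
    by (rule tau_omega_contains_ball) blast
  obtain R c where R: "\<And>i. R i \<ge> 0" "c > 0" "\<And>f B. f \<in> entire \<Longrightarrow> B \<ge> 0 \<Longrightarrow>
      (\<And>x. (\<And>i. cmod (x i) \<le> R i) \<Longrightarrow> cmod (f x) \<le> B) \<Longrightarrow> q f \<le> c * B"
    using q(1) unfolding ported_seminorm_iff polydisc_bounded_def by metis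
  obtain n :: nat where n: "R 0 < n" using reals_Archimedean2 by blast
  have n0: "n > 0" using n R(1)[of 0] by (metis of_nat_0 of_nat_0_less_iff le_less_trans)
  have "(\<lambda>k. c * ((R 0 / n) ^ k * R (Suc n))) \<longlonglongrightarrow> c * (0 * R (Suc n))"
    using n n0 R(1)[of 0] by (intro tendsto_intros LIMSEQ_realpow_zero) auto
  then have "eventually (\<lambda>k. c * ((R 0 / n) ^ k * R (Suc n)) < r) sequentially"
    using q(2) by (intro order_tendstoD(2)) auto
  then obtain k where k: "c * ((R 0 / n) ^ k * R (Suc n)) < r"
    by (auto simp: eventually_sequentially)
  define f where "f = (\<lambda>x :: nat \<Rightarrow> complex. (1 / of_nat n * x 0) ^ k * x (Suc n))"
  have f: "f \<in> entire"
    unfolding f_def by (intro entire_mult entire_power entire_scale entire_coordinate)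
  have "q f \<le> c * ((R 0 / n) ^ k * R (Suc n))"
  proof (rule R(3)[OF f])
    fix x :: "nat \<Rightarrow> complex" assume x: "\<And>i. cmod (x i) \<le> R i"
    have "cmod (f x) = (cmod (x 0) / n) ^ k * cmod (x (Suc n))"
      by (simp add: f_def norm_mult norm_power norm_divide)
    also have "\<dots> \<le> (R 0 / n) ^ k * R (Suc n)"
      using x R(1) by (intro mult_mono power_mono divide_right_mono) auto
    finally show "cmod (f x) \<le> (R 0 / n) ^ k * R (Suc n)" .
  qed (use R(1) in auto)
  then have "f \<in> U" using k f by (intro q(3)) auto
  then have "(\<Sum>n. escaping f n) < 1" by (simp add: U_def)
  moreover have "escaping f n = 1"
    using n0 by (simp add: escaping_def f_def unit_vec_def)
  moreover have "escaping f n \<le> (\<Sum>n. escaping f n)"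
    using sum_le_suminf[OF escaping_summable[OF f], of "{n}"]
    by (simp add: escaping_nonneg)
  ultimately show False by simp
qed

section \<open>Translations\<close>

lemma translation_CN: "translation CN a f = (\<lambda>x. f (\<lambda>i. x i - a i))"
  by (simp add: translation_def)

lemma entire_translation: "f \<in> entire \<Longrightarrow> translation CN a f \<in> entire"
proof -
  assume f: "f \<in> entire"
  have "continuous_on UNIV (\<lambda>x. f (\<lambda>i. x i - a i))"
  proof (rule continuous_on_compose2[of UNIV f])
    show "continuous_on UNIV (\<lambda>x i. x i - a i)"
      by (intro continuous_on_coordinatewise_then_product continuous_intros continuous_on_product_coordinates)
  qed (use f in \<open>auto simp: entire_iff\<close>)
  moreover have "(\<lambda>z. f (\<lambda>i. (x i + z * y i) - a i)) holomorphic_on UNIV" for x y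
    using entire_line[OF f, of "\<lambda>i. x i - a i" y] by (simp add: algebra_simps)
  ultimately show ?thesis by (simp add: entire_iff translation_CN)
qed

lemma cyl_translation: "cyl n f \<Longrightarrow> cyl n (translation CN a f)"
  by (auto simp: cyl_def translation_CN)

lemma topspace_tau_delta: "topspace (tau_delta CN CN_top) = entire"
  using delta.topspace_seminorm_topology by (simp add: tau_delta_def holo_space_eq)

lemma topspace_tau_omega: "topspace (tau_omega CN CN_top) = entire"
  using omega.topspace_seminorm_topology by (simp add: tau_omega_def holo_space_eq)

lemma delta_seminorm_translation:
  assumes "delta_seminorm CN CN_top q"
  shows "delta_seminorm CN CN_top (\<lambda>f. q (translation CN a f))"
  unfolding delta_seminorm_iff
proof
  have q: "seminorm_on (holo_space CN CN_top) q" "stage_bounded q"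
    using assms by (auto simp: delta_seminorm_iff)
  show "seminorm_on (holo_space CN CN_top) (\<lambda>f. q (translation CN a f))"
    using q(1) entire_translation unfolding seminorm_on_def holo_space_eq fun_space_simps restrict_UNIV_eq
    by (simp add: translation_CN)
  show "stage_bounded (\<lambda>f. q (translation CN a f))"
    unfolding stage_bounded_def
  proof
    fix n
    obtain r c where r: "r > 0" "c > 0" "\<And>f B. f \<in> entire \<Longrightarrow> cyl n f \<Longrightarrow> B \<ge> 0 \<Longrightarrow>
      (\<And>x. (\<And>i. i < n \<Longrightarrow> cmod (x i) \<le> r) \<Longrightarrow> cmod (f x) \<le> B) \<Longrightarrow> q f \<le> c * B"
      using q(2) unfolding stage_bounded_def by metis
    define s where "s = r + (\<Sum>i<n. cmod (a i))"
    have s: "s > 0" unfolding s_def using r(1) by (simp add: add_pos_nonneg sum_nonneg)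
    have "q (translation CN a f) \<le> c * B" if "f \<in> entire" "cyl n f" "B \<ge> 0"
      and fB: "\<forall>x. (\<forall>i<n. cmod (x i) \<le> s) \<longrightarrow> cmod (f x) \<le> B" for f B
    proof (rule r(3)[OF entire_translation[OF that(1)] cyl_translation[OF that(2)] that(3)])
      fix x assume x: "\<And>i. i < n \<Longrightarrow> cmod (x i) \<le> r"
      have "cmod (x i - a i) \<le> s" if "i < n" for i
        using x[OF that] member_le_sum[of i "{..<n}" "\<lambda>i. cmod (a i)"] that norm_triangle_ineq4[of "x i" "a i"]
        by (simp add: s_def)
      then show "cmod (translation CN a f x) \<le> B" using fB by (simp add: translation_CN)
    qed
    then show "\<exists>r>0. \<exists>c>0. \<forall>f\<in>entire. cyl n f \<longrightarrow>
      (\<forall>B\<ge>0. (\<forall>x. (\<forall>i<n. cmod (x i) \<le> r) \<longrightarrow> cmod (f x) \<le> B) \<longrightarrow> q (translation CN a f) \<le> c * B)"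
      using s r(2) by (intro exI[of _ s] conjI exI[of _ c]) auto
  qed
qed

lemma continuous_translation_delta:
  "continuous_map (tau_delta CN CN_top) (tau_delta CN CN_top) (translation CN a)"
  unfolding continuous_map_def topspace_tau_delta
proof (intro conjI allI impI)
  show "translation CN a \<in> entire \<rightarrow> entire" by (simp add: entire_translation)
  fix U assume U: "openin (tau_delta CN CN_top) U"
  show "openin (tau_delta CN CN_top) {f \<in> entire. translation CN a f \<in> U}"
    unfolding openin_tau_delta
  proof (intro conjI ballI)
    fix f assume f: "f \<in> {f \<in> entire. translation CN a f \<in> U}"
    then have "translation CN a f \<in> U" by simp
    with U obtain q r where q: "delta_seminorm CN CN_top q" "r > 0"
      "\<And>g. g \<in> entire \<Longrightarrow> q (\<lambda>x. g x - translation CN a f x) < r \<Longrightarrow> g \<in> U"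
      by (rule tau_delta_contains_ball) blast
    have "{g \<in> entire. q (translation CN a (\<lambda>x. g x - f x)) < r} \<subseteq> {f \<in> entire. translation CN a f \<in> U}"
      using q(3) entire_translation by (auto simp: translation_CN)
    then show "\<exists>q. delta_seminorm CN CN_top q \<and> (\<exists>r>0. {g \<in> entire. q (\<lambda>x. g x - f x) < r}
        \<subseteq> {f \<in> entire. translation CN a f \<in> U})"
      using delta_seminorm_translation[OF q(1)] q(2)
      by (intro exI[of _ "\<lambda>f. q (translation CN a f)"]) blast
  qed auto
qed

lemma continuous_translation_zero:
  "continuous_map (tau_zero CN CN_top) (tau_zero CN CN_top) (translation CN a)"
proof -
  have "continuous_map (tau_zero CN CN_top) (topology_generated_by
      {{f \<in> entire. f ` K \<subseteq> U} | K U. compactin CN_top K \<and> open U}) (translation CN a)"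
  proof (rule continuous_on_generated_topo)
    have ts: "topspace (tau_zero CN CN_top) = entire"
      by (simp add: tau_zero_eq_tau_omega topspace_tau_omega)
    fix S assume "S \<in> {{f \<in> entire. f ` K \<subseteq> U} | K U. compactin CN_top K \<and> open U}"
    then obtain K U where S: "S = {f \<in> entire. f ` K \<subseteq> U}" "compact K" "open U"
      by (auto simp: CN_top_eq)
    have "compact ((\<lambda>x i. x i - a i) ` K)"
      by (intro compact_continuous_image S continuous_on_coordinatewise_then_product continuous_intros
          continuous_on_subset[OF continuous_on_product_coordinates subset_UNIV])
    moreover have "translation CN a -` S \<inter> topspace (tau_zero CN CN_top)
        = {f \<in> entire. f ` (\<lambda>x i. x i - a i) ` K \<subseteq> U}"
      using entire_translation[of _ a] by (auto simp: S ts translation_CN image_subset_iff)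
    ultimately show "openin (tau_zero CN CN_top) (translation CN a -` S \<inter> topspace (tau_zero CN CN_top))"
      using openin_tau_zero_subbasis S(3) by simp
  next
    have "entire \<in> {{f \<in> entire. f ` K \<subseteq> U} | K U. compactin CN_top K \<and> open U}"
      by (auto intro!: exI[of _ "{}"])
    then show "translation CN a ` topspace (tau_zero CN CN_top)
        \<subseteq> \<Union> {{f \<in> entire. f ` K \<subseteq> U} | K U. compactin CN_top K \<and> open U}"
      using entire_translation by (fastforce simp: tau_zero_eq_tau_omega topspace_tau_omega)
  qed
  then show ?thesis by (simp add: tau_zero_def[symmetric])
qed

lemma convolution_operator_translation:
  assumes "continuous_map \<tau> \<tau> (translation CN a)"
  shows "convolution_operator CN CN_top \<tau> (translation CN a)"
  using assms entire_translation
  unfolding convolution_operator_def continuous_linear_op_def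
  by (auto simp: holo_space_eq translation_CN algebra_simps diff_diff_eq add.commute)

text \<open>
  The orbit stays in one stage, and a nonempty set that is already open for the coarsest of the
  topologies misses that stage.
\<close>

lemma not_hypercyclic_translation:
  assumes \<tau>: "\<And>U. openin (tau_zero CN CN_top) U \<Longrightarrow> openin \<tau> U" and ts: "topspace \<tau> = entire"
  shows "\<not> hypercyclic \<tau> (translation CN a)"
proof
  assume "hypercyclic \<tau> (translation CN a)"
  then obtain f where f: "f \<in> entire" "\<tau> closure_of range (\<lambda>n. (translation CN a ^^ n) f) = entire"
    unfolding hypercyclic_def ts by blast
  obtain N where N: "cyl N f" using entire_cyl[OF f(1)] .
  have orbit: "cyl N ((translation CN a ^^ n) f)" for n
    by (induction n) (auto simp: N cyl_translation)
  \<comment> \<open>functions that separate \<open>0\<close> from the unit vector \<open>e\<^sub>N\<close>, among them the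
    coordinate \<open>x N\<close>\<close>
  define U where "U = {f \<in> entire. f ` {\<lambda>i. 0} \<subseteq> ball 0 (1/2)} \<inter> {f \<in> entire. f ` {unit_vec N} \<subseteq> ball 1 (1/2)}"
  have "openin \<tau> U"
    unfolding U_def by (intro \<tau> openin_Int openin_tau_zero_subbasis) auto
  moreover have "(\<lambda>x. x N) \<in> U" by (simp add: U_def unit_vec_def entire_coordinate)
  moreover have "(\<lambda>x. x N) \<in> \<tau> closure_of range (\<lambda>n. (translation CN a ^^ n) f)"
    unfolding f(2) by (rule entire_coordinate)
  ultimately obtain g where g: "g \<in> range (\<lambda>n. (translation CN a ^^ n) f)" "g \<in> U"
    unfolding in_closure_of by blast
  have "g (unit_vec N) = g (\<lambda>i. 0)"
  proof -
    have "cyl N g" using g(1) orbit by blast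
    then show ?thesis by (rule cylD) (simp add: unit_vec_def)
  qed
  moreover have "dist 0 (g (\<lambda>i. 0)) < 1/2" "dist 1 (g (unit_vec N)) < 1/2"
    using g(2) by (auto simp: U_def)
  ultimately show False
    using dist_triangle[of 0 "1::complex" "g (\<lambda>i. 0)"] by (simp add: dist_commute)
qed

section \<open>Gauges of absorbing discs\<close>

text \<open>
  A disc is a balanced convex set. The locale relates it to the linear space \<open>F\<close> that it absorbs.
\<close>

locale absorbing_disc =
  fixes F W :: "('a \<Rightarrow> complex) set"
  assumes F_add: "\<And>f g. f \<in> F \<Longrightarrow> g \<in> F \<Longrightarrow> (\<lambda>x. f x + g x) \<in> F"
    and F_scale: "\<And>c f. f \<in> F \<Longrightarrow> (\<lambda>x. c * f x) \<in> F"
    and subset: "W \<subseteq> F"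
    and convex: "\<And>f g t. f \<in> W \<Longrightarrow> g \<in> W \<Longrightarrow> 0 \<le> t \<Longrightarrow> t \<le> 1 \<Longrightarrow>
      (\<lambda>x. complex_of_real (1 - t) * f x + complex_of_real t * g x) \<in> W"
    and balanced: "\<And>f c. f \<in> W \<Longrightarrow> cmod c \<le> 1 \<Longrightarrow> (\<lambda>x. c * f x) \<in> W"
    and absorbing: "\<And>f. f \<in> F \<Longrightarrow> \<exists>t>0. (\<lambda>x. complex_of_real (1 / t) * f x) \<in> W"
begin

definition scales :: "('a \<Rightarrow> complex) \<Rightarrow> real set" where
  "scales f = {t. t > 0 \<and> (\<lambda>x. complex_of_real (1 / t) * f x) \<in> W}"

definition gauge :: "('a \<Rightarrow> complex) \<Rightarrow> real" where
  "gauge f = Inf (scales f)"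

lemma scales_nonempty: "f \<in> F \<Longrightarrow> scales f \<noteq> {}"
  using absorbing by (auto simp: scales_def)

lemma scales_bdd: "bdd_below (scales f)"
  by (rule bdd_belowI[of _ 0]) (simp add: scales_def)

lemma gauge_le: "t \<in> scales f \<Longrightarrow> gauge f \<le> t"
  unfolding gauge_def by (intro cInf_lower scales_bdd)

lemma gauge_ge: "f \<in> F \<Longrightarrow> (\<And>t. t \<in> scales f \<Longrightarrow> a \<le> t) \<Longrightarrow> a \<le> gauge f"
  unfolding gauge_def by (intro cInf_greatest scales_nonempty) auto

lemma gauge_nonneg: "f \<in> F \<Longrightarrow> 0 \<le> gauge f"
  by (rule gauge_ge) (auto simp: scales_def)

lemma gauge_less_1:
  assumes "f \<in> F" "gauge f < 1"
  shows "f \<in> W"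
proof -
  obtain t where t: "t \<in> scales f" "t < 1"
    using assms scales_nonempty cInf_lessD unfolding gauge_def by blast
  then have "(\<lambda>x. complex_of_real (1 / t) * f x) \<in> W" "cmod (complex_of_real t) \<le> 1"
    by (auto simp: scales_def)
  then have "(\<lambda>x. complex_of_real t * (complex_of_real (1 / t) * f x)) \<in> W" by (rule balanced)
  then show ?thesis using t by (simp add: scales_def)
qed

text \<open>
  \<open>(f + g) / (s + t)\<close> is the convex combination of \<open>f / s\<close> and \<open>g / t\<close> with weights \<open>s / (s + t)\<close> and
  \<open>t / (s + t)\<close>.
\<close>

lemma scales_add:
  assumes s: "s \<in> scales f" and t: "t \<in> scales g"
  shows "s + t \<in> scales (\<lambda>x. f x + g x)"
proof -
  have st: "s > 0" "t > 0" using s t by (auto simp: scales_def)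
  define u where "u = t / (s + t)"
  have u: "0 \<le> u" "u \<le> 1" "(1 - u) * (1 / s) = 1 / (s + t)" "u * (1 / t) = 1 / (s + t)"
    using st by (auto simp: u_def divide_simps) 
  have "(\<lambda>x. complex_of_real (1 - u) * (complex_of_real (1 / s) * f x)
      + complex_of_real u * (complex_of_real (1 / t) * g x)) \<in> W"
    using s t u by (intro convex) (auto simp: scales_def)
  also have "(\<lambda>x. complex_of_real (1 - u) * (complex_of_real (1 / s) * f x)
      + complex_of_real u * (complex_of_real (1 / t) * g x))
      = (\<lambda>x. complex_of_real (1 / (s + t)) * (f x + g x))"
    unfolding mult.assoc[symmetric] of_real_mult[symmetric] u(3,4) distrib_left ..
  finally show ?thesis using st by (simp add: scales_def)
qed

lemma gauge_add:
  assumes f: "f \<in> F" and g: "g \<in> F"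
  shows "gauge (\<lambda>x. f x + g x) \<le> gauge f + gauge g"
proof -
  have "gauge (\<lambda>x. f x + g x) - s \<le> gauge g" if s: "s \<in> scales f" for s
  proof (rule gauge_ge[OF g])
    show "gauge (\<lambda>x. f x + g x) - s \<le> t" if "t \<in> scales g" for t
      using gauge_le[OF scales_add[OF s that]] by simp
  qed
  then have "gauge (\<lambda>x. f x + g x) - gauge g \<le> gauge f"
    by (intro gauge_ge f) (simp add: algebra_simps)
  then show ?thesis by simp
qed

lemma gauge_scale_le:
  assumes f: "f \<in> F" and c: "c \<noteq> 0"
  shows "gauge (\<lambda>x. c * f x) \<le> cmod c * gauge f"
proof -
  have "gauge (\<lambda>x. c * f x) / cmod c \<le> t" if t: "t \<in> scales f" for t
  proof -
    have t0: "t > 0" using t by (simp add: scales_def)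
    \<comment> \<open>the phase of \<open>c\<close> is a scalar of modulus \<open>1\<close>, under which the disc is
      invariant\<close>
    have "(\<lambda>x. complex_of_real (1 / t) * f x) \<in> W" "cmod (c / cmod c) \<le> 1"
      using t c by (auto simp: scales_def norm_divide)
    then have "(\<lambda>x. (c / cmod c) * (complex_of_real (1 / t) * f x)) \<in> W" by (rule balanced)
    also have "(\<lambda>x. (c / cmod c) * (complex_of_real (1 / t) * f x))
        = (\<lambda>x. complex_of_real (1 / (cmod c * t)) * (c * f x))"
      by (simp add: field_simps)
    finally have "cmod c * t \<in> scales (\<lambda>x. c * f x)" using c t0 by (simp add: scales_def)
    from gauge_le[OF this] show ?thesis using c by (simp add: field_simps)
  qed
  then have "gauge (\<lambda>x. c * f x) / cmod c \<le> gauge f" by (intro gauge_ge f)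
  then show ?thesis using c by (simp add: field_simps)
qed

lemma seminorm_gauge: "seminorm_on (fun_space UNIV F) gauge"
  unfolding seminorm_on_def fun_space_simps restrict_UNIV_eq
proof (intro conjI ballI allI)
  fix f assume f: "f \<in> F"
  show "0 \<le> gauge f" by (rule gauge_nonneg[OF f])
  show "gauge (\<lambda>x. f x + g x) \<le> gauge f + gauge g" if "g \<in> F" for g
    by (rule gauge_add[OF f that])
  show "gauge (\<lambda>x. c * f x) = cmod c * gauge f" for c
  proof (cases "c = 0")
    case True
    obtain t where "(\<lambda>x. complex_of_real (1 / t) * f x) \<in> W" using absorbing[OF f] by blast
    then have "(\<lambda>x. 0 * (complex_of_real (1 / t) * f x)) \<in> W" by (rule balanced) simp
    then have "gauge (\<lambda>x. 0) \<le> e" if "e > 0" for e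
      using that by (intro gauge_le) (simp add: scales_def)
    then have "gauge (\<lambda>x. 0) \<le> 0" by (rule field_le_epsilon) simp
    then show ?thesis using True gauge_nonneg[OF F_scale[OF f, of 0]] by simp
  next
    case False
    \<comment> \<open>the reverse inequality is the same estimate for the inverse scalar\<close>
    have "gauge (\<lambda>x. inverse c * (c * f x)) \<le> cmod (inverse c) * gauge (\<lambda>x. c * f x)"
      using False by (intro gauge_scale_le F_scale f) simp
    then have "cmod c * gauge f \<le> gauge (\<lambda>x. c * f x)"
      using False by (simp add: norm_divide field_simps)
    then show ?thesis using gauge_scale_le[OF f False] by simp
  qed
qed

end

section \<open>Coefficient sequences of infinite radius of convergence\<close>

definition rapidly_decreasing :: "(nat \<Rightarrow> real) \<Rightarrow> bool" where
  "rapidly_decreasing a \<longleftrightarrow> (\<forall>\<rho>>0. \<exists>C. \<forall>m. \<rho> ^ m * a m \<le> C)"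

text \<open>
  The condition on \<open>m\<close>-th roots that defines entire functions of bounded type, in a form that is visibly
  preserved by sums.
\<close>

lemma root_tendsto_0_iff:
  assumes a: "\<And>m. a m \<ge> 0"
  shows "(\<lambda>m. root m (a m)) \<longlonglongrightarrow> 0 \<longleftrightarrow> rapidly_decreasing a"
  unfolding rapidly_decreasing_def
proof (intro iffI allI impI)
  fix \<rho> :: real assume lim: "(\<lambda>m. root m (a m)) \<longlonglongrightarrow> 0" and \<rho>: "\<rho> > 0"
  have "eventually (\<lambda>m. root m (a m) < 1 / \<rho>) sequentially"
    using lim \<rho> by (intro order_tendstoD(2)) auto
  then obtain M where M: "\<And>m. m \<ge> M \<Longrightarrow> root m (a m) < 1 / \<rho>"
    by (auto simp: eventually_sequentially)
  have "\<rho> ^ m * a m \<le> 1 + (\<Sum>k\<le>M. \<rho> ^ k * a k)" for m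
  proof (cases "m \<le> M")
    case True
    then have "\<rho> ^ m * a m \<le> (\<Sum>k\<le>M. \<rho> ^ k * a k)"
      using a \<rho> by (intro member_le_sum) auto
    then show ?thesis by simp
  next
    case False
    then have "m > 0" by simp
    then have "a m = root m (a m) ^ m" using a by simp
    also have "\<dots> \<le> (1 / \<rho>) ^ m"
      using M[of m] False a by (intro power_mono) auto
    finally have "\<rho> ^ m * a m \<le> \<rho> ^ m * (1 / \<rho>) ^ m" using \<rho> by (intro mult_left_mono) auto
    also have "\<dots> = 1" using \<rho> by (simp add: power_divide)
    finally show ?thesis using a \<rho> by (simp add: sum_nonneg add_increasing2)
  qed
  then show "\<exists>C. \<forall>m. \<rho> ^ m * a m \<le> C" by blast
next
  assume R: "\<forall>\<rho>>0. \<exists>C. \<forall>m. \<rho> ^ m * a m \<le> C"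
  show "(\<lambda>m. root m (a m)) \<longlonglongrightarrow> 0"
  proof (rule order_tendstoI)
    fix e :: real assume e: "0 < e"
    \<comment> \<open>with \<open>\<rho> = 2 / e\<close> the roots are at most \<open>(e / 2) * root m D\<close>
      for \<open>D = max C 1\<close>, and \<open>root m D\<close> tends to \<open>1\<close>\<close>
    obtain C where C: "\<And>m. (2 / e) ^ m * a m \<le> C" using R e by (metis divide_pos_pos zero_less_numeral)
    define D where "D = max C 1"
    have "(\<lambda>m. root m D) \<longlonglongrightarrow> 1" by (rule LIMSEQ_root_const) (simp add: D_def)
    then have "eventually (\<lambda>m. root m D < 2) sequentially" by (rule order_tendstoD) simp
    then show "eventually (\<lambda>m. root m (a m) < e) sequentially"
      using eventually_gt_at_top[of 0]
    proof eventually_elim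
      case (elim m)
      have "a m = (2 / e) ^ m * a m * (e / 2) ^ m" using e by (simp add: power_divide)
      also have "\<dots> \<le> D * (e / 2) ^ m"
        using C[of m] e by (intro mult_right_mono) (auto simp: D_def)
      finally have "root m (a m) \<le> root m (D * (e / 2) ^ m)" using elim by simp
      also have "\<dots> = root m D * (e / 2)"
        using elim e by (simp add: real_root_mult real_root_power_cancel)
      also have "\<dots> < 2 * (e / 2)" using elim e by (intro mult_strict_right_mono) auto
      finally show ?case by simp
    qed
  next
    fix e :: real assume e: "e < 0"
    then have "e < root m (a m)" for m
      using a real_root_ge_zero[of "a m" m] by (meson less_le_trans)
    then show "eventually (\<lambda>m. e < root m (a m)) sequentially" by simp
  qed
qed

lemma rapidly_decreasing_summable:
  assumes a: "\<And>m. a m \<ge> 0" and R: "rapidly_decreasing a" and \<rho>: "\<rho> > 0"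
  shows "summable (\<lambda>m. \<rho> ^ m * a m)"
proof -
  \<comment> \<open>boundedness at the doubled radius leaves a geometric series with ratio \<open>1 / 2\<close>\<close>
  obtain C where C: "\<And>m. (2 * \<rho>) ^ m * a m \<le> C"
    using R \<rho> unfolding rapidly_decreasing_def by (metis mult_pos_pos zero_less_numeral)
  show ?thesis
  proof (rule summable_comparison_test')
    show "summable (\<lambda>m. C * (1 / 2) ^ m)" by (intro summable_mult summable_geometric) simp
    show "norm (\<rho> ^ m * a m) \<le> C * (1 / 2) ^ m" for m
      using C[of m] a \<rho> by (simp add: power_mult_distrib power_divide field_simps)
  qed
qed

section \<open>The normed space of a continuous seminorm\<close>

text \<open>
  The elements of the quotient \<open>E\<^sub>p\<close> are cosets. All notions on \<open>E\<^sub>p\<close> are transported to their lifts, that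
  is, to functions of sequences.
\<close>

locale continuous_seminorm =
  fixes p :: "(nat \<Rightarrow> complex) \<Rightarrow> real"
  assumes p_cs: "p \<in> cs CN CN_top"
begin

lemma nonneg: "0 \<le> p x"
  and add_le: "p (\<lambda>n. x n + y n) \<le> p x + p y"
  and scale: "p (\<lambda>n. c * x n) = cmod c * p x"
  and continuous: "continuous_on UNIV p"
  using p_cs by (auto simp: cs_def seminorm_on_def CN_top_eq)

lemma null: "p (\<lambda>n. 0) = 0"
  using scale[of 0 "\<lambda>n. 0"] by simp

lemma swap: "p (\<lambda>n. x n - y n) = p (\<lambda>n. y n - x n)"
  using scale[of "- 1" "\<lambda>n. x n - y n"] by simp

lemma triangle: "p (\<lambda>n. z n - x n) \<le> p (\<lambda>n. z n - y n) + p (\<lambda>n. y n - x n)"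
  using add_le[of "\<lambda>n. z n - y n" "\<lambda>n. y n - x n"] by simp

lemma le_diff: "p x \<le> p y + p (\<lambda>n. x n - y n)"
  using add_le[of y "\<lambda>n. x n - y n"] by simp

text \<open>
  Near \<open>0\<close> the seminorm is less than \<open>1\<close> on a cylinder, and homogeneity turns this into a bound by
  finitely many coordinates. The case \<open>r = 0\<close> says that sequences supported outside of these
  coordinates lie in the kernel.
\<close>

lemma dominated:
  obtains n C where "C > 0" "\<And>x r. r \<ge> 0 \<Longrightarrow> (\<And>i. i < n \<Longrightarrow> cmod (x i) \<le> r) \<Longrightarrow> p x \<le> C * r"
proof -
  have "open (p -` {..<1})" by (intro open_vimage continuous) simp
  then obtain n e where e: "e > 0" "\<And>y. (\<And>i. i < n \<Longrightarrow> cmod (y i - 0) < e) \<Longrightarrow> y \<in> p -` {..<1}"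
    using open_contains_cylinder[of "p -` {..<1}" "\<lambda>i. 0"] null by (metis lessThan_iff vimageI zero_less_one)
  have "p x \<le> 1 / e * r" if r: "r \<ge> 0" "\<And>i. i < n \<Longrightarrow> cmod (x i) \<le> r" for x r
  proof (rule field_le_epsilon)
    fix d :: real assume d: "d > 0"
    \<comment> \<open>a radius slightly larger than \<open>r\<close>, so that \<open>x\<close> scaled by
      \<open>e / s\<close> lies in the open cylinder\<close>
    define s where "s = r + d * e"
    have s: "s > r" "s > 0" using d e r by (auto simp: s_def add_nonneg_pos)
    have "cmod (complex_of_real (e / s) * x i) < e" if "i < n" for i
    proof -
      have "cmod (complex_of_real (e / s) * x i) = e / s * cmod (x i)"
        unfolding norm_mult norm_of_real using e s by simp
      also have "\<dots> \<le> e / s * r" using e s r(2)[OF that] by (intro mult_left_mono) auto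
      also have "\<dots> < e" using e s by (simp add: field_simps)
      finally show ?thesis .
    qed
    then have "p (\<lambda>i. complex_of_real (e / s) * x i) < 1" using e(2)[of "\<lambda>i. complex_of_real (e / s) * x i"] by simp
    then have "e / s * p x < 1" unfolding scale norm_of_real using e s by simp
    then have "p x < s / e" using e s by (simp add: field_simps)
    also have "\<dots> = 1 / e * r + d" using e by (simp add: s_def field_simps)
    finally show "p x \<le> 1 / e * r + d" by simp
  qed
  then show thesis using e(1) that[of "1 / e" n] by simp
qed

abbreviation E where "E \<equiv> quot CN p"
abbreviation N where "N \<equiv> quot_norm p"
abbreviation coset where "coset \<equiv> proj CN p"

lemma coset_eq: "coset x = {y. p (\<lambda>n. y n - x n) = 0}"
proof -
  have "y \<in> (\<lambda>k n. x n + k n) ` {k. p k = 0}" if "p (\<lambda>n. y n - x n) = 0" for y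
    using that by (intro image_eqI[of _ _ "\<lambda>n. y n - x n"]) auto
  then show ?thesis by (auto simp: proj_def ker_def)
qed

lemma mem_coset: "x \<in> coset x"
  by (simp add: coset_eq null)

lemma carrier_E: "vcarrier E = range coset"
  by (simp add: quot_def)

lemma add_E: "vadd E (coset x) (coset y) = coset (\<lambda>n. x n + y n)"
proof -
  have "p (\<lambda>n. a n + b n - (x n + y n)) = 0" if "p (\<lambda>n. a n - x n) = 0" "p (\<lambda>n. b n - y n) = 0" for a b
  proof -
    have "p (\<lambda>n. a n + b n - (x n + y n)) = p (\<lambda>n. (a n - x n) + (b n - y n))" by (simp add: algebra_simps)
    then show ?thesis
      using add_le[of "\<lambda>n. a n - x n" "\<lambda>n. b n - y n"] that nonneg[of "\<lambda>n. a n + b n - (x n + y n)"] by simp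
  qed
  moreover have "\<exists>a b. z = (\<lambda>n. a n + b n) \<and> p (\<lambda>n. a n - x n) = 0 \<and> p (\<lambda>n. b n - y n) = 0"
    if "p (\<lambda>n. z n - (x n + y n)) = 0" for z
    using that by (intro exI[of _ "\<lambda>n. z n - y n"] exI[of _ y]) (simp add: null algebra_simps)
  ultimately show ?thesis by (auto simp: quot_def coset_eq)
qed

lemma scale_E: "vscale E c (coset x) = coset (\<lambda>n. c * x n)"
proof -
  have "p (\<lambda>n. c * a n + k n - c * x n) = 0" if "p (\<lambda>n. a n - x n) = 0" "p k = 0" for a k
  proof -
    have "p (\<lambda>n. c * a n + k n - c * x n) = p (\<lambda>n. c * (a n - x n) + k n)" by (simp add: algebra_simps)
    then show ?thesis
      using add_le[of "\<lambda>n. c * (a n - x n)" k] that nonneg[of "\<lambda>n. c * a n + k n - c * x n"]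
      by (simp add: scale)
  qed
  moreover have "\<exists>a k. z = (\<lambda>n. c * a n + k n) \<and> p (\<lambda>n. a n - x n) = 0 \<and> p k = 0"
    if "p (\<lambda>n. z n - c * x n) = 0" for z
    using that by (intro exI[of _ x] exI[of _ "\<lambda>n. z n - c * x n"]) (simp add: null)
  ultimately show ?thesis by (auto simp: quot_def coset_eq ker_def)
qed

lemma minus_E: "vminus E (coset x) (coset y) = coset (\<lambda>n. x n - y n)"
  by (simp add: vminus_def scale_E add_E)

lemma norm_E: "N (coset x) = p x"
proof -
  have "p y = p x" if "y \<in> coset x" for y
    using le_diff[of y x] le_diff[of x y] that swap[of x y] by (simp add: coset_eq)
  then have "p ` coset x = {p x}" using mem_coset[of x] by blast
  then show ?thesis by (simp add: quot_norm_def)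
qed

sublocale E: directed_gauges E "{N}"
proof
  show "q (vminus E X X) = 0" if "q \<in> {N}" "X \<in> vcarrier E" for q X
    using that by (auto simp: carrier_E minus_E norm_E null)
  show "q (vminus E Z X) \<le> q (vminus E Z Y) + q (vminus E Y X)"
    if "q \<in> {N}" "X \<in> vcarrier E" "Y \<in> vcarrier E" "Z \<in> vcarrier E" for q X Y Z
    using that by (auto simp: carrier_E minus_E norm_E triangle)
qed auto

text \<open>
  Continuity of the function induced on \<open>E\<^sub>p\<close>. It implies that \<open>f\<close> is constant on cosets.
\<close>

definition p_continuous :: "((nat \<Rightarrow> complex) \<Rightarrow> complex) \<Rightarrow> bool" where
  "p_continuous f \<longleftrightarrow>
    (\<forall>x. \<forall>e>0. \<exists>d>0. \<forall>y. p (\<lambda>n. y n - x n) < d \<longrightarrow> cmod (f y - f x) < e)"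

lemma continuous_map_E_iff:
  "continuous_map (seminorm_topology E {N}) euclidean g \<longleftrightarrow> p_continuous (\<lambda>x. g (coset x))"
proof
  assume g: "continuous_map (seminorm_topology E {N}) euclidean g"
  show "p_continuous (\<lambda>x. g (coset x))"
    unfolding p_continuous_def
  proof (intro allI impI)
    fix x and e :: real assume e: "e > 0"
    let ?U = "{X \<in> topspace (seminorm_topology E {N}). g X \<in> ball (g (coset x)) e}"
    have "openin (seminorm_topology E {N}) ?U"
      using g by (rule openin_continuous_map_preimage) simp
    moreover have "coset x \<in> ?U" using e by (simp add: E.topspace_seminorm_topology carrier_E)
    ultimately obtain d where d: "d > 0" "{Y \<in> vcarrier E. N (vminus E Y (coset x)) < d} \<subseteq> ?U"
      unfolding E.openin_seminorm_topology by fastforce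
    have "cmod (g (coset y) - g (coset x)) < e" if "p (\<lambda>n. y n - x n) < d" for y
    proof -
      have "coset y \<in> {Y \<in> vcarrier E. N (vminus E Y (coset x)) < d}"
        using that by (simp add: carrier_E minus_E norm_E)
      then have "coset y \<in> ?U" using d(2) by blast
      then show ?thesis by (simp add: dist_norm norm_minus_commute)
    qed
    then show "\<exists>d>0. \<forall>y. p (\<lambda>n. y n - x n) < d \<longrightarrow> cmod (g (coset y) - g (coset x)) < e"
      using d(1) by blast
  qed
next
  assume g: "p_continuous (\<lambda>x. g (coset x))"
  show "continuous_map (seminorm_topology E {N}) euclidean g"
    unfolding continuous_map_def E.topspace_seminorm_topology
  proof (intro conjI allI impI)
    fix U :: "complex set" assume U: "openin euclidean U"
    show "openin (seminorm_topology E {N}) {X \<in> vcarrier E. g X \<in> U}"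
      unfolding E.openin_seminorm_topology
    proof (intro conjI ballI)
      fix X assume "X \<in> {X \<in> vcarrier E. g X \<in> U}"
      then obtain x where x: "X = coset x" "g (coset x) \<in> U" by (auto simp: carrier_E)
      obtain e where e: "e > 0" "ball (g (coset x)) e \<subseteq> U"
        using U x(2) open_contains_ball by (metis open_openin)
      obtain d where d: "d > 0" "\<And>y. p (\<lambda>n. y n - x n) < d \<Longrightarrow> cmod (g (coset y) - g (coset x)) < e"
        using g e(1) unfolding p_continuous_def by metis
      have "{Y \<in> vcarrier E. N (vminus E Y X) < d} \<subseteq> {X \<in> vcarrier E. g X \<in> U}"
        using d(2) e(2) by (auto simp: carrier_E minus_E norm_E x(1) subset_iff dist_norm norm_minus_commute)
      then show "\<exists>q\<in>{N}. \<exists>r>0. {Y \<in> vcarrier E. q (vminus E Y X) < r} \<subseteq> {X \<in> vcarrier E. g X \<in> U}"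
        using d(1) by blast
    qed auto
  qed auto
qed

text \<open>The lifts of entire functions on \<open>E\<^sub>p\<close>.\<close>

definition p_entire :: "((nat \<Rightarrow> complex) \<Rightarrow> complex) \<Rightarrow> bool" where
  "p_entire f \<longleftrightarrow> p_continuous f \<and> (\<forall>x y. (\<lambda>z. f (\<lambda>n. x n + z * y n)) holomorphic_on UNIV)"

lemma holo_E_iff:
  "g \<in> holo E (seminorm_topology E {N}) \<longleftrightarrow>
    g \<in> extensional (range coset) \<and> p_entire (\<lambda>x. g (coset x))"
  by (simp add: holo_def p_entire_def continuous_map_E_iff carrier_E scale_E add_E)

lemma pullback_eq: "pullback CN p g = (\<lambda>x. g (coset x))"
  by (simp add: pullback_def compose_def)

lemma p_entire_imp_entire:
  assumes "p_entire f"
  shows "f \<in> entire"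
  unfolding entire_iff
proof
  show "\<forall>x y. (\<lambda>z. f (\<lambda>n. x n + z * y n)) holomorphic_on UNIV"
    using assms by (simp add: p_entire_def)
  have "open (f -` U)" if U: "open U" for U
  proof (subst open_subopen, intro ballI)
    fix x assume "x \<in> f -` U"
    then obtain e where e: "e > 0" "ball (f x) e \<subseteq> U" using U open_contains_ball by blast
    obtain d where d: "d > 0" "\<And>y. p (\<lambda>n. y n - x n) < d \<Longrightarrow> cmod (f y - f x) < e"
      using assms e(1) unfolding p_entire_def p_continuous_def by metis
    have "continuous_on UNIV (\<lambda>y n. y n - x n)"
      by (intro continuous_on_coordinatewise_then_product continuous_intros continuous_on_product_coordinates)
    then have "open ((\<lambda>y. p (\<lambda>n. y n - x n)) -` {..<d})"
      by (intro open_vimage continuous_on_compose2[OF continuous]) auto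
    moreover have "x \<in> (\<lambda>y. p (\<lambda>n. y n - x n)) -` {..<d}" using d(1) by (simp add: null)
    moreover have "(\<lambda>y. p (\<lambda>n. y n - x n)) -` {..<d} \<subseteq> f -` U"
      using d(2) e(2) by (auto simp: subset_iff dist_norm norm_minus_commute)
    ultimately show "\<exists>T. open T \<and> x \<in> T \<and> T \<subseteq> f -` U" by blast
  qed
  then show "continuous_on UNIV f" by (simp add: continuous_on_open_vimage)
qed

lemma p_entire_local_bound:
  assumes "p_entire f"
  obtains d B where "d > 0" "\<And>x. p x \<le> d \<Longrightarrow> cmod (f x) \<le> B"
proof -
  have "p_continuous f" using assms by (simp add: p_entire_def)
  then have "\<forall>e>0. \<exists>d>0. \<forall>y. p (\<lambda>n. y n - 0) < d \<longrightarrow> cmod (f y - f (\<lambda>n. 0)) < e"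
    unfolding p_continuous_def by (rule spec)
  then have "\<exists>d>0. \<forall>y. p (\<lambda>n. y n - 0) < d \<longrightarrow> cmod (f y - f (\<lambda>n. 0)) < 1"
    using zero_less_one by blast
  then obtain d where d: "d > 0" "\<And>y. p (\<lambda>n. y n - 0) < d \<Longrightarrow> cmod (f y - f (\<lambda>n. 0)) < 1"
    by blast
  show thesis
  proof (rule that[of "d / 2"])
    show "cmod (f x) \<le> cmod (f (\<lambda>n. 0)) + 1" if "p x \<le> d / 2" for x
      using d(2)[of x] that d(1) norm_triangle_ineq2[of "f x" "f (\<lambda>n. 0)"] by simp
  qed (use d(1) in simp)
qed

text \<open>
  The lift of the Taylor polynomial of degree \<open>m\<close> of a function on \<open>E\<^sub>p\<close>; the lifts of its norm and of the
  seminorms of \<open>\<H>\<^sub>b(E\<^sub>p)\<close> are \<open>coeff_norm\<close> and \<open>weighted_norm\<close>.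
\<close>

definition coeff :: "((nat \<Rightarrow> complex) \<Rightarrow> complex) \<Rightarrow> nat \<Rightarrow> (nat \<Rightarrow> complex) \<Rightarrow> complex" where
  "coeff f m x = (deriv ^^ m) (\<lambda>z. f (\<lambda>n. z * x n)) 0 / fact m"

definition coeff_norm :: "((nat \<Rightarrow> complex) \<Rightarrow> complex) \<Rightarrow> nat \<Rightarrow> real" where
  "coeff_norm f m = (SUP x\<in>{x. p x \<le> 1}. cmod (coeff f m x))"

lemma taylor_poly_E: "taylor_poly E g m (coset x) = coeff (\<lambda>x. g (coset x)) m x"
  by (simp add: taylor_poly_def coeff_def scale_E)

lemma taylor_norm_E: "taylor_norm E N g m = coeff_norm (\<lambda>x. g (coset x)) m"
proof -
  have "{X \<in> vcarrier E. N X \<le> 1} = coset ` {x. p x \<le> 1}"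
    by (auto simp: carrier_E norm_E)
  then show ?thesis
    by (simp add: taylor_norm_def coeff_norm_def image_image taylor_poly_E)
qed

lemma p_entire_radial: "p_entire f \<Longrightarrow> (\<lambda>z. f (\<lambda>n. z * x n)) holomorphic_on S"
  using p_entire_imp_entire[THEN entire_line, of f "\<lambda>n. 0" x] holomorphic_on_subset by auto

lemma coeff_bound:
  assumes f: "p_entire f" and r: "r > 0" and B: "\<And>y. p y \<le> r \<Longrightarrow> cmod (f y) \<le> B" and x: "p x \<le> 1"
  shows "cmod (coeff f m x) \<le> B / r ^ m"
proof -
  have "cmod ((deriv ^^ m) (\<lambda>z. f (\<lambda>n. z * x n)) 0) \<le> fact m * B / r ^ m"
  proof (rule Cauchy_inequality)
    show "(\<lambda>z. f (\<lambda>n. z * x n)) holomorphic_on ball 0 r" by (rule p_entire_radial[OF f])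
    show "continuous_on (cball 0 r) (\<lambda>z. f (\<lambda>n. z * x n))"
      by (intro holomorphic_on_imp_continuous_on p_entire_radial f)
    fix z assume "cmod (0 - z) = r"
    then show "cmod (f (\<lambda>n. z * x n)) \<le> B"
      using x r by (intro B) (simp add: scale mult_left_le)
  qed (rule r)
  then show ?thesis by (simp add: coeff_def norm_divide field_simps)
qed

text \<open>
  The supremum in \<open>coeff_norm\<close> is over a bounded set: \<open>f\<close> is bounded on some ball of \<open>p\<close>, and the
  Cauchy estimates for that ball bound the coefficients on the unit ball.
\<close>

lemma coeff_le_coeff_norm:
  assumes "p_entire f" "p x \<le> 1"
  shows "cmod (coeff f m x) \<le> coeff_norm f m"
proof -
  obtain d B where d: "d > 0" "\<And>x. p x \<le> d \<Longrightarrow> cmod (f x) \<le> B"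
    using p_entire_local_bound[OF assms(1)] by blast
  have "bdd_above ((\<lambda>x. cmod (coeff f m x)) ` {x. p x \<le> 1})"
    using coeff_bound[OF assms(1) d(1) d(2)] by (intro bdd_aboveI2) auto
  then show ?thesis unfolding coeff_norm_def using assms(2) by (intro cSUP_upper) auto
qed

lemma coeff_norm_le: "(\<And>x. p x \<le> 1 \<Longrightarrow> cmod (coeff f m x) \<le> B) \<Longrightarrow> coeff_norm f m \<le> B"
  unfolding coeff_norm_def using null by (intro cSUP_least) (auto intro!: exI[of _ "\<lambda>n. 0"])

lemma coeff_norm_nonneg: "p_entire f \<Longrightarrow> 0 \<le> coeff_norm f m"
  using order_trans[OF norm_ge_zero coeff_le_coeff_norm[of f "\<lambda>n. 0" m]] by (simp add: null)

lemma p_entire_add: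
  assumes f: "p_entire f" and g: "p_entire g"
  shows "p_entire (\<lambda>x. f x + g x)"
  unfolding p_entire_def
proof
  show "\<forall>x y. (\<lambda>z. f (\<lambda>n. x n + z * y n) + g (\<lambda>n. x n + z * y n)) holomorphic_on UNIV"
    using f g unfolding p_entire_def by (auto intro!: holomorphic_intros)
  show "p_continuous (\<lambda>x. f x + g x)"
    unfolding p_continuous_def
  proof (intro allI impI)
    fix x and e :: real assume e: "e > 0"
    then have e2: "e / 2 > 0" by simp
    obtain d where d: "d > 0" "\<And>y. p (\<lambda>n. y n - x n) < d \<Longrightarrow> cmod (f y - f x) < e / 2"
      using f e2 unfolding p_entire_def p_continuous_def by meson
    obtain d' where d': "d' > 0" "\<And>y. p (\<lambda>n. y n - x n) < d' \<Longrightarrow> cmod (g y - g x) < e / 2"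
      using g e2 unfolding p_entire_def p_continuous_def by meson
    have "cmod (f y + g y - (f x + g x)) < e" if "p (\<lambda>n. y n - x n) < min d d'" for y
      using d(2)[of y] d'(2)[of y] that norm_diff_triangle_ineq[of "f y" "g y" "f x" "g x"] by simp
    then show "\<exists>d>0. \<forall>y. p (\<lambda>n. y n - x n) < d \<longrightarrow> cmod (f y + g y - (f x + g x)) < e"
      using d(1) d'(1) by (intro exI[of _ "min d d'"]) auto
  qed
qed

lemma p_entire_uminus:
  assumes f: "p_entire f"
  shows "p_entire (\<lambda>x. - f x)"
proof -
  have "cmod (- f y - - f x) = cmod (f y - f x)" for x y by (metis minus_diff_minus norm_minus_cancel)
  then show ?thesis
    using f unfolding p_entire_def p_continuous_def by (auto intro!: holomorphic_intros)
qed

lemma coeff_add: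
  assumes f: "p_entire f" and g: "p_entire g"
  shows "coeff (\<lambda>x. f x + g x) m x = coeff f m x + coeff g m x"
  using higher_deriv_add[OF p_entire_radial[OF f, of x UNIV] p_entire_radial[OF g, of x UNIV], of 0 m]
  by (simp add: coeff_def add_divide_distrib)

lemma coeff_uminus:
  assumes f: "p_entire f"
  shows "coeff (\<lambda>x. - f x) m x = - coeff f m x"
  using higher_deriv_uminus[OF p_entire_radial[OF f, of x UNIV], of 0 m]
  by (simp add: coeff_def)

lemma coeff_norm_add:
  assumes f: "p_entire f" and g: "p_entire g"
  shows "coeff_norm (\<lambda>x. f x + g x) m \<le> coeff_norm f m + coeff_norm g m"
  by (intro coeff_norm_le) (auto simp: coeff_add f g intro!: norm_triangle_le add_mono coeff_le_coeff_norm)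

lemma coeff_norm_uminus: "p_entire f \<Longrightarrow> coeff_norm (\<lambda>x. - f x) m = coeff_norm f m"
  by (simp add: coeff_norm_def coeff_uminus)

text \<open>The lifts of the functions of bounded type on \<open>E\<^sub>p\<close>.\<close>

definition bounded_type :: "((nat \<Rightarrow> complex) \<Rightarrow> complex) \<Rightarrow> bool" where
  "bounded_type f \<longleftrightarrow> p_entire f \<and> rapidly_decreasing (coeff_norm f)"

lemma bounded_type_add:
  assumes f: "bounded_type f" and g: "bounded_type g"
  shows "bounded_type (\<lambda>x. f x + g x)"
  unfolding bounded_type_def rapidly_decreasing_def
proof (intro conjI allI impI)
  have fg: "p_entire f" "p_entire g" using f g by (auto simp: bounded_type_def)
  show "p_entire (\<lambda>x. f x + g x)" by (rule p_entire_add[OF fg])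
  fix \<rho> :: real assume \<rho>: "\<rho> > 0"
  obtain C D where C: "\<And>m. \<rho> ^ m * coeff_norm f m \<le> C" and D: "\<And>m. \<rho> ^ m * coeff_norm g m \<le> D"
    using f g \<rho> unfolding bounded_type_def rapidly_decreasing_def by metis
  have "\<rho> ^ m * coeff_norm (\<lambda>x. f x + g x) m \<le> \<rho> ^ m * (coeff_norm f m + coeff_norm g m)" for m
    using \<rho> by (intro mult_left_mono coeff_norm_add fg) auto
  then have "\<rho> ^ m * coeff_norm (\<lambda>x. f x + g x) m \<le> C + D" for m
    using C[of m] D[of m] by (smt (verit) distrib_left)
  then show "\<exists>C. \<forall>m. \<rho> ^ m * coeff_norm (\<lambda>x. f x + g x) m \<le> C" by blast
qed

lemma bounded_type_uminus: "bounded_type f \<Longrightarrow> bounded_type (\<lambda>x. - f x)"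
  by (simp add: bounded_type_def p_entire_uminus rapidly_decreasing_def coeff_norm_uminus)

lemma bounded_type_diff: "bounded_type f \<Longrightarrow> bounded_type g \<Longrightarrow> bounded_type (\<lambda>x. f x - g x)"
  using bounded_type_add[of f "\<lambda>x. - g x"] bounded_type_uminus by simp

definition weighted_norm :: "real \<Rightarrow> ((nat \<Rightarrow> complex) \<Rightarrow> complex) \<Rightarrow> real" where
  "weighted_norm \<rho> f = (\<Sum>m. \<rho> ^ m * coeff_norm f m)"

lemma bounded_type_summable:
  "bounded_type f \<Longrightarrow> \<rho> > 0 \<Longrightarrow> summable (\<lambda>m. \<rho> ^ m * coeff_norm f m)"
  unfolding bounded_type_def by (intro rapidly_decreasing_summable coeff_norm_nonneg) auto

lemma weighted_norm_add:
  assumes f: "bounded_type f" and g: "bounded_type g" and \<rho>: "\<rho> > 0"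
  shows "weighted_norm \<rho> (\<lambda>x. f x + g x) \<le> weighted_norm \<rho> f + weighted_norm \<rho> g"
  unfolding weighted_norm_def suminf_add[OF bounded_type_summable[OF f \<rho>] bounded_type_summable[OF g \<rho>]]
proof (rule suminf_le)
  show "\<rho> ^ m * coeff_norm (\<lambda>x. f x + g x) m \<le> \<rho> ^ m * coeff_norm f m + \<rho> ^ m * coeff_norm g m" for m
    using f g \<rho> coeff_norm_add[of f g m] unfolding distrib_left[symmetric]
    by (intro mult_left_mono) (auto simp: bounded_type_def)
qed (intro bounded_type_summable bounded_type_add summable_add f g \<rho>)+

lemma weighted_norm_mono:
  assumes f: "bounded_type f" and \<rho>: "0 < \<rho>" "\<rho> \<le> \<sigma>"
  shows "weighted_norm \<rho> f \<le> weighted_norm \<sigma> f"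
  unfolding weighted_norm_def
proof (rule suminf_le)
  show "\<rho> ^ m * coeff_norm f m \<le> \<sigma> ^ m * coeff_norm f m" for m
    using f \<rho> by (intro mult_right_mono power_mono coeff_norm_nonneg) (auto simp: bounded_type_def)
qed (use \<rho> in \<open>auto intro!: bounded_type_summable f\<close>)

lemma weighted_norm_zero: "weighted_norm \<rho> (\<lambda>x. 0) = 0"
proof -
  have "coeff (\<lambda>x. 0) m x = 0" for m x
    using higher_deriv_const[of m 0] by (auto simp: coeff_def)
  moreover have "{x. p x \<le> 1} \<noteq> {}" using null by (auto intro!: exI[of _ "\<lambda>n. 0"])
  ultimately have "coeff_norm (\<lambda>x. 0) m = 0" for m by (simp add: coeff_norm_def)
  then show ?thesis by (simp add: weighted_norm_def)
qed

text \<open>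
  Taylor's series of \<open>f\<close> at \<open>x\<close>. Writing \<open>x = \<rho> y\<close> with \<open>y\<close> in the unit ball and expanding in \<open>\<rho>\<close>
  makes the bound of each term immediate from the definition of \<open>coeff_norm\<close>.
\<close>

lemma norm_le_weighted_norm:
  assumes f: "bounded_type f" and \<rho>: "\<rho> > 0" and x: "p x \<le> \<rho>"
  shows "cmod (f x) \<le> weighted_norm \<rho> f"
proof -
  define y where "y = (\<lambda>n. complex_of_real (1 / \<rho>) * x n)"
  have fe: "p_entire f" using f by (simp add: bounded_type_def)
  have y: "p y \<le> 1" unfolding y_def scale norm_of_real using x \<rho> by simp
  have xy: "x = (\<lambda>n. complex_of_real \<rho> * y n)" using \<rho> by (simp add: y_def)
  have "(\<lambda>m. (deriv ^^ m) (\<lambda>z. f (\<lambda>n. z * y n)) 0 / fact m * (complex_of_real \<rho> - 0) ^ m)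
      sums f (\<lambda>n. complex_of_real \<rho> * y n)"
    by (rule holomorphic_power_series[OF p_entire_radial[OF fe, of y "ball 0 (\<rho> + 1)"]]) (use \<rho> in auto)
  then have s: "(\<lambda>m. coeff f m y * complex_of_real \<rho> ^ m) sums f x"
    using xy by (simp add: coeff_def)
  have "cmod (coeff f m y * complex_of_real \<rho> ^ m) \<le> \<rho> ^ m * coeff_norm f m" for m
    using \<rho> coeff_le_coeff_norm[OF fe y, of m] by (simp add: norm_mult norm_power)
  then have "cmod (\<Sum>m. coeff f m y * complex_of_real \<rho> ^ m) \<le> (\<Sum>m. \<rho> ^ m * coeff_norm f m)"
    by (intro norm_suminf_le bounded_type_summable f \<rho>)
  then show ?thesis using sums_unique[OF s] by (simp add: weighted_norm_def)
qed

text \<open>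
  The Cauchy estimates on the ball of radius \<open>2 \<rho>\<close> bound the series by \<open>B\<close> times a geometric series of
  ratio \<open>1 / 2\<close>.
\<close>

lemma weighted_norm_le:
  assumes f: "p_entire f" and \<rho>: "\<rho> > 0" and B: "\<And>x. p x \<le> 2 * \<rho> \<Longrightarrow> cmod (f x) \<le> B"
  shows "weighted_norm \<rho> f \<le> 2 * B"
proof -
  have c: "\<rho> ^ m * coeff_norm f m \<le> B * (1 / 2) ^ m" for m
  proof -
    have "coeff_norm f m \<le> B / (2 * \<rho>) ^ m"
      using \<rho> B by (intro coeff_norm_le coeff_bound f) auto
    then have "\<rho> ^ m * coeff_norm f m \<le> \<rho> ^ m * (B / (2 * \<rho>) ^ m)" using \<rho> by (intro mult_left_mono) auto
    also have "\<dots> = B * (1 / 2) ^ m" using \<rho> by (simp add: power_mult_distrib power_divide)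
    finally show ?thesis .
  qed
  have s: "summable (\<lambda>m. B * (1 / 2) ^ m)" by (intro summable_mult summable_geometric) simp
  have "summable (\<lambda>m. \<rho> ^ m * coeff_norm f m)"
    using c coeff_norm_nonneg[OF f] \<rho> by (intro summable_comparison_test'[OF s]) simp
  then have "weighted_norm \<rho> f \<le> (\<Sum>m. B * (1 / 2) ^ m)"
    unfolding weighted_norm_def using c s by (intro suminf_le) auto
  also have "\<dots> = 2 * B" using suminf_mult[of "\<lambda>m. (1 / 2 :: real) ^ m" B] suminf_geometric[of "1 / 2 :: real"] by simp
  finally show ?thesis .
qed

lemma Hb_E_iff:
  "g \<in> Hb E N \<longleftrightarrow> g \<in> extensional (range coset) \<and> bounded_type (\<lambda>x. g (coset x))"
  unfolding Hb_def bounded_type_def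
  by (auto simp: holo_E_iff taylor_norm_E root_tendsto_0_iff[OF coeff_norm_nonneg])

lemma Hb_seminorm_E: "Hb_seminorm E N \<rho> g = weighted_norm \<rho> (\<lambda>x. g (coset x))"
  by (simp add: Hb_seminorm_def weighted_norm_def taylor_norm_E)

abbreviation Hb_space where "Hb_space \<equiv> fun_space (vcarrier E) (Hb E N)"

lemma Hb_seminorm_diff:
  "Hb_seminorm E N \<rho> (vminus Hb_space g h) = weighted_norm \<rho> (\<lambda>x. g (coset x) - h (coset x))"
  by (simp add: Hb_seminorm_E carrier_E)

sublocale Hb: directed_gauges Hb_space "{Hb_seminorm E N \<rho> | \<rho>. 0 < \<rho>}"
proof
  show "q (vminus Hb_space g g) = 0" if "q \<in> {Hb_seminorm E N \<rho> | \<rho>. 0 < \<rho>}" for q g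
    using that weighted_norm_zero by (auto simp: Hb_seminorm_diff simp del: fun_space_simps)
  show "q (vminus Hb_space h f) \<le> q (vminus Hb_space h g) + q (vminus Hb_space g f)"
    if q: "q \<in> {Hb_seminorm E N \<rho> | \<rho>. 0 < \<rho>}"
      and fgh: "f \<in> vcarrier Hb_space" "g \<in> vcarrier Hb_space" "h \<in> vcarrier Hb_space" for q f g h
  proof -
    obtain \<rho> where \<rho>: "q = Hb_seminorm E N \<rho>" "\<rho> > 0" using q by blast
    have "bounded_type (\<lambda>x. h (coset x) - g (coset x))" "bounded_type (\<lambda>x. g (coset x) - f (coset x))"
      using fgh by (auto simp: Hb_E_iff intro!: bounded_type_diff)
    from weighted_norm_add[OF this \<rho>(2)] show ?thesis
      unfolding \<rho>(1) Hb_seminorm_diff by simp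
  qed
  show "\<exists>s\<in>{Hb_seminorm E N \<rho> | \<rho>. 0 < \<rho>}. \<forall>g\<in>vcarrier Hb_space. \<forall>h\<in>vcarrier Hb_space.
      q (vminus Hb_space h g) \<le> s (vminus Hb_space h g) \<and> q' (vminus Hb_space h g) \<le> s (vminus Hb_space h g)"
    if qq': "q \<in> {Hb_seminorm E N \<rho> | \<rho>. 0 < \<rho>}" "q' \<in> {Hb_seminorm E N \<rho> | \<rho>. 0 < \<rho>}" for q q'
  proof -
    obtain \<rho> \<rho>' where \<rho>: "q = Hb_seminorm E N \<rho>" "\<rho> > 0" "q' = Hb_seminorm E N \<rho>'" "\<rho>' > 0"
      using qq' by blast
    have "weighted_norm \<rho> (\<lambda>x. h (coset x) - g (coset x)) \<le> weighted_norm (max \<rho> \<rho>') (\<lambda>x. h (coset x) - g (coset x))"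
      "weighted_norm \<rho>' (\<lambda>x. h (coset x) - g (coset x)) \<le> weighted_norm (max \<rho> \<rho>') (\<lambda>x. h (coset x) - g (coset x))"
      if "g \<in> Hb E N" "h \<in> Hb E N" for g h
      using that \<rho> by (auto simp: Hb_E_iff intro!: weighted_norm_mono bounded_type_diff)
    then show ?thesis
      using \<rho>(2,4) unfolding \<rho>(1,3)
      by (intro bexI[of _ "Hb_seminorm E N (max \<rho> \<rho>')"])
        (auto simp: Hb_seminorm_diff fun_space_simps(1) simp del: fun_space_simps(5))
  qed
  show "{Hb_seminorm E N \<rho> | \<rho>. 0 < \<rho>} \<noteq> {}" by (auto intro: exI[of _ "1 :: real"])
qed

end

section \<open>Entire functions are of uniformly bounded type\<close>

text \<open>
  The seminorm whose normed space is \<open>\<complex>\<^sup>n\<close> with the sum norm.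
\<close>

definition stage_seminorm :: "nat \<Rightarrow> (nat \<Rightarrow> complex) \<Rightarrow> real" where
  "stage_seminorm n x = (\<Sum>i<n. cmod (x i))"

lemma coordinate_le_stage_seminorm: "i < n \<Longrightarrow> cmod (x i) \<le> stage_seminorm n x"
  unfolding stage_seminorm_def by (intro member_le_sum) auto

lemma stage_seminorm_cs: "stage_seminorm n \<in> cs CN CN_top"
proof -
  have "continuous_on UNIV (stage_seminorm n)"
    unfolding stage_seminorm_def by (intro continuous_intros continuous_on_product_coordinates)
  moreover have "stage_seminorm n (\<lambda>i. x i + y i) \<le> stage_seminorm n x + stage_seminorm n y" for x y
    unfolding stage_seminorm_def sum.distrib[symmetric] by (intro sum_mono norm_triangle_ineq)
  ultimately show ?thesis
    by (simp add: cs_def seminorm_on_def CN_top_eq)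
      (simp add: stage_seminorm_def sum_nonneg norm_mult sum_distrib_left)
qed

interpretation stage: continuous_seminorm "stage_seminorm n" for n
  by unfold_locales (rule stage_seminorm_cs)

text \<open>
  A function of the first \<open>n\<close> coordinates may be evaluated after replacing the other coordinates of \<open>y\<close>
  by those of \<open>x\<close>; the replaced point is close to \<open>x\<close> in every coordinate as soon as the seminorm of
  \<open>y - x\<close> is small.
\<close>

lemma stage_p_entire:
  assumes f: "f \<in> entire" and n: "cyl n f"
  shows "stage.p_entire n f"
  unfolding stage.p_entire_def
proof
  show "\<forall>x y. (\<lambda>z. f (\<lambda>i. x i + z * y i)) holomorphic_on UNIV" using f by (simp add: entire_iff)
  show "stage.p_continuous n f"
    unfolding stage.p_continuous_def
  proof (intro allI impI)
    fix x and e :: real assume e: "e > 0"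
    have o: "open (f -` ball (f x) e)"
      using f by (intro open_vimage open_ball) (simp add: entire_iff)
    have "x \<in> f -` ball (f x) e" using e by simp
    from o this obtain m d where d: "d > 0" "\<And>y. (\<And>i. i < m \<Longrightarrow> cmod (y i - x i) < d) \<Longrightarrow> y \<in> f -` ball (f x) e"
      by (rule open_contains_cylinder) blast
    have "cmod (f y - f x) < e" if y: "stage_seminorm n (\<lambda>i. y i - x i) < d" for y
    proof -
      let ?y = "\<lambda>i. if i < n then y i else x i"
      have "?y \<in> f -` ball (f x) e"
        using d(1) le_less_trans[OF coordinate_le_stage_seminorm y] by (intro d(2)) auto
      moreover have "f ?y = f y" by (rule cylD[OF n]) simp
      ultimately show ?thesis by (simp add: dist_norm norm_minus_commute)
    qed
    then show "\<exists>d>0. \<forall>y. stage_seminorm n (\<lambda>i. y i - x i) < d \<longrightarrow> cmod (f y - f x) < e"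
      using d(1) by blast
  qed
qed

lemma stage_bounded_type:
  assumes f: "f \<in> entire" and n: "cyl n f"
  shows "stage.bounded_type n f"
  unfolding stage.bounded_type_def rapidly_decreasing_def
proof (intro conjI allI impI)
  show fe: "stage.p_entire n f" by (rule stage_p_entire[OF f n])
  fix \<rho> :: real assume \<rho>: "\<rho> > 0"
  obtain B where B: "\<And>x. (\<And>i. i < n \<Longrightarrow> cmod (x i) \<le> \<rho>) \<Longrightarrow> cmod (f x) \<le> B"
    using cyl_bounded[OF f n, of \<rho>] by blast
  have B': "cmod (f x) \<le> B" if x: "stage_seminorm n x \<le> \<rho>" for x
    by (rule B, rule order_trans[OF coordinate_le_stage_seminorm x])
  have "\<rho> ^ m * stage.coeff_norm n f m \<le> B" for m
  proof -
    have "stage.coeff_norm n f m \<le> B / \<rho> ^ m"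
      by (rule stage.coeff_norm_le, rule stage.coeff_bound[OF fe \<rho> B'])
    then show ?thesis using \<rho> by (simp add: field_simps)
  qed
  then show "\<exists>C. \<forall>m. \<rho> ^ m * stage.coeff_norm n f m \<le> C" by blast
qed

text \<open>
  A function of the first \<open>n\<close> coordinates is constant on the cosets, so the choice of a representative
  does not matter.
\<close>

lemma stage_factorisation:
  assumes f: "f \<in> entire" and n: "cyl n f"
  obtains g where "g \<in> Hb (quot CN (stage_seminorm n)) (quot_norm (stage_seminorm n))"
    "\<And>x. g (proj CN (stage_seminorm n) x) = f x"
proof -
  let ?\<pi> = "proj CN (stage_seminorm n)"
  define g where "g = (\<lambda>X\<in>range ?\<pi>. f (SOME x. x \<in> X))"
  have g: "g (?\<pi> x) = f x" for x
  proof -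
    have "(SOME y. y \<in> ?\<pi> x) \<in> ?\<pi> x" by (rule someI[of _ x]) (rule stage.mem_coset)
    then have "stage_seminorm n (\<lambda>i. (SOME y. y \<in> ?\<pi> x) i - x i) = 0"
      by (simp add: stage.coset_eq)
    then have "f (SOME y. y \<in> ?\<pi> x) = f x"
      using coordinate_le_stage_seminorm[of _ n "\<lambda>i. (SOME y. y \<in> ?\<pi> x) i - x i"]
      by (intro cylD[OF n]) auto
    then show ?thesis by (simp add: g_def)
  qed
  have "g \<in> extensional (range ?\<pi>)" by (simp add: g_def)
  then have "g \<in> Hb (quot CN (stage_seminorm n)) (quot_norm (stage_seminorm n))"
    using stage_bounded_type[OF f n] by (simp add: stage.Hb_E_iff g)
  then show thesis using g by (rule that)
qed

lemma Hub_eq_entire: "Hub CN CN_top = entire"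
proof (intro equalityI subsetI)
  fix f assume "f \<in> Hub CN CN_top"
  then obtain p g where p: "p \<in> cs CN CN_top" and g: "g \<in> Hb (quot CN p) (quot_norm p)"
    and f: "f = pullback CN p g"
    unfolding Hub_def by blast
  interpret continuous_seminorm p by unfold_locales (rule p)
  show "f \<in> entire"
    using g p_entire_imp_entire by (simp add: f pullback_eq Hb_E_iff bounded_type_def)
next
  fix f assume f: "f \<in> entire"
  obtain n where n: "cyl n f" using entire_cyl[OF f] .
  obtain g where g: "g \<in> Hb (quot CN (stage_seminorm n)) (quot_norm (stage_seminorm n))"
    "\<And>x. g (proj CN (stage_seminorm n) x) = f x"
    using stage_factorisation[OF f n] by blast
  then have "f = pullback CN (stage_seminorm n) g" by (simp add: stage.pullback_eq)
  then show "f \<in> Hub CN CN_top"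
    unfolding Hub_def using g(1) stage_seminorm_cs by blast
qed

lemma Hub_space_eq: "Hub_space CN CN_top = fun_space UNIV entire"
  by (simp add: Hub_space_def Hub_eq_entire)

section \<open>The topology \<open>\<tau>\<^sub>\<delta>\<close> is the inductive topology\<close>

text \<open>
  The seminorm \<open>p\<close> is dominated by \<open>n\<close> coordinates, so lifts belong to the stage \<open>n\<close> and a polydisc of that
  stage lies in a ball of \<open>p\<close>; on that ball a lift is bounded by its Taylor norms.
\<close>

lemma (in continuous_seminorm) delta_seminorm_pullback:
  assumes "delta_seminorm CN CN_top q"
  obtains \<rho> c where "\<rho> > 0" "c > 0" "\<And>f. bounded_type f \<Longrightarrow> q f \<le> c * weighted_norm \<rho> f"
proof -
  obtain n C where C: "C > 0" "\<And>x r. r \<ge> 0 \<Longrightarrow> (\<And>i. i < n \<Longrightarrow> cmod (x i) \<le> r) \<Longrightarrow> p x \<le> C * r"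
    using dominated by metis
  obtain r c where r: "r > 0" "c > 0" "\<And>f B. f \<in> entire \<Longrightarrow> cyl n f \<Longrightarrow> B \<ge> 0 \<Longrightarrow>
      (\<And>x. (\<And>i. i < n \<Longrightarrow> cmod (x i) \<le> r) \<Longrightarrow> cmod (f x) \<le> B) \<Longrightarrow> q f \<le> c * B"
    using assms unfolding delta_seminorm_iff stage_bounded_def by metis
  have Cr: "C * r > 0" using C(1) r(1) by simp
  have "q f \<le> c * weighted_norm (C * r) f" if f: "bounded_type f" for f
  proof (rule r(3))
    have fe: "p_entire f" using f by (simp add: bounded_type_def)
    show "f \<in> entire" by (rule p_entire_imp_entire[OF fe])
    have bnd: "cmod (f x) \<le> weighted_norm (C * r) f" if "p x \<le> C * r" for x
      using norm_le_weighted_norm[OF f Cr that] .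
    show "cmod (f x) \<le> weighted_norm (C * r) f" if "\<And>i. i < n \<Longrightarrow> cmod (x i) \<le> r" for x
      using that r(1) by (intro bnd C(2)) auto
    show "0 \<le> weighted_norm (C * r) f"
      using order_trans[OF norm_ge_zero bnd[of "\<lambda>n. 0"]] Cr by (simp add: null)
    show "cyl n f"
      unfolding cyl_def
    proof (intro allI impI)
      fix x y :: "nat \<Rightarrow> complex" assume "\<forall>i<n. x i = y i"
      then have "p (\<lambda>i. x i - y i) \<le> 0" using C(2)[of 0 "\<lambda>i. x i - y i"] by simp
      then have xy: "p (\<lambda>i. x i - y i) = 0" using nonneg[of "\<lambda>i. x i - y i"] by linarith
      \<comment> \<open>\<open>x\<close> and \<open>y\<close> lie in the same coset, where a \<open>p\<close>-continuous
        function is constant\<close>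
      have "cmod (f x - f y) < e" if "e > 0" for e
        using fe that xy unfolding p_entire_def p_continuous_def by metis
      from this[of "cmod (f x - f y)"] show "f x = f y" by auto
    qed
  qed
  then show thesis using Cr r(2) that by blast
qed

lemma (in continuous_seminorm) continuous_pullback:
  "continuous_map (Hb_topology E N) (tau_delta CN CN_top) (pullback CN p)"
  unfolding continuous_map_def topspace_tau_delta
proof (intro conjI allI impI)
  have ts: "topspace (Hb_topology E N) = Hb E N"
    using Hb.topspace_seminorm_topology by (simp add: Hb_topology_def)
  show "pullback CN p \<in> topspace (Hb_topology E N) \<rightarrow> entire"
    using p_entire_imp_entire by (auto simp: ts pullback_eq Hb_E_iff bounded_type_def)
  fix U assume U: "openin (tau_delta CN CN_top) U"
  show "openin (Hb_topology E N) {g \<in> topspace (Hb_topology E N). pullback CN p g \<in> U}"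
    unfolding ts unfolding Hb_topology_def Hb.openin_seminorm_topology
  proof (intro conjI ballI)
    fix g assume "g \<in> {g \<in> Hb E N. pullback CN p g \<in> U}"
    then have g: "g \<in> Hb E N" "pullback CN p g \<in> U" by auto
    obtain q r where q: "delta_seminorm CN CN_top q" "r > 0"
      "\<And>f. f \<in> entire \<Longrightarrow> q (\<lambda>x. f x - pullback CN p g x) < r \<Longrightarrow> f \<in> U"
      using tau_delta_contains_ball[OF U g(2)] by blast
    obtain \<rho> c where \<rho>: "\<rho> > 0" "c > 0" "\<And>f. bounded_type f \<Longrightarrow> q f \<le> c * weighted_norm \<rho> f"
      using delta_seminorm_pullback[OF q(1)] by blast
    have "pullback CN p h \<in> U" if h: "h \<in> Hb E N" "Hb_seminorm E N \<rho> (vminus Hb_space h g) < r / c" for h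
    proof (rule q(3))
      have bt: "bounded_type (\<lambda>x. h (coset x))" "bounded_type (\<lambda>x. h (coset x) - g (coset x))"
        using h(1) g(1) by (auto simp: Hb_E_iff intro!: bounded_type_diff)
      show "pullback CN p h \<in> entire"
        using bt(1) p_entire_imp_entire by (simp add: pullback_eq bounded_type_def)
      have "q (\<lambda>x. h (coset x) - g (coset x)) \<le> c * weighted_norm \<rho> (\<lambda>x. h (coset x) - g (coset x))"
        by (rule \<rho>(3)[OF bt(2)])
      also have "\<dots> < c * (r / c)"
        using h(2) \<rho>(2) unfolding Hb_seminorm_diff by (rule mult_strict_left_mono)
      finally show "q (\<lambda>x. pullback CN p h x - pullback CN p g x) < r"
        using \<rho>(2) by (simp add: pullback_eq)
    qed
    then show "\<exists>q\<in>{Hb_seminorm E N \<rho> | \<rho>. 0 < \<rho>}. \<exists>r>0.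
        {h \<in> vcarrier Hb_space. q (vminus Hb_space h g) < r} \<subseteq> {g \<in> Hb E N. pullback CN p g \<in> U}"
      using \<rho>(1,2) q(2)
      by (intro bexI[of _ "Hb_seminorm E N \<rho>"] exI[of _ "r / c"])
        (auto simp: fun_space_simps(1) simp del: fun_space_simps(5))
  qed auto
qed

lemma Hub_admissible_tau_delta: "Hub_admissible CN CN_top (tau_delta CN CN_top)"
  unfolding Hub_admissible_def
proof (intro conjI ballI)
  show "locally_convex_topology (Hub_space CN CN_top) (tau_delta CN CN_top)"
    using delta.locally_convex by (simp add: tau_delta_def Hub_space_eq holo_space_eq)
  fix p assume p: "p \<in> cs CN CN_top"
  interpret continuous_seminorm p by unfold_locales (rule p)
  show "continuous_map (Hb_topology E N) (tau_delta CN CN_top) (pullback CN p)"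
    by (rule continuous_pullback)
qed

text \<open>
  Admissibility applied to the stage seminorm: the preimage of \<open>W\<close> in the corresponding space of functions
  of bounded type contains a ball, and the Taylor norms of \<open>f\<close> are controlled by its supremum over the
  polydisc of twice the radius.
\<close>

lemma admissible_neighbourhood_stage:
  assumes S: "Hub_admissible CN CN_top S" and W: "openin S W" "(\<lambda>x. 0) \<in> W"
  obtains r e where "r > 0" "e > 0"
    "\<And>f. f \<in> entire \<Longrightarrow> cyl n f \<Longrightarrow> (\<And>x. (\<And>i. i < n \<Longrightarrow> cmod (x i) \<le> r) \<Longrightarrow> cmod (f x) \<le> e) \<Longrightarrow> f \<in> W"
proof -
  let ?E = "quot CN (stage_seminorm n)" and ?N = "quot_norm (stage_seminorm n)"
  let ?V = "fun_space (vcarrier ?E) (Hb ?E ?N)"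
  have cont: "continuous_map (Hb_topology ?E ?N) S (pullback CN (stage_seminorm n))"
    using S stage_seminorm_cs by (simp add: Hub_admissible_def)
  have ts: "topspace (Hb_topology ?E ?N) = Hb ?E ?N"
    using stage.Hb.topspace_seminorm_topology[of n] by (simp add: Hb_topology_def)
  \<comment> \<open>the zero function on the quotient, as the factor of \<open>0\<close>\<close>
  obtain z where z: "z \<in> Hb ?E ?N" "\<And>x. z (proj CN (stage_seminorm n) x) = 0"
    using stage_factorisation[OF entire_const[of 0], of n] by (auto simp: cyl_def)
  let ?A = "{g \<in> Hb ?E ?N. pullback CN (stage_seminorm n) g \<in> W}"
  have "openin (Hb_topology ?E ?N) ?A"
    using openin_continuous_map_preimage[OF cont W(1)] by (simp add: ts)
  moreover have "z \<in> ?A" using z W(2) by (simp add: stage.pullback_eq)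
  ultimately have "\<exists>q\<in>{Hb_seminorm ?E ?N \<rho> | \<rho>. 0 < \<rho>}. \<exists>r>0. {g \<in> vcarrier ?V. q (vminus ?V g z) < r} \<subseteq> ?A"
    unfolding Hb_topology_def stage.Hb.openin_seminorm_topology by blast
  then obtain \<rho> r where r: "\<rho> > 0" "r > 0" "{g \<in> vcarrier ?V. Hb_seminorm ?E ?N \<rho> (vminus ?V g z) < r} \<subseteq> ?A"
    by blast
  have "f \<in> W" if f: "f \<in> entire" "cyl n f"
    and B: "\<And>x. (\<And>i. i < n \<Longrightarrow> cmod (x i) \<le> 2 * \<rho>) \<Longrightarrow> cmod (f x) \<le> r / 4" for f
  proof -
    obtain g where g: "g \<in> Hb ?E ?N" "\<And>x. g (proj CN (stage_seminorm n) x) = f x"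
      using stage_factorisation[OF f] by blast
    have B': "cmod (f x) \<le> r / 4" if x: "stage_seminorm n x \<le> 2 * \<rho>" for x
      by (rule B, rule order_trans[OF coordinate_le_stage_seminorm x])
    have "Hb_seminorm ?E ?N \<rho> (vminus ?V g z) = stage.weighted_norm n \<rho> f"
      unfolding stage.Hb_seminorm_diff by (simp add: g(2) z(2))
    also have "\<dots> \<le> 2 * (r / 4)"
      by (rule stage.weighted_norm_le[OF stage_p_entire[OF f] r(1) B'])
    also have "\<dots> < r" using r(2) by simp
    finally have "g \<in> ?A" using r(3) g(1) by auto
    then show "f \<in> W" by (simp add: stage.pullback_eq g(2))
  qed
  then show thesis using that[of "2 * \<rho>" "r / 4"] r by simp
qed

text \<open>
  Local convexity provides a convex neighbourhood \<open>W\<close> of \<open>0\<close> with \<open>f + W \<subseteq> U\<close>. Its balanced core \<open>D\<close>, the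
  functions all of whose multiples by scalars of modulus at most \<open>1\<close> lie in \<open>W\<close>, might not be open, but
  it still contains, for every \<open>n\<close>, the functions of the stage \<open>n\<close> that are small on some polydisc, since
  smallness is not affected by such scalars. Hence its gauge is one of the seminorms that generate \<open>\<tau>\<^sub>\<delta>\<close>.
\<close>

lemma tau_delta_finest:
  assumes S: "Hub_admissible CN CN_top S" and U: "openin S U"
  shows "openin (tau_delta CN CN_top) U"
proof -
  have lc: "locally_convex_topology (fun_space UNIV entire) S"
    using S by (simp add: Hub_admissible_def Hub_space_eq)
  have ts: "topspace S = entire" using lc by (simp add: locally_convex_topology_def)
  have "\<exists>q. delta_seminorm CN CN_top q \<and> (\<exists>r>0. {g \<in> entire. q (\<lambda>x. g x - f x) < r} \<subseteq> U)"
    if fU: "f \<in> U" for f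
  proof -
    have f: "f \<in> entire" using openin_subset[OF U] fU ts by blast
    have "continuous_map S S (\<lambda>g. (\<lambda>(x, y). vadd (fun_space UNIV entire) x y) (f, g))"
    proof (rule continuous_map_compose[unfolded o_def])
      show "continuous_map S (prod_topology S S) (\<lambda>g. (f, g))"
        using f ts by (simp add: continuous_map_paired)
      show "continuous_map (prod_topology S S) S (\<lambda>(x, y). vadd (fun_space UNIV entire) x y)"
        using lc by (simp add: locally_convex_topology_def)
    qed
    from openin_continuous_map_preimage[OF this U]
    have "openin S {g \<in> entire. (\<lambda>x. f x + g x) \<in> U}" by (simp add: ts)
    moreover have "(\<lambda>x. 0) \<in> {g \<in> entire. (\<lambda>x. f x + g x) \<in> U}" using fU by (simp add: entire_const)
    ultimately have "\<exists>W. openin S W \<and> vzero (fun_space UNIV entire) \<in> W \<and>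
        W \<subseteq> {g \<in> entire. (\<lambda>x. f x + g x) \<in> U} \<and> vconvex (fun_space UNIV entire) W"
      using lc unfolding locally_convex_topology_def by simp
    then obtain W where W: "openin S W" "(\<lambda>x. 0) \<in> W" "W \<subseteq> {g \<in> entire. (\<lambda>x. f x + g x) \<in> U}"
      and conv: "vconvex (fun_space UNIV entire) W"
      by auto
    define D where "D = {g \<in> entire. \<forall>c. cmod c \<le> 1 \<longrightarrow> (\<lambda>x. c * g x) \<in> W}"
    have D_stage: "\<exists>r>0. \<exists>e>0. \<forall>g\<in>entire. cyl n g \<longrightarrow>
        (\<forall>x. (\<forall>i<n. cmod (x i) \<le> r) \<longrightarrow> cmod (g x) \<le> e) \<longrightarrow> g \<in> D" for n
    proof -
      obtain r e where r: "r > 0" "e > 0"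
        "\<And>f. f \<in> entire \<Longrightarrow> cyl n f \<Longrightarrow> (\<And>x. (\<And>i. i < n \<Longrightarrow> cmod (x i) \<le> r) \<Longrightarrow> cmod (f x) \<le> e) \<Longrightarrow> f \<in> W"
        using admissible_neighbourhood_stage[OF S W(1,2), of n] by blast
      have "g \<in> D" if g: "g \<in> entire" "cyl n g" "\<forall>x. (\<forall>i<n. cmod (x i) \<le> r) \<longrightarrow> cmod (g x) \<le> e" for g
      proof -
        have "(\<lambda>x. c * g x) \<in> W" if c: "cmod c \<le> 1" for c
        proof (rule r(3))
          show "(\<lambda>x. c * g x) \<in> entire" by (rule entire_scale[OF g(1)])
          show "cyl n (\<lambda>x. c * g x)" using g(2) unfolding cyl_def by metis
          fix x :: "nat \<Rightarrow> complex" assume "\<And>i. i < n \<Longrightarrow> cmod (x i) \<le> r"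
          then have "cmod (g x) \<le> e" using g(3) by blast
          then have "cmod c * cmod (g x) \<le> 1 * e" using c r(2) by (intro mult_mono) auto
          then show "cmod (c * g x) \<le> e" by (simp add: norm_mult)
        qed
        then show ?thesis using g(1) by (simp add: D_def)
      qed
      then show ?thesis using r(1,2) by blast
    qed
    interpret absorbing_disc entire D
    proof
      show "(\<lambda>x. complex_of_real (1 - t) * g x + complex_of_real t * h x) \<in> D"
        if gh: "g \<in> D" "h \<in> D" and t: "0 \<le> t" "t \<le> 1" for g h t
        unfolding D_def
      proof (intro CollectI conjI allI impI)
        show "(\<lambda>x. complex_of_real (1 - t) * g x + complex_of_real t * h x) \<in> entire"
          using gh by (intro entire_add entire_scale) (auto simp: D_def)
        fix c assume c: "cmod c \<le> 1"
        have "(\<lambda>x. c * g x) \<in> W" "(\<lambda>x. c * h x) \<in> W" using gh c by (auto simp: D_def)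
        then have "(\<lambda>x. complex_of_real (1 - t) * (c * g x) + complex_of_real t * (c * h x)) \<in> W"
          using conv t unfolding vconvex_def by (auto simp del: of_real_diff)
        then show "(\<lambda>x. c * (complex_of_real (1 - t) * g x + complex_of_real t * h x)) \<in> W"
          by (simp add: algebra_simps)
      qed
      show "(\<lambda>x. c * g x) \<in> D" if g: "g \<in> D" and c: "cmod c \<le> 1" for g c
        unfolding D_def
      proof (intro CollectI conjI allI impI)
        show "(\<lambda>x. c * g x) \<in> entire" using g by (intro entire_scale) (simp add: D_def)
        fix d assume "cmod d \<le> 1"
        then have "cmod (d * c) \<le> 1" using c by (simp add: norm_mult mult_le_one)
        then have "(\<lambda>x. (d * c) * g x) \<in> W" using g by (simp add: D_def)
        then show "(\<lambda>x. d * (c * g x)) \<in> W" by (simp add: mult.assoc)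
      qed
      show "\<exists>t>0. (\<lambda>x. complex_of_real (1 / t) * g x) \<in> D" if g: "g \<in> entire" for g
      proof -
        obtain n where n: "cyl n g" using entire_cyl[OF g] .
        obtain r e where r: "r > 0" "e > 0" "\<And>g. g \<in> entire \<Longrightarrow> cyl n g \<Longrightarrow>
          \<forall>x. (\<forall>i<n. cmod (x i) \<le> r) \<longrightarrow> cmod (g x) \<le> e \<Longrightarrow> g \<in> D"
          using D_stage[of n] by blast
        obtain B where B: "B \<ge> 0" "\<And>x. (\<And>i. i < n \<Longrightarrow> cmod (x i) \<le> r) \<Longrightarrow> cmod (g x) \<le> B"
          using cyl_bounded[OF g n, of r] by blast
        \<comment> \<open>\<open>B + 1\<close> rather than \<open>B\<close>, to have \<open>t > 0\<close>\<close>
        define t where "t = (B + 1) / e"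
        have t: "t > 0" "B \<le> e * t" using B(1) r(2) by (auto simp: t_def)
        have "(\<lambda>x. complex_of_real (1 / t) * g x) \<in> D"
        proof (rule r(3))
          show "(\<lambda>x. complex_of_real (1 / t) * g x) \<in> entire" by (rule entire_scale[OF g])
          show "cyl n (\<lambda>x. complex_of_real (1 / t) * g x)" using n unfolding cyl_def by metis
          show "\<forall>x. (\<forall>i<n. cmod (x i) \<le> r) \<longrightarrow> cmod (complex_of_real (1 / t) * g x) \<le> e"
          proof (intro allI impI)
            fix x :: "nat \<Rightarrow> complex" assume "\<forall>i<n. cmod (x i) \<le> r"
            then have "cmod (g x) \<le> e * t" using B(2)[of x] t(2) by (meson order_trans)
            then show "cmod (complex_of_real (1 / t) * g x) \<le> e"
              unfolding norm_mult norm_of_real using t(1) by (simp add: field_simps)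
          qed
        qed
        then show ?thesis using t(1) by blast
      qed
    qed (auto simp: D_def entire_add entire_scale)
    have "stage_bounded gauge"
      unfolding stage_bounded_def
    proof
      fix n
      obtain r e where r: "r > 0" "e > 0" "\<And>g. g \<in> entire \<Longrightarrow> cyl n g \<Longrightarrow>
          \<forall>x. (\<forall>i<n. cmod (x i) \<le> r) \<longrightarrow> cmod (g x) \<le> e \<Longrightarrow> g \<in> D"
        using D_stage[of n] by blast
      have "gauge g \<le> 1 / e * B" if g: "g \<in> entire" "cyl n g" and B: "B \<ge> 0"
        "\<forall>x. (\<forall>i<n. cmod (x i) \<le> r) \<longrightarrow> cmod (g x) \<le> B" for g B
      proof (rule field_le_epsilon)
        fix d :: real assume d: "d > 0"
        define t where "t = 1 / e * B + d"
        have t: "t > 0" "B \<le> e * t" using B(1) r(2) d by (auto simp: t_def distrib_left add_nonneg_pos)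
        have "(\<lambda>x. complex_of_real (1 / t) * g x) \<in> D"
        proof (rule r(3))
          show "(\<lambda>x. complex_of_real (1 / t) * g x) \<in> entire" by (rule entire_scale[OF g(1)])
          show "cyl n (\<lambda>x. complex_of_real (1 / t) * g x)" using g(2) unfolding cyl_def by metis
          show "\<forall>x. (\<forall>i<n. cmod (x i) \<le> r) \<longrightarrow> cmod (complex_of_real (1 / t) * g x) \<le> e"
          proof (intro allI impI)
            fix x :: "nat \<Rightarrow> complex" assume "\<forall>i<n. cmod (x i) \<le> r"
            then have "cmod (g x) \<le> e * t" using B(2) t(2) by (meson order_trans)
            then show "cmod (complex_of_real (1 / t) * g x) \<le> e"
              unfolding norm_mult norm_of_real using t(1) by (simp add: field_simps)
          qed
        qed
        then have "t \<in> scales g" using t(1) by (simp add: scales_def)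
        then show "gauge g \<le> 1 / e * B + d" using gauge_le t_def by blast
      qed
      then show "\<exists>r>0. \<exists>c>0. \<forall>f\<in>entire. cyl n f \<longrightarrow>
          (\<forall>B\<ge>0. (\<forall>x. (\<forall>i<n. cmod (x i) \<le> r) \<longrightarrow> cmod (f x) \<le> B) \<longrightarrow> gauge f \<le> c * B)"
        using r(1,2) by (intro exI[of _ r] conjI exI[of _ "1 / e"]) auto
    qed
    then have "delta_seminorm CN CN_top gauge"
      unfolding delta_seminorm_iff holo_space_eq using seminorm_gauge by blast
    moreover have "g \<in> U" if g: "g \<in> entire" "gauge (\<lambda>x. g x - f x) < 1" for g
    proof -
      have "(\<lambda>x. g x - f x) \<in> D" using gauge_less_1 entire_diff[OF g(1) f] g(2) by blast
      then have "\<forall>c. cmod c \<le> 1 \<longrightarrow> (\<lambda>x. c * (g x - f x)) \<in> W" by (simp add: D_def)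
      then have "cmod 1 \<le> 1 \<longrightarrow> (\<lambda>x. 1 * (g x - f x)) \<in> W" by (rule spec)
      then have "(\<lambda>x. 1 * (g x - f x)) \<in> W" by simp
      then have "(\<lambda>x. f x + 1 * (g x - f x)) \<in> U" using W(3) by blast
      then show ?thesis by simp
    qed
    ultimately show ?thesis
      by (intro exI[of _ gauge] conjI exI[of _ 1]) auto
  qed
  then show ?thesis
    unfolding openin_tau_delta using openin_subset[OF U] ts by blast
qed

lemma tau_delta_eq_Hub_topology: "tau_delta CN CN_top = Hub_topology CN CN_top"
  unfolding Hub_topology_def
proof (rule the_equality[symmetric])
  show "Hub_admissible CN CN_top (tau_delta CN CN_top) \<and>
      (\<forall>S'. Hub_admissible CN CN_top S' \<longrightarrow> (\<forall>U. openin S' U \<longrightarrow> openin (tau_delta CN CN_top) U))"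
    using Hub_admissible_tau_delta tau_delta_finest by blast
  fix S assume "Hub_admissible CN CN_top S \<and>
      (\<forall>S'. Hub_admissible CN CN_top S' \<longrightarrow> (\<forall>U. openin S' U \<longrightarrow> openin S U))"
  then show "S = tau_delta CN CN_top"
    unfolding topology_eq using Hub_admissible_tau_delta tau_delta_finest by blast
qed

theorem theorem5p1:
  shows "(tau_zero CN CN_top = tau_omega CN CN_top \<and>
          tau_omega CN CN_top \<noteq> tau_delta CN CN_top \<and>
          holo_space CN CN_top = Hub_space CN CN_top \<and>
          tau_delta CN CN_top = Hub_topology CN CN_top) \<and>
         (\<forall>a \<in> vcarrier CN.
            \<forall>\<tau> \<in> {tau_zero CN CN_top, tau_omega CN CN_top, tau_delta CN CN_top}.
              convolution_operator CN CN_top \<tau> (translation CN a) \<and>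
              \<not> hypercyclic \<tau> (translation CN a))"
proof (intro conjI ballI)
  show "tau_zero CN CN_top = tau_omega CN CN_top" by (rule tau_zero_eq_tau_omega)
  show "tau_omega CN CN_top \<noteq> tau_delta CN CN_top" by (rule tau_omega_neq_tau_delta)
  show "holo_space CN CN_top = Hub_space CN CN_top" by (simp add: holo_space_eq Hub_space_eq)
  show "tau_delta CN CN_top = Hub_topology CN CN_top" by (rule tau_delta_eq_Hub_topology)
  fix a \<tau> assume "\<tau> \<in> {tau_zero CN CN_top, tau_omega CN CN_top, tau_delta CN CN_top}"
  then consider "\<tau> = tau_zero CN CN_top" | "\<tau> = tau_delta CN CN_top"
    using tau_zero_eq_tau_omega by auto
  then have \<tau>: "continuous_map \<tau> \<tau> (translation CN a)" "topspace \<tau> = entire"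
    "\<And>U. openin (tau_zero CN CN_top) U \<Longrightarrow> openin \<tau> U"
    using continuous_translation_zero continuous_translation_delta topspace_tau_delta topspace_tau_omega
      tau_omega_le_tau_delta tau_zero_eq_tau_omega by (cases; simp)+
  show "convolution_operator CN CN_top \<tau> (translation CN a)"
    by (rule convolution_operator_translation[OF \<tau>(1)])
  show "\<not> hypercyclic \<tau> (translation CN a)"
    using \<tau>(3,2) by (rule not_hypercyclic_translation)
qed

end
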